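(* Let $\psi$ be a characteristic generator. (i) The class $\mathcal E(\psi)$ contains an NCD $n$-joint mix for all $n\ge2$ if and only if the class $\mathcal E(\psi)$ is a Gaussian variance mixture family. (ii) The class $\mathcal E(\psi)$ contains an NOD, NSD, or NA $n$-joint mix for all $n\ge2$ if and only if the class $\mathcal E(\psi)$ is Gaussian.
   Context: An $n$-dimensional random vector $\mathbf X$ follows the elliptical distribution $\mathrm E_n(\boldsymbol\mu,\Sigma,\psi)$, with location vector $\boldsymbol\mu\in\mathbb R^n$, positive semi-definite symmetric dispersion matrix $\Sigma\in\mathbb R^{n\times n}$ and characteristic generator $\psi:[0,\infty)\to\mathbb R$, if $\mathbb E[\exp(\mathrm i\mathbf t^\top\mathbf X)]=\exp(\mathrm i\mathbf t^\top\boldsymbol\mu)\,\psi(\mathbf t^\top\Sigma\mathbf t)$ for all $\mathbf t\in\mathbb R^n$. It is non-degenerate if all its marginals are non-degenerate (i.e., not a point mass). $\mathcal E(\psi)$ is the class of all non-degenerate random vectors (of any dimension) following an elliptical distribution with characteristic generator $\psi$. The class $\mathcal E(\psi)$ is Gaussian if its members are Gaussian random vectors. It is a Gaussian variance mixture family if there exists a nonnegative random variable $W$ such that each member $\mathbf X$ of $\mathcal E(\psi)$ is equal in distribution to $\boldsymbol\mu+\sqrt W A\mathbf Z$, where $\boldsymbol\mu\in\mathbb R^n$, $A\in\mathbb R^{n\times k}$ and $\mathbf Z$ is a $k$-dimensional standard Gaussian independent of $W$. An $n$-joint mix is an $n$-dimensional random vector $\mathbf X=(X_1,\dots,X_n)$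 with $\sum_{i=1}^nX_i$ almost surely equal to a constant. Let $\mathbf X^\perp$ be a random vector with independent components such that $X_i^\perp$ has the same distribution as $X_i$ for each $i$. The vector $\mathbf X$ is: NCD (negative correlation dependent) if $\mathrm{Cov}(X_i,X_j)\le0$ for all $i\ne j$; NOD (negative orthant dependent) if $\mathbb P(\mathbf X\le\mathbf t)\le\mathbb P(\mathbf X^\perp\le\mathbf t)$ and $\mathbb P(\mathbf X>\mathbf t)\le\mathbb P(\mathbf X^\perp>\mathbf t)$ for all $\mathbf t\in\mathbb R^n$ (component-wise inequalities); NSD (negative supermodular dependent) if $\mathbb E[\varphi(\mathbf X)]\le\mathbb E[\varphi(\mathbf X^\perp)]$ for all supermodular $\varphi:\mathbb R^n\to\mathbb R$ such that the expectations exist, where supermodular means $\varphi(\mathbf x\wedge\mathbf y)+\varphi(\mathbf x\vee\mathbf y)\ge\varphi(\mathbf x)+\varphi(\mathbf y)$ for all $\mathbf x,\mathbf y\in\mathbb R^n$ (component-wise minimum and maximum); NA (negatively associated) if $\mathrm{Cov}(f(\mathbf X_A),g(\mathbf X_B))\le0$ for any disjoint $A,B\subseteq\{1,\dots,n\}$ and any real-valued coordinate-wise increasing functions $f,g$ such that $f(\mathbf X_A)$ and $g(\mathbf X_B)$ have finite second moments, where $\mathbf X_A=(X_i)_{i\in A}$.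
   Formalization: In (i), the "if" direction is proved only when all members of E(ψ) have finite second moments; without this it fails (e.g. multivariate Cauchy, where covariances do not exist). A characteristic generator is taken to be one with E(ψ) nonempty. *)

theory Defs
  imports "HOL-Probability.Probability"
begin

text \<open>
  Vectors in \<open>\<real>\<^sup>n\<close> are functions \<open>nat \<Rightarrow> real\<close> with coordinates \<open>0, \<dots>, n - 1\<close>, because the
  dimension is quantified inside the statement. As usual for \<open>PiM\<close>, points of the measurable space
  \<open>\<real>\<^sup>n\<close> are extensional (equal to \<open>undefined\<close> outside \<open>{..<n}\<close>).
\<close>

abbreviation borel_vec :: "nat \<Rightarrow> (nat \<Rightarrow> real) measure" where
  "borel_vec n \<equiv> PiM {..<n} (\<lambda>_. borel)"

definition random_vector :: "nat \<Rightarrow> 'a measure \<Rightarrow> ('a \<Rightarrow> nat \<Rightarrow> real) \<Rightarrow> bool" where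
  "random_vector n M X \<longleftrightarrow> prob_space M \<and> X \<in> measurable M (borel_vec n)"

definition nondegenerate :: "nat \<Rightarrow> 'a measure \<Rightarrow> ('a \<Rightarrow> nat \<Rightarrow> real) \<Rightarrow> bool" where
  "nondegenerate n M X \<longleftrightarrow> (\<forall>i<n. \<not> (\<exists>c. AE \<omega> in M. X \<omega> i = c))"

definition quad_form :: "nat \<Rightarrow> (nat \<Rightarrow> nat \<Rightarrow> real) \<Rightarrow> (nat \<Rightarrow> real) \<Rightarrow> real" where
  "quad_form n \<Sigma> t = (\<Sum>i<n. \<Sum>j<n. t i * \<Sigma> i j * t j)"

definition psd_symmetric :: "nat \<Rightarrow> (nat \<Rightarrow> nat \<Rightarrow> real) \<Rightarrow> bool" where
  "psd_symmetric n \<Sigma> \<longleftrightarrow> (\<forall>i<n. \<forall>j<n. \<Sigma> i j = \<Sigma> j i) \<and> (\<forall>t. 0 \<le> quad_form n \<Sigma> t)"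

text \<open>The generator \<open>\<psi>\<close> is only ever evaluated on \<open>[0, \<infinity>)\<close>.\<close>

definition elliptical ::
    "nat \<Rightarrow> (nat \<Rightarrow> real) \<Rightarrow> (nat \<Rightarrow> nat \<Rightarrow> real) \<Rightarrow> (real \<Rightarrow> real) \<Rightarrow> 'a measure \<Rightarrow> ('a \<Rightarrow> nat \<Rightarrow> real) \<Rightarrow> bool" where
  "elliptical n \<mu> \<Sigma> \<psi> M X \<longleftrightarrow>
     random_vector n M X \<and> psd_symmetric n \<Sigma> \<and>
     (\<forall>t::nat \<Rightarrow> real. (CLINT \<omega>|M. iexp (\<Sum>i<n. t i * X \<omega> i)) =
        iexp (\<Sum>i<n. t i * \<mu> i) * complex_of_real (\<psi> (quad_form n \<Sigma> t)))"

definition in_elliptical_class :: "(real \<Rightarrow> real) \<Rightarrow> nat \<Rightarrow> 'a measure \<Rightarrow> ('a \<Rightarrow> nat \<Rightarrow> real) \<Rightarrow> bool" where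
  "in_elliptical_class \<psi> n M X \<longleftrightarrow>
     1 \<le> n \<and> nondegenerate n M X \<and> (\<exists>\<mu> \<Sigma>. elliptical n \<mu> \<Sigma> \<psi> M X)"

text \<open>
  Quantification over all random vectors in the class needs a fixed type of outcomes. The type
  \<open>nat \<Rightarrow> real\<close> is no restriction: every \<open>n\<close>-dimensional random vector has the same distribution as
  the identity on the probability space formed by its own law, which lives on that type.

  A characteristic generator is one whose class is nonempty. Point masses must not count as
  witnesses: they satisfy the elliptical equation with \<open>\<Sigma> = 0\<close> for every \<open>\<psi>\<close> with \<open>\<psi> 0 = 1\<close>.
\<close>

definition characteristic_generator :: "(real \<Rightarrow> real) \<Rightarrow> bool" where
  "characteristic_generator \<psi> \<longleftrightarrow>
     (\<exists>n (M :: (nat \<Rightarrow> real) measure) X. in_elliptical_class \<psi> n M X)"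

definition class_square_integrable :: "(real \<Rightarrow> real) \<Rightarrow> bool" where
  "class_square_integrable \<psi> \<longleftrightarrow>
     (\<forall>n (M :: (nat \<Rightarrow> real) measure) X. in_elliptical_class \<psi> n M X \<longrightarrow>
        (\<forall>i<n. integrable M (\<lambda>\<omega>. (X \<omega> i)\<^sup>2)))"

text \<open>The library's \<open>indep_var\<close> forces both variables to have the same value type.\<close>

definition independent_rvs ::
    "'a measure \<Rightarrow> 'b measure \<Rightarrow> ('a \<Rightarrow> 'b) \<Rightarrow> 'c measure \<Rightarrow> ('a \<Rightarrow> 'c) \<Rightarrow> bool" where
  "independent_rvs Q N U L V \<longleftrightarrow>
     U \<in> measurable Q N \<and> V \<in> measurable Q L \<and>
     prob_space.indep_set Q {U -` S \<inter> space Q | S. S \<in> sets N} {V -` S \<inter> space Q | S. S \<in> sets L}"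

definition std_gaussian_vector :: "nat \<Rightarrow> 'a measure \<Rightarrow> ('a \<Rightarrow> nat \<Rightarrow> real) \<Rightarrow> bool" where
  "std_gaussian_vector k M Z \<longleftrightarrow>
     random_vector k M Z \<and> distr M (borel_vec k) Z = PiM {..<k} (\<lambda>_. std_normal_distribution)"

definition affine_vec ::
    "nat \<Rightarrow> nat \<Rightarrow> (nat \<Rightarrow> real) \<Rightarrow> (nat \<Rightarrow> nat \<Rightarrow> real) \<Rightarrow> real \<Rightarrow> (nat \<Rightarrow> real) \<Rightarrow> nat \<Rightarrow> real" where
  "affine_vec n k \<mu> A s z = (\<lambda>i\<in>{..<n}. \<mu> i + s * (\<Sum>j<k. A i j * z j))"

definition gaussian_vector :: "nat \<Rightarrow> 'a measure \<Rightarrow> ('a \<Rightarrow> nat \<Rightarrow> real) \<Rightarrow> bool" where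
  "gaussian_vector n M X \<longleftrightarrow> random_vector n M X \<and>
     (\<exists>\<mu> k A (Q :: (nat \<Rightarrow> real) measure) Z.
        std_gaussian_vector k Q Z \<and>
        distr M (borel_vec n) X = distr Q (borel_vec n) (\<lambda>q. affine_vec n k \<mu> A 1 (Z q)))"

definition gaussian_class :: "(real \<Rightarrow> real) \<Rightarrow> bool" where
  "gaussian_class \<psi> \<longleftrightarrow>
     (\<forall>n (M :: (nat \<Rightarrow> real) measure) X. in_elliptical_class \<psi> n M X \<longrightarrow> gaussian_vector n M X)"

text \<open>
  The mixing variable enters through its law \<open>\<nu>\<close>, chosen once for the whole class. For each member,
  \<open>W\<close> with law \<open>\<nu>\<close> and an independent \<open>Z\<close> of the required dimension are then taken on a common
  probability space.
\<close>

definition gaussian_variance_mixture_family :: "(real \<Rightarrow> real) \<Rightarrow> bool" where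
  "gaussian_variance_mixture_family \<psi> \<longleftrightarrow>
     (\<exists>\<nu> :: real measure. prob_space \<nu> \<and> sets \<nu> = sets borel \<and> (AE w in \<nu>. 0 \<le> w) \<and>
       (\<forall>n (M :: (nat \<Rightarrow> real) measure) X. in_elliptical_class \<psi> n M X \<longrightarrow>
         (\<exists>\<mu> k A (Q :: (real \<times> (nat \<Rightarrow> real)) measure) W Z.
            W \<in> borel_measurable Q \<and> distr Q borel W = \<nu> \<and>
            std_gaussian_vector k Q Z \<and>
            independent_rvs Q borel W (borel_vec k) Z \<and>
            distr M (borel_vec n) X =
              distr Q (borel_vec n) (\<lambda>q. affine_vec n k \<mu> A (sqrt (W q)) (Z q)))))"

definition joint_mix :: "nat \<Rightarrow> 'a measure \<Rightarrow> ('a \<Rightarrow> nat \<Rightarrow> real) \<Rightarrow> bool" where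
  "joint_mix n M X \<longleftrightarrow> random_vector n M X \<and> (\<exists>c. AE \<omega> in M. (\<Sum>i<n. X \<omega> i) = c)"

text \<open>The law of \<open>X\<^sup>\<bottom>\<close>: independent components with the marginals of \<open>X\<close>.\<close>

definition indep_law :: "nat \<Rightarrow> 'a measure \<Rightarrow> ('a \<Rightarrow> nat \<Rightarrow> real) \<Rightarrow> (nat \<Rightarrow> real) measure" where
  "indep_law n M X = PiM {..<n} (\<lambda>i. distr M borel (\<lambda>\<omega>. X \<omega> i))"

definition covariance :: "'a measure \<Rightarrow> ('a \<Rightarrow> real) \<Rightarrow> ('a \<Rightarrow> real) \<Rightarrow> real" where
  "covariance M U V =
     (LINT \<omega>|M. (U \<omega> - (LINT \<omega>'|M. U \<omega>')) * (V \<omega> - (LINT \<omega>'|M. V \<omega>')))"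

text \<open>
  The Bochner integral of a non-integrable function is \<open>0\<close>, so the existence of the covariance
  has to be required explicitly.
\<close>

definition covariance_exists :: "'a measure \<Rightarrow> ('a \<Rightarrow> real) \<Rightarrow> ('a \<Rightarrow> real) \<Rightarrow> bool" where
  "covariance_exists M U V \<longleftrightarrow>
     integrable M U \<and> integrable M V \<and> integrable M (\<lambda>\<omega>. U \<omega> * V \<omega>)"

definition NCD :: "nat \<Rightarrow> 'a measure \<Rightarrow> ('a \<Rightarrow> nat \<Rightarrow> real) \<Rightarrow> bool" where
  "NCD n M X \<longleftrightarrow>
     (\<forall>i<n. \<forall>j<n. i \<noteq> j \<longrightarrow>
        covariance_exists M (\<lambda>\<omega>. X \<omega> i) (\<lambda>\<omega>. X \<omega> j) \<and>
        covariance M (\<lambda>\<omega>. X \<omega> i) (\<lambda>\<omega>. X \<omega> j) \<le> 0)"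

definition NOD :: "nat \<Rightarrow> 'a measure \<Rightarrow> ('a \<Rightarrow> nat \<Rightarrow> real) \<Rightarrow> bool" where
  "NOD n M X \<longleftrightarrow>
     (\<forall>t::nat \<Rightarrow> real.
        measure M {\<omega> \<in> space M. \<forall>i<n. X \<omega> i \<le> t i}
          \<le> measure (indep_law n M X) {x \<in> space (indep_law n M X). \<forall>i<n. x i \<le> t i} \<and>
        measure M {\<omega> \<in> space M. \<forall>i<n. X \<omega> i > t i}
          \<le> measure (indep_law n M X) {x \<in> space (indep_law n M X). \<forall>i<n. x i > t i})"

text \<open>
  For functions, \<open>inf\<close> and \<open>sup\<close> are the component-wise minimum and maximum; both preserve
  extensionality.
\<close>

definition supermodular :: "nat \<Rightarrow> ((nat \<Rightarrow> real) \<Rightarrow> real) \<Rightarrow> bool" where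
  "supermodular n \<phi> \<longleftrightarrow>
     (\<forall>x \<in> {..<n} \<rightarrow>\<^sub>E UNIV. \<forall>y \<in> {..<n} \<rightarrow>\<^sub>E UNIV. \<phi> (inf x y) + \<phi> (sup x y) \<ge> \<phi> x + \<phi> y)"

definition NSD :: "nat \<Rightarrow> 'a measure \<Rightarrow> ('a \<Rightarrow> nat \<Rightarrow> real) \<Rightarrow> bool" where
  "NSD n M X \<longleftrightarrow>
     (\<forall>\<phi>. supermodular n \<phi> \<longrightarrow>
        integrable M (\<lambda>\<omega>. \<phi> (X \<omega>)) \<longrightarrow> integrable (indep_law n M X) \<phi> \<longrightarrow>
        (LINT \<omega>|M. \<phi> (X \<omega>)) \<le> (LINT x|indep_law n M X. \<phi> x))"

definition coordwise_increasing :: "nat set \<Rightarrow> ((nat \<Rightarrow> real) \<Rightarrow> real) \<Rightarrow> bool" where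
  "coordwise_increasing A f \<longleftrightarrow>
     (\<forall>x \<in> A \<rightarrow>\<^sub>E UNIV. \<forall>y \<in> A \<rightarrow>\<^sub>E UNIV. (\<forall>i\<in>A. x i \<le> y i) \<longrightarrow> f x \<le> f y)"

definition finite_second_moment :: "'a measure \<Rightarrow> ('a \<Rightarrow> real) \<Rightarrow> bool" where
  "finite_second_moment M U \<longleftrightarrow> U \<in> borel_measurable M \<and> integrable M (\<lambda>\<omega>. (U \<omega>)\<^sup>2)"

definition NA :: "nat \<Rightarrow> 'a measure \<Rightarrow> ('a \<Rightarrow> nat \<Rightarrow> real) \<Rightarrow> bool" where
  "NA n M X \<longleftrightarrow>
     (\<forall>A B f g. A \<subseteq> {..<n} \<longrightarrow> B \<subseteq> {..<n} \<longrightarrow> A \<inter> B = {} \<longrightarrow>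
        coordwise_increasing A f \<longrightarrow> coordwise_increasing B g \<longrightarrow>
        finite_second_moment M (\<lambda>\<omega>. f (restrict (X \<omega>) A)) \<longrightarrow>
        finite_second_moment M (\<lambda>\<omega>. g (restrict (X \<omega>) B)) \<longrightarrow>
        covariance M (\<lambda>\<omega>. f (restrict (X \<omega>) A)) (\<lambda>\<omega>. g (restrict (X \<omega>) B)) \<le> 0)"

definition class_contains_joint_mix ::
    "(real \<Rightarrow> real) \<Rightarrow> (nat \<Rightarrow> (nat \<Rightarrow> real) measure \<Rightarrow> ((nat \<Rightarrow> real) \<Rightarrow> nat \<Rightarrow> real) \<Rightarrow> bool) \<Rightarrow> nat \<Rightarrow> bool" where
  "class_contains_joint_mix \<psi> dep n \<longleftrightarrow>
     (\<exists>M X. in_elliptical_class \<psi> n M X \<and> joint_mix n M X \<and> dep n M X)"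

end

theory Submission
  imports Defs
begin

text \<open>
  Let \<open>Y\<^sub>i = (X\<^sub>i - \<mu>\<^sub>i) / \<surd>\<Sigma>\<^sub>i\<^sub>i\<close> be the standardised components of an \<open>n\<close>-dimensional member of the class and let
  \<open>Z\<close> be an independent standard Gaussian vector. Evaluating \<open>E exp(i \<surd>(u/n) \<Sum> Z\<^sub>i Y\<^sub>i)\<close> in the two possible
  orders gives \<open>E exp(- u W\<^sub>n / 2) = E \<psi>(u Q\<^sub>n)\<close>, where \<open>W\<^sub>n\<close> is the mean of the \<open>Y\<^sub>i\<^sup>2\<close> and \<open>Q\<^sub>n\<close> is a Gaussian
  quadratic form with mean 1. If \<open>\<Sigma>\<close> has nonpositive off-diagonal entries, the variance of \<open>Q\<^sub>n\<close> is at
  most \<open>4/n\<close>, so the left-hand side tends to \<open>\<psi>(u)\<close>. For NCD joint mixes, \<open>\<psi>\<close> is thus a limit of Laplace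
  transforms and hence a Laplace transform, which is the variance mixture property.

  NOD, NSD and NA all imply pairwise negative quadrant dependence, which again makes the off-diagonal
  entries of \<open>\<Sigma>\<close> nonpositive, and moreover makes averages of bounded monotone functions of the \<open>Y\<^sub>i\<close>
  concentrate. Hence \<open>W\<^sub>n\<close> is asymptotically constant: truncation gives \<open>\<psi>(u) \<le> exp(- u v / 2)\<close> with
  \<open>v = E Y\<^sub>1\<^sup>2\<close>, and Jensen's inequality gives the converse.

  For existence take \<open>X = (Z\<^sub>1, \<dots>, Z\<^sub>m, - (Z\<^sub>1 + \<dots> + Z\<^sub>m))\<close> with \<open>Z\<close> spherical. If the \<open>Z\<^sub>k\<close> are independent,
  exchanging single coordinates of \<open>Z\<close> with those of an independent copy yields both NSD and NA.
\<close>

section \<open>Uniqueness of characteristic functions of random vectors\<close>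

text \<open>In part (ii) the dependence notions come with no moment assumption, so covariances of
  the components need not exist, while the dispersion matrix acts through quadratic quantities.
  Hence the signs of its entries are read off from arctangents and the squares are truncated; that
  the second moment is finite comes out only at the end, from the continuity of \<psi> at 0. In part
  (i) the second moment is recovered from the constant sum, since NCD speaks only of pairs of
  different components. The converse of (i) is stated under square integrability because NCD asks
  for existing covariances, and a variance mixture may have none, as the Cauchy generator exp (-
  sqrt u) shows. The variance bound 4/n rests on one fact: the off-diagonal entries of a correlation
  matrix sum to at least - n, so if all of them are nonpositive, the squares of all entries sum to
  at most 2 n.\<close>

lemma weighted_char_unique:
  fixes X H :: "'a \<Rightarrow> real" and Y K :: "'b \<Rightarrow> real"
  assumes M: "prob_space M" and N: "prob_space N"
  assumes [measurable]: "X \<in> borel_measurable M" "H \<in> borel_measurable M"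
    "Y \<in> borel_measurable N" "K \<in> borel_measurable N"
  assumes H: "\<And>\<omega>. 0 \<le> H \<omega>" "\<And>\<omega>. H \<omega> \<le> C" and K: "\<And>\<omega>. 0 \<le> K \<omega>" "\<And>\<omega>. K \<omega> \<le> C"
  assumes eq: "\<And>s. (CLINT \<omega>|M. of_real (H \<omega>) * iexp (s * X \<omega>)) =
    (CLINT \<omega>|N. of_real (K \<omega>) * iexp (s * Y \<omega>))"
  assumes [measurable]: "B \<in> sets borel"
  shows "(LINT \<omega>|M. H \<omega> * indicator B (X \<omega>)) = (LINT \<omega>|N. K \<omega> * indicator B (Y \<omega>))"
proof -
  interpret M: prob_space M by fact
  interpret N: prob_space N by fact
  define c where "c = (LINT \<omega>|M. H \<omega>)"
  have iH: "integrable M H" by (rule M.integrable_const_bound[of _ C]) (use H in auto)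
  have iK: "integrable N K" by (rule N.integrable_const_bound[of _ C]) (use K in auto)
  have cK: "c = (LINT \<omega>|N. K \<omega>)"
    using eq[of 0] by (simp add: c_def)
  have c0: "0 \<le> c" unfolding c_def using H by (intro integral_nonneg_AE) auto
  show ?thesis
  \<comment> \<open>At s = 0 the hypothesis shows that both weights have total mass c. For c > 0 the
    weights divided by c are densities, and Levy's uniqueness theorem compares the images of the
    resulting laws; c = 0 is treated apart because this division fails.\<close>
  proof (cases "c = 0")
    case True
    have "AE \<omega> in M. H \<omega> = 0"
      using True integral_nonneg_eq_0_iff_AE[OF iH] H unfolding c_def by auto
    then have "(LINT \<omega>|M. H \<omega> * indicator B (X \<omega>)) = (LINT \<omega>|M. 0)"
      by (intro integral_cong_AE) auto
    moreover have "AE \<omega> in N. K \<omega> = 0"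
      using True integral_nonneg_eq_0_iff_AE[OF iK] K unfolding cK by auto
    then have "(LINT \<omega>|N. K \<omega> * indicator B (Y \<omega>)) = (LINT \<omega>|N. 0)"
      by (intro integral_cong_AE) auto
    ultimately show ?thesis by simp
  next
    case False
    then have c: "c > 0" using c0 by auto
    define P where "P = distr (density M (\<lambda>\<omega>. H \<omega> / c)) borel X"
    define Q where "Q = distr (density N (\<lambda>\<omega>. K \<omega> / c)) borel Y"
    have "prob_space (density M (\<lambda>\<omega>. H \<omega> / c))"
    proof (rule prob_spaceI)
      have "emeasure (density M (\<lambda>\<omega>. H \<omega> / c)) (space (density M (\<lambda>\<omega>. H \<omega> / c)))
          = (\<integral>\<^sup>+\<omega>. ennreal (H \<omega> / c) \<partial>M)"
        by (auto simp: emeasure_density intro!: nn_integral_cong)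
      also have "\<dots> = ennreal (LINT \<omega>|M. H \<omega> / c)"
        using iH H c by (intro nn_integral_eq_integral) auto
      also have "\<dots> = 1" using c by (simp add: c_def)
      finally show "emeasure (density M (\<lambda>\<omega>. H \<omega> / c)) (space (density M (\<lambda>\<omega>. H \<omega> / c))) = 1" .
    qed
    then have P: "real_distribution P"
      unfolding P_def by (intro prob_space.real_distribution_distr) auto
    have "prob_space (density N (\<lambda>\<omega>. K \<omega> / c))"
    proof (rule prob_spaceI)
      have "emeasure (density N (\<lambda>\<omega>. K \<omega> / c)) (space (density N (\<lambda>\<omega>. K \<omega> / c)))
          = (\<integral>\<^sup>+\<omega>. ennreal (K \<omega> / c) \<partial>N)"
        by (auto simp: emeasure_density intro!: nn_integral_cong)
      also have "\<dots> = ennreal (LINT \<omega>|N. K \<omega> / c)"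
        using iK K c by (intro nn_integral_eq_integral) auto
      also have "\<dots> = 1" using c by (simp add: cK)
      finally show "emeasure (density N (\<lambda>\<omega>. K \<omega> / c)) (space (density N (\<lambda>\<omega>. K \<omega> / c))) = 1" .
    qed
    then have Q: "real_distribution Q"
      unfolding Q_def by (intro prob_space.real_distribution_distr) auto
    have Pint: "(LINT x|P. f x) = (1 / c) *\<^sub>R (LINT \<omega>|M. H \<omega> *\<^sub>R f (X \<omega>))"
      if [measurable]: "f \<in> borel_measurable borel"
      for f :: "real \<Rightarrow> 'z::{banach,second_countable_topology}"
      using c H unfolding P_def
      by (subst integral_distr, simp, simp, subst integral_density)
        (auto simp: divide_inverse_commute simp flip: scaleR_scaleR)
    have Qint: "(LINT x|Q. f x) = (1 / c) *\<^sub>R (LINT \<omega>|N. K \<omega> *\<^sub>R f (Y \<omega>))"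
      if [measurable]: "f \<in> borel_measurable borel"
      for f :: "real \<Rightarrow> 'z::{banach,second_countable_topology}"
      using c K unfolding Q_def
      by (subst integral_distr, simp, simp, subst integral_density)
        (auto simp: divide_inverse_commute simp flip: scaleR_scaleR)
    have "char P = char Q"
    proof
      fix t show "char P t = char Q t"
        unfolding char_def using eq[of t] by (subst Pint, simp, subst Qint, simp) (simp add: scaleR_conv_of_real)
    qed
    then have "P = Q" by (intro Levy_uniqueness P Q)
    then have "(LINT x|P. indicator B x :: real) = (LINT x|Q. indicator B x)" by simp
    then show ?thesis using c by (subst (asm) Pint, simp, subst (asm) Qint, simp) simp
  qed
qed

text \<open>The phase iexp V is no density, but 1 + cos (V + \<theta>) is a nonnegative weight.
  Euler's formula expresses integrals against it by the joint transform of X and V at the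
  frequencies r = 0, 1, -1.\<close>

lemma (in prob_space) cos_weighted_char:
  fixes X V p :: "'a \<Rightarrow> real"
  assumes [measurable]: "X \<in> borel_measurable M" "V \<in> borel_measurable M" "p \<in> borel_measurable M"
  assumes p: "\<And>\<omega>. 0 \<le> p \<omega>" "\<And>\<omega>. p \<omega> \<le> 1"
  shows "(CLINT \<omega>|M. of_real (p \<omega> * (1 + cos (V \<omega> + \<theta>))) * iexp (s * X \<omega>))
      = (CLINT \<omega>|M. of_real (p \<omega>) * iexp (s * X \<omega> + 0 * V \<omega>))
       + iexp \<theta> / 2 * (CLINT \<omega>|M. of_real (p \<omega>) * iexp (s * X \<omega> + 1 * V \<omega>))
       + iexp (-\<theta>) / 2 * (CLINT \<omega>|M. of_real (p \<omega>) * iexp (s * X \<omega> + (-1) * V \<omega>))"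
proof -
  have i: "integrable M (\<lambda>\<omega>. of_real (p \<omega>) * iexp (s * X \<omega> + r * V \<omega>))" for r
    using p by (intro integrable_const_bound[of _ 1])
      (auto simp: norm_mult simp del: of_real_add of_real_mult)
  have "(CLINT \<omega>|M. of_real (p \<omega> * (1 + cos (V \<omega> + \<theta>))) * iexp (s * X \<omega>))
    = (CLINT \<omega>|M. of_real (p \<omega>) * iexp (s * X \<omega> + 0 * V \<omega>)
     + iexp \<theta> / 2 * (of_real (p \<omega>) * iexp (s * X \<omega> + 1 * V \<omega>))
     + iexp (-\<theta>) / 2 * (of_real (p \<omega>) * iexp (s * X \<omega> + (-1) * V \<omega>)))"
    by (intro Bochner_Integration.integral_cong refl)
      (simp add: cos_of_real[symmetric] cos_exp_eq del: cos_of_real,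
       simp add: field_simps exp_add[symmetric] exp_diff exp_minus)
  then show ?thesis
    by (simp only: Bochner_Integration.integral_add Bochner_Integration.integrable_add
      integrable_mult_right integral_mult_right_zero i)
qed

text \<open>The exchange step for \<open>char_unique_vec\<close>: one coordinate moves from a phase
  to an indicator while V keeps the remaining phases. The weights p (1 + cos (V + \<theta>)) fall
  under \<open>weighted_char_unique\<close>; removing the part without cosine and taking \<theta> =
  0 and \<theta> = - pi / 2 recovers the real and imaginary parts of iexp V.\<close>

lemma phase_char_unique:
  fixes X V p :: "'a \<Rightarrow> real" and Y W q :: "'b \<Rightarrow> real"
  assumes M: "prob_space M" and N: "prob_space N"
  assumes [measurable]: "X \<in> borel_measurable M" "V \<in> borel_measurable M" "p \<in> borel_measurable M"
    "Y \<in> borel_measurable N" "W \<in> borel_measurable N" "q \<in> borel_measurable N"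
  assumes p: "\<And>\<omega>. 0 \<le> p \<omega>" "\<And>\<omega>. p \<omega> \<le> 1" and q: "\<And>\<omega>. 0 \<le> q \<omega>" "\<And>\<omega>. q \<omega> \<le> 1"
  assumes eq: "\<And>s r. (CLINT \<omega>|M. of_real (p \<omega>) * iexp (s * X \<omega> + r * V \<omega>)) =
    (CLINT \<omega>|N. of_real (q \<omega>) * iexp (s * Y \<omega> + r * W \<omega>))"
  assumes [measurable]: "B \<in> sets borel"
  shows "(CLINT \<omega>|M. of_real (p \<omega> * indicator B (X \<omega>)) * iexp (V \<omega>)) =
    (CLINT \<omega>|N. of_real (q \<omega> * indicator B (Y \<omega>)) * iexp (W \<omega>))"
proof -
  interpret M: prob_space M by fact
  interpret N: prob_space N by fact
  have bd: "\<bar>a * indicator B b * cos d\<bar> \<le> 1" "\<bar>a * indicator B b\<bar> \<le> 1" "a * indicator B b \<le> 1" "0 \<le> 1 + cos d"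
    "0 \<le> a * (1 + cos d)" "a * (1 + cos d) \<le> 2"
    if "0 \<le> a" "a \<le> 1" for a b d :: real
  proof -
    show c: "0 \<le> 1 + cos d" using cos_ge_minus_one[of d] by linarith
    then show "0 \<le> a * (1 + cos d)" using that by simp
    have "a * (1 + cos d) \<le> 1 * 2" using c that cos_le_one[of d] by (intro mult_mono) auto
    then show "a * (1 + cos d) \<le> 2" by simp
    show "a * indicator B b \<le> 1" using that by (auto simp: indicator_def)
    show "\<bar>a * indicator B b\<bar> \<le> 1" using that by (auto simp: indicator_def)
    then have "\<bar>a * indicator B b\<bar> * \<bar>cos d\<bar> \<le> 1 * 1" by (intro mult_mono) auto
    then show "\<bar>a * indicator B b * cos d\<bar> \<le> 1" by (simp add: abs_mult)
  qed
  have 1: "(LINT \<omega>|M. p \<omega> * (1 + cos (V \<omega> + \<theta>)) * indicator B (X \<omega>)) =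
    (LINT \<omega>|N. q \<omega> * (1 + cos (W \<omega> + \<theta>)) * indicator B (Y \<omega>))" for \<theta>
  proof (rule weighted_char_unique[where C = 2])
    fix s show "(CLINT \<omega>|M. of_real (p \<omega> * (1 + cos (V \<omega> + \<theta>))) * iexp (s * X \<omega>)) =
      (CLINT \<omega>|N. of_real (q \<omega> * (1 + cos (W \<omega> + \<theta>))) * iexp (s * Y \<omega>))"
      unfolding M.cos_weighted_char[OF assms(3,4,5) p] N.cos_weighted_char[OF assms(6,7,8) q] eq ..
  qed (simp_all add: M N bd p q)
  have 2: "(LINT \<omega>|M. p \<omega> * indicator B (X \<omega>)) = (LINT \<omega>|N. q \<omega> * indicator B (Y \<omega>))"
  proof (rule weighted_char_unique[where C = 1])
    fix s show "(CLINT \<omega>|M. of_real (p \<omega>) * iexp (s * X \<omega>)) = (CLINT \<omega>|N. of_real (q \<omega>) * iexp (s * Y \<omega>))"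
      using eq[of s 0] by (simp only: mult_zero_left add_0_right)
  qed (simp_all add: M N p q)
  have iM: "integrable M (\<lambda>\<omega>. p \<omega> * indicator B (X \<omega>))"
      "integrable M (\<lambda>\<omega>. p \<omega> * indicator B (X \<omega>) * cos (V \<omega> + \<theta>))" for \<theta>
    by (rule M.integrable_const_bound[of _ 1]; simp add: bd p)+
  have iN: "integrable N (\<lambda>\<omega>. q \<omega> * indicator B (Y \<omega>))"
      "integrable N (\<lambda>\<omega>. q \<omega> * indicator B (Y \<omega>) * cos (W \<omega> + \<theta>))" for \<theta>
    by (rule N.integrable_const_bound[of _ 1]; simp add: bd q)+
  have 3: "(LINT \<omega>|M. p \<omega> * indicator B (X \<omega>) * cos (V \<omega> + \<theta>)) =
      (LINT \<omega>|N. q \<omega> * indicator B (Y \<omega>) * cos (W \<omega> + \<theta>))" for \<theta>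
  proof -
    have "(LINT \<omega>|M. p \<omega> * (1 + cos (V \<omega> + \<theta>)) * indicator B (X \<omega>)) =
      (LINT \<omega>|M. p \<omega> * indicator B (X \<omega>)) + (LINT \<omega>|M. p \<omega> * indicator B (X \<omega>) * cos (V \<omega> + \<theta>))"
      unfolding Bochner_Integration.integral_add[OF iM, symmetric]
      by (intro Bochner_Integration.integral_cong refl) (simp only: distrib_left distrib_right mult_1_right mult.assoc mult.commute[of "indicator _ _"])
    moreover have "(LINT \<omega>|N. q \<omega> * (1 + cos (W \<omega> + \<theta>)) * indicator B (Y \<omega>)) =
      (LINT \<omega>|N. q \<omega> * indicator B (Y \<omega>)) + (LINT \<omega>|N. q \<omega> * indicator B (Y \<omega>) * cos (W \<omega> + \<theta>))"
      unfolding Bochner_Integration.integral_add[OF iN, symmetric]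
      by (intro Bochner_Integration.integral_cong refl) (simp only: distrib_left distrib_right mult_1_right mult.assoc mult.commute[of "indicator _ _"])
    ultimately show ?thesis using 1[of \<theta>] 2 by simp
  qed
  have sin: "cos (x + - pi / 2) = sin x" for x :: real by (simp add: cos_diff)
  have s: "(of_real (p * i) :: complex) * iexp v =
     of_real (p * i * cos (v + 0)) + \<i> * of_real (p * i * cos (v + - pi / 2))" for p i v :: real
    unfolding sin exp_Euler[of "complex_of_real v"] cos_of_real sin_of_real of_real_mult add_0_right distrib_left
    by (simp only: mult.left_commute)
  have iM': "integrable M (\<lambda>\<omega>. complex_of_real (p \<omega> * indicator B (X \<omega>) * cos (V \<omega> + \<theta>)))" for \<theta>
    by (subst complex_of_real_integrable_eq) (rule iM)
  have iN': "integrable N (\<lambda>\<omega>. complex_of_real (q \<omega> * indicator B (Y \<omega>) * cos (W \<omega> + \<theta>)))" for \<theta>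
    by (subst complex_of_real_integrable_eq) (rule iN)
  have "(CLINT \<omega>|M. of_real (p \<omega> * indicator B (X \<omega>)) * iexp (V \<omega>)) =
    of_real (LINT \<omega>|M. p \<omega> * indicator B (X \<omega>) * cos (V \<omega> + 0)) +
    \<i> * of_real (LINT \<omega>|M. p \<omega> * indicator B (X \<omega>) * cos (V \<omega> + - pi / 2))"
    unfolding s Bochner_Integration.integral_add[OF iM' integrable_mult_right[OF iM']]
      integral_mult_right_zero integral_complex_of_real ..
  also have "\<dots> = of_real (LINT \<omega>|N. q \<omega> * indicator B (Y \<omega>) * cos (W \<omega> + 0)) +
    \<i> * of_real (LINT \<omega>|N. q \<omega> * indicator B (Y \<omega>) * cos (W \<omega> + - pi / 2))"
    by (simp only: 3)
  also have "\<dots> = (CLINT \<omega>|N. of_real (q \<omega> * indicator B (Y \<omega>)) * iexp (W \<omega>))"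
    unfolding s Bochner_Integration.integral_add[OF iN' integrable_mult_right[OF iN']]
      integral_mult_right_zero integral_complex_of_real ..
  finally show ?thesis .
qed

text \<open>Multivariate uniqueness from the univariate theorem: the coordinates are converted one
  by one from frequencies to Borel sets, until only the probabilities of boxes remain.\<close>

theorem char_unique_vec:
  assumes M: "random_vector n M X" and N: "random_vector n N Y"
  assumes eq: "\<And>t :: nat \<Rightarrow> real. (CLINT \<omega>|M. iexp (\<Sum>i<n. t i * X \<omega> i)) = (CLINT \<omega>|N. iexp (\<Sum>i<n. t i * Y \<omega> i))"
  shows "distr M (borel_vec n) X = distr N (borel_vec n) Y"
proof -
  interpret M: prob_space M using M by (simp add: random_vector_def)
  interpret N: prob_space N using N by (simp add: random_vector_def)
  have [measurable]: "X \<in> measurable M (borel_vec n)" "Y \<in> measurable N (borel_vec n)"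
    using M N by (simp_all add: random_vector_def)
  have [measurable]: "(\<lambda>\<omega>. X \<omega> i) \<in> borel_measurable M" "(\<lambda>\<omega>. Y \<omega> i) \<in> borel_measurable N" if "i < n" for i
    using that by (auto intro: measurable_compose[OF _ measurable_component_singleton])
  have main: "(CLINT \<omega>|M. of_real (\<Prod>i<k. indicator (B i) (X \<omega> i)) * iexp (\<Sum>i=k..<n. t i * X \<omega> i)) =
     (CLINT \<omega>|N. of_real (\<Prod>i<k. indicator (B i) (Y \<omega> i)) * iexp (\<Sum>i=k..<n. t i * Y \<omega> i))"
    if "k \<le> n" and B: "\<And>i. B i \<in> sets borel" for k B and t :: "nat \<Rightarrow> real"
    using that(1)
  proof (induction k arbitrary: t)
    case 0
    then show ?case using eq[of t] by (simp add: atLeast0LessThan)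
  next
    case (Suc k)
    have [measurable]: "B i \<in> sets borel" for i by (rule B)
    have ind: "(\<Prod>i<k. indicator (B i) (f i)) \<in> {0..1::real}" for f :: "nat \<Rightarrow> real"
      by (auto intro!: prod_nonneg prod_le_1)
    \<comment> \<open>These frequencies, s at k and r * t i behind it, turn the induction hypothesis
      into the two-parameter hypothesis of \<open>phase_char_unique\<close>.\<close>
    have sp: "(\<Sum>i=k..<n. (if i = k then s else r * t i) * f i) = s * f k + r * (\<Sum>i=Suc k..<n. t i * f i)"
      for f :: "nat \<Rightarrow> real" and s r
    proof -
      have "{k..<n} = insert k {Suc k..<n}" using Suc.prems by auto
      then show ?thesis by (simp add: sum_distrib_left mult.assoc)
    qed
    have "(CLINT \<omega>|M. of_real ((\<Prod>i<k. indicator (B i) (X \<omega> i)) * indicator (B k) (X \<omega> k)) * iexp (\<Sum>i=Suc k..<n. t i * X \<omega> i)) =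
     (CLINT \<omega>|N. of_real ((\<Prod>i<k. indicator (B i) (Y \<omega> i)) * indicator (B k) (Y \<omega> k)) * iexp (\<Sum>i=Suc k..<n. t i * Y \<omega> i))"
    proof (rule phase_char_unique)
      fix s r
      show "(CLINT \<omega>|M. of_real (\<Prod>i<k. indicator (B i) (X \<omega> i)) * iexp (s * X \<omega> k + r * (\<Sum>i=Suc k..<n. t i * X \<omega> i))) =
        (CLINT \<omega>|N. of_real (\<Prod>i<k. indicator (B i) (Y \<omega> i)) * iexp (s * Y \<omega> k + r * (\<Sum>i=Suc k..<n. t i * Y \<omega> i)))"
        using Suc.IH[of "\<lambda>i. if i = k then s else r * t i"] Suc.prems unfolding sp by simp
    qed (use Suc.prems ind in \<open>auto intro!: borel_measurable_prod borel_measurable_sum borel_measurable_times M.prob_space_axioms N.prob_space_axioms\<close>)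
    then show ?case by (simp add: mult.commute)
  qed
  interpret product_sigma_finite "\<lambda>_. lborel :: real measure"
    by standard
  show ?thesis
  proof (rule measure_eqI_PiM_finite)
    show "finite {..<n}" by simp
    show "sets (distr M (borel_vec n) X) = sets (borel_vec n)" "sets (distr N (borel_vec n) Y) = sets (borel_vec n)" by simp_all
    fix A assume A: "\<And>i. i \<in> {..<n} \<Longrightarrow> A i \<in> sets (borel :: real measure)"
    define B where "B i = (if i < n then A i else {})" for i
    have B: "B i \<in> sets borel" for i using A by (auto simp: B_def)
    have E: "PiE {..<n} A = PiE {..<n} B" by (intro PiE_cong) (auto simp: B_def)
    have sM: "X \<omega> \<in> extensional {..<n}" if "\<omega> \<in> space M" for \<omega>
      using measurable_space[OF \<open>X \<in> measurable M (borel_vec n)\<close> that] by (auto simp: space_PiM PiE_def)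
    have sN: "Y \<omega> \<in> extensional {..<n}" if "\<omega> \<in> space N" for \<omega>
      using measurable_space[OF \<open>Y \<in> measurable N (borel_vec n)\<close> that] by (auto simp: space_PiM PiE_def)
    have p: "(\<Prod>i<n. indicator (B i) (f i)) = (indicator (PiE {..<n} B) f :: real)" if "f \<in> extensional {..<n}" for f
      using that by (auto simp: indicator_def PiE_def Pi_def prod_zero_iff split: if_splits)
    have "(LINT \<omega>|M. (\<Prod>i<n. indicator (B i) (X \<omega> i))) = (LINT \<omega>|M. indicat_real (X -` PiE {..<n} B \<inter> space M) \<omega>)"
      by (intro Bochner_Integration.integral_cong refl) (simp add: p sM, simp add: indicator_def)
    then have "measure M (X -` PiE {..<n} B \<inter> space M) = (LINT \<omega>|M. (\<Prod>i<n. indicator (B i) (X \<omega> i)))"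
      by simp
    moreover
    have "(LINT \<omega>|N. (\<Prod>i<n. indicator (B i) (Y \<omega> i))) = (LINT \<omega>|N. indicat_real (Y -` PiE {..<n} B \<inter> space N) \<omega>)"
      by (intro Bochner_Integration.integral_cong refl) (simp add: p sN, simp add: indicator_def)
    then have "measure N (Y -` PiE {..<n} B \<inter> space N) = (LINT \<omega>|N. (\<Prod>i<n. indicator (B i) (Y \<omega> i)))"
      by simp
    moreover have "(LINT \<omega>|M. (\<Prod>i<n. indicator (B i) (X \<omega> i))) = (LINT \<omega>|N. (\<Prod>i<n. indicator (B i) (Y \<omega> i)) :: real)"
      using main[of n B] B by (simp flip: of_real_prod)
    ultimately show "emeasure (distr M (borel_vec n) X) (PiE {..<n} A) = emeasure (distr N (borel_vec n) Y) (PiE {..<n} A)"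
      using B unfolding E by (subst (1 2) emeasure_distr) (auto simp: M.emeasure_eq_measure N.emeasure_eq_measure)
  next
    show "range (\<lambda>_. space (borel_vec n)) \<subseteq> prod_algebra {..<n} (\<lambda>_. borel :: real measure)"
      by (auto simp: prod_algebra_eq_finite space_PiM)
    show "(\<Union>i::nat. space (borel_vec n)) = space (PiM {..<n} (\<lambda>_. borel))" by simp
    show "emeasure (distr M (borel_vec n) X) (space (borel_vec n)) \<noteq> \<infinity>"
      by (simp add: emeasure_distr)
  qed
qed

section \<open>The generating law of an elliptical class\<close>

text \<open>\<open>P\<close> is the common law of all standardised components (X_i - mu_i) / sqrt
  (S_ii), whichever member of the class they come from. The last clause excludes the point mass at
  0, for which \<psi> would be constantly 1 on the nonnegative reals.\<close>

definition generating_law :: "(real \<Rightarrow> real) \<Rightarrow> real measure \<Rightarrow> bool" where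
  "generating_law \<psi> P \<longleftrightarrow> real_distribution P \<and> (\<forall>s. char P s = of_real (\<psi> (s\<^sup>2))) \<and> \<not> (AE y in P. y = 0)"

lemma sum_one:
  fixes f :: "nat \<Rightarrow> real"
  assumes "i < n"
  shows "(\<Sum>l<n. (if l = i then a else 0) * f l) = a * (f i :: real)"
proof -
  have "(\<Sum>l<n. (if l = i then a else 0) * f l) = (\<Sum>l\<in>{i}. (if l = i then a else 0) * f l)"
    using assms by (intro sum.mono_neutral_right) auto
  then show ?thesis by simp
qed

lemma sum_two:
  fixes f :: "nat \<Rightarrow> real"
  assumes "i < n" "j < n" "i \<noteq> j"
  shows "(\<Sum>l<n. (if l = i then a else if l = j then b else 0) * f l) = a * f i + b * (f j :: real)"
proof -
  have "(\<Sum>l<n. (if l = i then a else if l = j then b else 0) * f l) =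
    (\<Sum>l\<in>{i, j}. (if l = i then a else if l = j then b else 0) * f l)"
    using assms by (intro sum.mono_neutral_right) auto
  then show ?thesis using assms by simp
qed

lemma quad_form_alt: "quad_form n S t = (\<Sum>i<n. t i * (\<Sum>j<n. t j * S i j))"
  unfolding quad_form_def sum_distrib_left by (intro sum.cong refl) simp

lemma quad_form_one: "i < n \<Longrightarrow> quad_form n S (\<lambda>k. if k = i then a else 0) = a\<^sup>2 * S i i"
  by (simp only: quad_form_alt sum_one power2_eq_square mult.assoc)

lemma quad_form_two:
  assumes "i < n" "j < n" "i \<noteq> j"
  shows "quad_form n S (\<lambda>k. if k = i then a else if k = j then b else 0) =
    a\<^sup>2 * S i i + a * b * S i j + a * b * S j i + b\<^sup>2 * S j j"
  unfolding quad_form_alt sum_two[OF assms] by (simp add: power2_eq_square algebra_simps)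

lemma quad_form_scale: "quad_form n S (\<lambda>i. s * t i) = s\<^sup>2 * quad_form n S t"
  by (simp add: quad_form_def sum_distrib_left power2_eq_square mult_ac)

lemma elliptical_prob_space: "elliptical n \<mu> S \<psi> M X \<Longrightarrow> prob_space M"
  by (simp add: elliptical_def random_vector_def)

lemma random_vector_component:
  assumes "random_vector n M X" "i < n"
  shows "(\<lambda>\<omega>. X \<omega> i) \<in> borel_measurable M"
  using assms by (auto simp: random_vector_def intro: measurable_compose[OF _ measurable_component_singleton])

lemma elliptical_component:
  assumes "elliptical n \<mu> S \<psi> M X" "i < n"
  shows "(\<lambda>\<omega>. X \<omega> i) \<in> borel_measurable M"
  using assms random_vector_component by (auto simp: elliptical_def)

lemma elliptical_char:
  assumes "elliptical n \<mu> S \<psi> M X"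
  shows "(CLINT \<omega>|M. iexp (\<Sum>i<n. t i * (X \<omega> i - \<mu> i))) = of_real (\<psi> (quad_form n S t))"
proof -
  have "iexp (\<Sum>i<n. t i * (X \<omega> i - \<mu> i)) = iexp (- (\<Sum>i<n. t i * \<mu> i)) * iexp (\<Sum>i<n. t i * X \<omega> i)" for \<omega>
    by (simp add: exp_add[symmetric] algebra_simps sum_subtractf)
  then have "(CLINT \<omega>|M. iexp (\<Sum>i<n. t i * (X \<omega> i - \<mu> i))) =
     iexp (- (\<Sum>i<n. t i * \<mu> i)) * (CLINT \<omega>|M. iexp (\<Sum>i<n. t i * X \<omega> i))"
    by (simp only: integral_mult_right_zero)
  also have "\<dots> = of_real (\<psi> (quad_form n S t))"
    using assms by (simp add: elliptical_def exp_minus flip: mult.assoc)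
  finally show ?thesis .
qed

lemma elliptical_zero:
  assumes "elliptical n \<mu> S \<psi> M X"
  shows "\<psi> 0 = 1"
proof -
  interpret prob_space M using assms by (rule elliptical_prob_space)
  show ?thesis using elliptical_char[OF assms, of "\<lambda>_. 0"] by (simp add: quad_form_def prob_space)
qed

text \<open>Replacing t by s t multiplies the quadratic form by s^2, so both laws have the
  characteristic function \<psi> (s^2 q) in s, where q is the value of the form at t.\<close>

lemma elliptical_linear_distr:
  assumes P: "generating_law \<psi> P" and E: "elliptical n \<mu> S \<psi> M X"
  shows "distr M borel (\<lambda>\<omega>. \<Sum>i<n. t i * (X \<omega> i - \<mu> i)) = distr P borel (\<lambda>y. sqrt (quad_form n S t) * y)"
proof -
  interpret P: real_distribution P using P by (simp add: generating_law_def)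
  interpret M: prob_space M using E by (rule elliptical_prob_space)
  have [measurable]: "(\<lambda>\<omega>. X \<omega> i) \<in> borel_measurable M" if "i < n" for i
    using elliptical_component[OF E that] .
  have m: "(\<lambda>\<omega>. \<Sum>i<n. t i * (X \<omega> i - \<mu> i)) \<in> borel_measurable M"
    by (intro borel_measurable_sum) auto
  have q: "0 \<le> quad_form n S t" using E by (simp add: elliptical_def psd_symmetric_def)
  show ?thesis
  proof (rule Levy_uniqueness)
    show "real_distribution (distr M borel (\<lambda>\<omega>. \<Sum>i<n. t i * (X \<omega> i - \<mu> i)))"
      using m by (rule M.real_distribution_distr)
    show "real_distribution (distr P borel (\<lambda>y. sqrt (quad_form n S t) * y))"
      by (rule P.real_distribution_distr) simp
    show "char (distr M borel (\<lambda>\<omega>. \<Sum>i<n. t i * (X \<omega> i - \<mu> i))) =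
      char (distr P borel (\<lambda>y. sqrt (quad_form n S t) * y))"
    proof
      fix s
      have "char (distr M borel (\<lambda>\<omega>. \<Sum>i<n. t i * (X \<omega> i - \<mu> i))) s =
        (CLINT \<omega>|M. iexp (\<Sum>i<n. (s * t i) * (X \<omega> i - \<mu> i)))"
        unfolding char_def using m by (subst integral_distr) (auto simp: sum_distrib_left mult_ac)
      also have "\<dots> = of_real (\<psi> (s\<^sup>2 * quad_form n S t))"
        by (simp only: elliptical_char[OF E] quad_form_scale)
      also have "s\<^sup>2 * quad_form n S t = (s * sqrt (quad_form n S t))\<^sup>2"
        using q by (simp add: power_mult_distrib)
      also have "of_real (\<psi> ((s * sqrt (quad_form n S t))\<^sup>2)) = char P (s * sqrt (quad_form n S t))"
        using P by (simp add: generating_law_def)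
      also have "\<dots> = char (distr P borel (\<lambda>y. sqrt (quad_form n S t) * y)) s"
        unfolding char_def by (subst integral_distr) (auto simp: mult_ac)
      finally show "char (distr M borel (\<lambda>\<omega>. \<Sum>i<n. t i * (X \<omega> i - \<mu> i))) s =
        char (distr P borel (\<lambda>y. sqrt (quad_form n S t) * y)) s" .
    qed
  qed
qed

lemma elliptical_component_distr:
  assumes P: "generating_law \<psi> P" and E: "elliptical n \<mu> S \<psi> M X" and i: "i < n"
  shows "distr M borel (\<lambda>\<omega>. X \<omega> i - \<mu> i) = distr P borel (\<lambda>y. sqrt (S i i) * y)"
  using elliptical_linear_distr[OF P E, of "\<lambda>k. if k = i then 1 else 0"]
  by (simp only: quad_form_one[OF i] sum_one[OF i]) simp

lemma AE_distr_cong: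
  assumes "distr M N f = distr M' N f'" "f \<in> measurable M N" "f' \<in> measurable M' N"
    and "{x \<in> space N. Q x} \<in> sets N"
  shows "(AE x in M. Q (f x)) \<longleftrightarrow> (AE x in M'. Q (f' x))"
  unfolding AE_distr_iff[OF assms(2,4), symmetric] AE_distr_iff[OF assms(3,4), symmetric] assms(1) ..

lemma in_elliptical_class_diag_pos:
  assumes P: "generating_law \<psi> P" and E: "elliptical n \<mu> S \<psi> M X" and "nondegenerate n M X" and i: "i < n"
  shows "0 < S i i"
proof -
  have "0 \<le> quad_form n S (\<lambda>k. if k = i then 1 else 0)"
    using E by (simp add: elliptical_def psd_symmetric_def)
  then have "0 \<le> S i i" by (simp add: quad_form_one[OF i])
  moreover have "S i i \<noteq> 0"
  proof
    assume "S i i = 0"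
    note [measurable] = elliptical_component[OF E i]
    interpret P: real_distribution P using P by (simp add: generating_law_def)
    have "(AE \<omega> in M. X \<omega> i - \<mu> i = 0) \<longleftrightarrow> (AE y in P. sqrt (S i i) * y = 0)"
      by (rule AE_distr_cong[OF elliptical_component_distr[OF P E i]]) auto
    then have "AE \<omega> in M. X \<omega> i = \<mu> i" by (simp add: \<open>S i i = 0\<close>)
    then show False using assms(3) i by (auto simp: nondegenerate_def)
  qed
  ultimately show ?thesis by simp
qed

lemma standardised_component_distr:
  assumes P: "generating_law \<psi> P" and E: "elliptical n \<mu> S \<psi> M X" and i: "i < n" and pos: "0 < S i i"
  shows "distr M borel (\<lambda>\<omega>. (X \<omega> i - \<mu> i) / sqrt (S i i)) = P"
proof -
  interpret P: real_distribution P using P by (simp add: generating_law_def)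
  note [measurable] = elliptical_component[OF E i]
  have "distr M borel (\<lambda>\<omega>. (X \<omega> i - \<mu> i) / sqrt (S i i)) =
     distr (distr M borel (\<lambda>\<omega>. X \<omega> i - \<mu> i)) borel (\<lambda>x. x / sqrt (S i i))"
    by (subst distr_distr) (auto simp: comp_def)
  also have "\<dots> = distr P borel (\<lambda>x. x)"
    unfolding elliptical_component_distr[OF P E i] using pos by (subst distr_distr) (auto simp: comp_def)
  also have "\<dots> = P" by (rule distr_id2) simp
  finally show ?thesis .
qed

lemma generating_law_symmetric:
  assumes P: "generating_law \<psi> P"
  shows "distr P borel uminus = P"
proof -
  interpret P: real_distribution P using P by (simp add: generating_law_def)
  show ?thesis
  proof (rule Levy_uniqueness)
    show "real_distribution (distr P borel uminus)" by (rule P.real_distribution_distr) simp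
    show "real_distribution P" by (rule P.real_distribution_axioms)
    show "char (distr P borel uminus) = char P"
    proof
      fix t
      have "char (distr P borel uminus) t = char P (-t)"
        unfolding char_def by (subst integral_distr) auto
      then show "char (distr P borel uminus) t = char P t" using P by (simp add: generating_law_def)
    qed
  qed
qed

text \<open>By symmetry a point mass at c is also one at - c, so c would be 0.\<close>

lemma generating_law_not_const:
  assumes P: "generating_law \<psi> P"
  shows "\<not> (AE y in P. y = c)"
proof
  assume c: "AE y in P. y = c"
  interpret P: real_distribution P using P by (simp add: generating_law_def)
  have "AE y in distr P borel uminus. y = c" unfolding generating_law_symmetric[OF P] by (rule c)
  then have "AE y in P. - y = c" by (subst (asm) AE_distr_iff) auto
  with c have "AE y in P. y = 0" by eventually_elim auto
  then show False using P by (simp add: generating_law_def)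
qed

lemma nondegenerateI:
  assumes P: "generating_law \<psi> P" and E: "elliptical n \<mu> S \<psi> M X" and pos: "\<And>i. i < n \<Longrightarrow> 0 < S i i"
  shows "nondegenerate n M X"
  unfolding nondegenerate_def
proof (intro allI impI notI)
  fix i assume i: "i < n" and "\<exists>c. AE \<omega> in M. X \<omega> i = c"
  then obtain c where c: "AE \<omega> in M. X \<omega> i = c" by auto
  note [measurable] = elliptical_component[OF E i]
  interpret P: real_distribution P using P by (simp add: generating_law_def)
  have "(AE \<omega> in M. (X \<omega> i - \<mu> i) / sqrt (S i i) = (c - \<mu> i) / sqrt (S i i)) \<longleftrightarrow> (AE y in P. y = (c - \<mu> i) / sqrt (S i i))"
    by (subst standardised_component_distr[OF P E i pos[OF i], symmetric], subst AE_distr_iff) auto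
  moreover have "AE \<omega> in M. (X \<omega> i - \<mu> i) / sqrt (S i i) = (c - \<mu> i) / sqrt (S i i)"
    using c by eventually_elim simp
  ultimately show False using generating_law_not_const[OF P] by blast
qed

lemma generating_law_exists:
  assumes "in_elliptical_class \<psi> n M X"
  shows "\<exists>P. generating_law \<psi> P"
proof -
  from assms obtain \<mu> S where n: "0 < n" and nd: "nondegenerate n M X" and E: "elliptical n \<mu> S \<psi> M X"
    by (auto simp: in_elliptical_class_def)
  interpret M: prob_space M using E by (rule elliptical_prob_space)
  note [measurable] = elliptical_component[OF E n]
  have ch: "(CLINT \<omega>|M. iexp (s * (X \<omega> 0 - \<mu> 0))) = of_real (\<psi> (s\<^sup>2 * S 0 0))" for s
    using elliptical_char[OF E, of "\<lambda>k. if k = 0 then s else 0"]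
    by (simp only: quad_form_one[OF n] sum_one[OF n])
  have "0 \<le> quad_form n S (\<lambda>k. if k = 0 then 1 else 0)"
    using E by (simp add: elliptical_def psd_symmetric_def)
  then have ge: "0 \<le> S 0 0" by (simp add: quad_form_one[OF n])
  \<comment> \<open>\<open>in_elliptical_class_diag_pos\<close> presupposes the generating law,
    which is still to be built. Here S 0 0 = 0 makes the characteristic function of X_0 - mu_0
    constantly \<psi> 0 = 1.\<close>
  have "S 0 0 \<noteq> 0"
  proof
    assume "S 0 0 = 0"
    have "distr M borel (\<lambda>\<omega>. X \<omega> 0 - \<mu> 0) = distr M borel (\<lambda>_. 0)"
    proof (rule Levy_uniqueness)
      show "char (distr M borel (\<lambda>\<omega>. X \<omega> 0 - \<mu> 0)) = char (distr M borel (\<lambda>_. 0))"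
        unfolding char_def
        by (subst (1 2) integral_distr) (use ch in \<open>auto simp: \<open>S 0 0 = 0\<close> elliptical_zero[OF E] M.prob_space\<close>)
    qed (rule M.real_distribution_distr; simp)+
    then have "(AE \<omega> in M. X \<omega> 0 - \<mu> 0 = 0) \<longleftrightarrow> (AE \<omega> in M. 0 = (0::real))"
      by (rule AE_distr_cong) auto
    then show False using nd n by (auto simp: nondegenerate_def)
  qed
  with ge have pos: "S 0 0 > 0" by simp
  define P where "P = distr M borel (\<lambda>\<omega>. (X \<omega> 0 - \<mu> 0) / sqrt (S 0 0))"
  have "real_distribution P" unfolding P_def by (rule M.real_distribution_distr) simp
  moreover have "char P s = of_real (\<psi> (s\<^sup>2))" for s
    using ch[of "s / sqrt (S 0 0)"] pos unfolding P_def char_def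
    by (subst integral_distr) (auto simp: power_divide)
  moreover have "\<not> (AE y in P. y = 0)"
  proof
    assume "AE y in P. y = 0"
    then have "AE \<omega> in M. X \<omega> 0 = \<mu> 0"
      unfolding P_def using pos by (subst (asm) AE_distr_iff) auto
    then show False using nd n by (auto simp: nondegenerate_def)
  qed
  ultimately show ?thesis by (auto simp: generating_law_def)
qed

lemma generating_law_zero: "generating_law \<psi> P \<Longrightarrow> \<psi> 0 = 1"
  unfolding generating_law_def using real_distribution.char_zero[of P] by (metis of_real_eq_1_iff power_zero_numeral)

lemma generating_law_bounded:
  assumes "generating_law \<psi> P" "0 \<le> u"
  shows "\<bar>\<psi> u\<bar> \<le> 1"
proof -
  interpret P: real_distribution P using assms by (simp add: generating_law_def)
  have "norm (char P (sqrt u)) \<le> 1" by (rule P.cmod_char_le_1)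
  then show ?thesis using assms by (simp add: generating_law_def)
qed

lemma generating_law_continuous:
  assumes "generating_law \<psi> P"
  shows "continuous_on {0..} \<psi>"
proof -
  interpret P: real_distribution P using assms by (simp add: generating_law_def)
  have "continuous_on UNIV (char P)"
    by (simp add: P.isCont_char continuous_at_imp_continuous_on)
  then have "continuous_on {0..} (\<lambda>u. char P (sqrt u))"
    by (rule continuous_on_compose2) (auto intro: continuous_intros)
  then have "continuous_on {0..} (\<lambda>u. Re (char P (sqrt u)))"
    by (rule continuous_on_Re)
  moreover have "Re (char P (sqrt u)) = \<psi> u" if "u \<in> {0..}" for u
    using assms that by (simp add: generating_law_def)
  ultimately show ?thesis by (rule continuous_on_eq)
qed

section \<open>Laplace transforms of mean squares\<close>

abbreviation gauss :: "nat \<Rightarrow> (nat \<Rightarrow> real) measure" where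
  "gauss k \<equiv> PiM {..<k} (\<lambda>_. std_normal_distribution)"

interpretation std_normal: real_distribution std_normal_distribution
  by (rule real_dist_normal_dist)

interpretation std_normal_prod: product_sigma_finite "\<lambda>_ :: nat. std_normal_distribution"
  by standard

lemma prob_space_gauss: "prob_space (gauss k)"
  by (rule prob_space_PiM) (rule std_normal.prob_space_axioms)

lemma sets_gauss [measurable_cong]: "sets (gauss k) = sets (borel_vec k)"
  by (intro sets_PiM_cong) auto

lemma gauss_char:
  "(CLINT z|gauss k. iexp (\<Sum>i<k. a i * z i)) = of_real (exp (- (\<Sum>i<k. (a i)\<^sup>2) / 2))"
proof -
  have "(CLINT z|gauss k. iexp (\<Sum>i<k. a i * z i)) = (CLINT z|gauss k. (\<Prod>i<k. iexp (a i * z i)))"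
    by (simp add: exp_sum sum_distrib_left)
  also have "\<dots> = (\<Prod>i<k. CLINT x|std_normal_distribution. iexp (a i * x))"
    by (rule std_normal_prod.product_integral_prod)
      (auto intro!: std_normal.integrable_iexp simp del: of_real_mult)
  also have "\<dots> = (\<Prod>i<k. of_real (exp (- ((a i)\<^sup>2) / 2)))"
    using char_std_normal_distribution by (simp add: char_def fun_eq_iff)
  also have "\<dots> = of_real (exp (\<Sum>i<k. - ((a i)\<^sup>2) / 2))"
    by (simp add: exp_sum)
  finally show ?thesis by (simp add: sum_negf sum_divide_distrib)
qed

lemma std_normal_moments:
  "(LINT x|std_normal_distribution. x ^ 0) = 1"
  "(LINT x|std_normal_distribution. x ^ 1) = 0"
  "(LINT x|std_normal_distribution. x ^ 2) = 1"
  "(LINT x|std_normal_distribution. x ^ 3) = 0"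
  "(LINT x|std_normal_distribution. x ^ 4) = 3"
  using std_normal_distribution_even_moments(1)[of 1] std_normal_distribution_even_moments(1)[of 2]
    integral_std_normal_distribution_moment_odd[of 1] integral_std_normal_distribution_moment_odd[of 3]
    std_normal.prob_space
  by (simp_all add: fact_numeral)

lemma prod_power_of_bool: "i < n \<Longrightarrow> (\<Prod>m<n. z m ^ of_bool (m = i)) = (z i :: real)" for n :: nat
proof -
  assume "i < n"
  then have "(\<Prod>m<n. z m ^ of_bool (m = i)) = (\<Prod>m\<in>{i}. z m ^ of_bool (m = i))"
    by (intro prod.mono_neutral_right) auto
  then show ?thesis by simp
qed

lemma gauss_monomial:
  "integrable (gauss n) (\<lambda>z. \<Prod>m<n. z m ^ c m)"
  "(LINT z|gauss n. (\<Prod>m<n. z m ^ c m)) = (\<Prod>m<n. LINT x|std_normal_distribution. x ^ c m)"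
  by (rule std_normal_prod.product_integrable_prod, simp, rule integrable_std_normal_distribution_moment,
    rule std_normal_prod.product_integral_prod, simp, rule integrable_std_normal_distribution_moment)

lemma gauss_moment2:
  assumes "i < n" "j < n"
  shows "integrable (gauss n) (\<lambda>z. z i * z j)" "(LINT z|gauss n. z i * z j) = of_bool (i = j)"
proof -
  define c :: "nat \<Rightarrow> nat" where "c m = of_bool (m = i) + of_bool (m = j)" for m
  have e: "z i * z j = (\<Prod>m<n. z m ^ c m)" for z :: "nat \<Rightarrow> real"
    using assms by (simp only: c_def power_add prod.distrib prod_power_of_bool)
  show "integrable (gauss n) (\<lambda>z. z i * z j)"
    unfolding e by (rule gauss_monomial)
  have "(LINT z|gauss n. z i * z j) = (\<Prod>m<n. LINT x|std_normal_distribution. x ^ c m)"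
    unfolding e by (rule gauss_monomial)
  also have "\<dots> = (\<Prod>m\<in>{i, j}. LINT x|std_normal_distribution. x ^ c m)"
    using assms by (intro prod.mono_neutral_right) (auto simp: c_def std_normal_moments(1)[simplified])
  also have "\<dots> = of_bool (i = j)"
    using std_normal_moments by (cases "i = j") (auto simp: c_def numeral_eq_Suc)
  finally show "(LINT z|gauss n. z i * z j) = of_bool (i = j)" .
qed

text \<open>Isserlis' formula with identity covariance. With c m counting the occurrences of m among
  the four indices, independence splits the expectation into the univariate moments 1, 0, 1, 0, 3,
  and every pattern of equalities is checked.\<close>

lemma gauss_moment4:
  assumes "i < n" "j < n" "k < n" "l < n"
  shows "integrable (gauss n) (\<lambda>z. z i * z j * (z k * z l))"
    "(LINT z|gauss n. z i * z j * (z k * z l)) =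
      of_bool (i = j) * of_bool (k = l) + of_bool (i = k) * of_bool (j = l) + of_bool (i = l) * of_bool (j = k)"
proof -
  define c :: "nat \<Rightarrow> nat" where "c m = of_bool (m = i) + of_bool (m = j) + (of_bool (m = k) + of_bool (m = l))" for m
  have e: "z i * z j * (z k * z l) = (\<Prod>m<n. z m ^ c m)" for z :: "nat \<Rightarrow> real"
    using assms by (simp only: c_def power_add prod.distrib prod_power_of_bool)
  show "integrable (gauss n) (\<lambda>z. z i * z j * (z k * z l))"
    unfolding e by (rule gauss_monomial)
  have "(LINT z|gauss n. z i * z j * (z k * z l)) = (\<Prod>m<n. LINT x|std_normal_distribution. x ^ c m)"
    unfolding e by (rule gauss_monomial)
  also have "\<dots> = (\<Prod>m\<in>{i, j, k, l}. LINT x|std_normal_distribution. x ^ c m)"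
    using assms by (intro prod.mono_neutral_right) (auto simp: c_def std_normal_moments(1)[simplified])
  also have "\<dots> = of_bool (i = j) * of_bool (k = l) + of_bool (i = k) * of_bool (j = l) + of_bool (i = l) * of_bool (j = k)"
    using std_normal_moments
    by (cases "i = j"; cases "i = k"; cases "i = l"; cases "j = k"; cases "j = l"; cases "k = l")
      (simp_all add: c_def numeral_eq_Suc insert_commute)
  finally show "(LINT z|gauss n. z i * z j * (z k * z l)) =
      of_bool (i = j) * of_bool (k = l) + of_bool (i = k) * of_bool (j = l) + of_bool (i = l) * of_bool (j = k)" .
qed

text \<open>Of the three pairings in \<open>gauss_moment4\<close> the first contributes the squared
  trace, which is the squared mean 1; each of the other two contributes the sum of the squared
  entries, by symmetry of A.\<close>

lemma gauss_quadratic_variance: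
  fixes A :: "nat \<Rightarrow> nat \<Rightarrow> real"
  assumes sym: "\<And>i j. i < n \<Longrightarrow> j < n \<Longrightarrow> A i j = A j i" and tr: "(\<Sum>i<n. A i i) = 1"
  defines "Q \<equiv> (\<lambda>z. \<Sum>i<n. \<Sum>j<n. A i j * (z i * z j))"
  shows "integrable (gauss n) (\<lambda>z. (Q z - 1)\<^sup>2)"
    "(LINT z|gauss n. (Q z - 1)\<^sup>2) = 2 * (\<Sum>i<n. \<Sum>j<n. (A i j)\<^sup>2)"
proof -
  interpret prob_space "gauss n" by (rule prob_space_gauss)
  have sq: "(Q z)\<^sup>2 = (\<Sum>i<n. \<Sum>j<n. \<Sum>k<n. \<Sum>l<n. A i j * A k l * (z i * z j * (z k * z l)))" for z
    unfolding Q_def power2_eq_square sum_distrib_right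
    unfolding sum_distrib_left by (simp only: mult_ac)
  have iQ: "integrable (gauss n) Q"
    unfolding Q_def by (intro Bochner_Integration.integrable_sum integrable_mult_right gauss_moment2) auto
  have iQ2: "integrable (gauss n) (\<lambda>z. (Q z)\<^sup>2)"
    unfolding sq by (intro Bochner_Integration.integrable_sum integrable_mult_right gauss_moment4) auto
  have EQ: "(LINT z|gauss n. Q z) = 1"
  proof -
    have "(LINT z|gauss n. Q z) = (\<Sum>i<n. \<Sum>j<n. A i j * (LINT z|gauss n. z i * z j))"
      unfolding Q_def
      by (intro has_bochner_integral_integral_eq has_bochner_integral_sum has_bochner_integral_mult_right
        has_bochner_integral_integrable gauss_moment2) auto
    also have "\<dots> = (\<Sum>i<n. \<Sum>j<n. if i = j then A i j else 0)"
      by (intro sum.cong refl) (simp add: gauss_moment2)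
    also have "\<dots> = 1" using tr by simp
    finally show ?thesis .
  qed
  have EQ2: "(LINT z|gauss n. (Q z)\<^sup>2) = 1 + 2 * (\<Sum>i<n. \<Sum>j<n. (A i j)\<^sup>2)"
  proof -
    have "(LINT z|gauss n. (Q z)\<^sup>2) =
      (\<Sum>i<n. \<Sum>j<n. \<Sum>k<n. \<Sum>l<n. A i j * A k l * (LINT z|gauss n. z i * z j * (z k * z l)))"
      unfolding sq
      by (intro has_bochner_integral_integral_eq has_bochner_integral_sum has_bochner_integral_mult_right
        has_bochner_integral_integrable gauss_moment4) auto
    also have "\<dots> = (\<Sum>i<n. \<Sum>j<n. (if i = j then A i j * (\<Sum>k<n. A k k) else 0) + A i j * A i j + A i j * A j i)"
    proof (intro sum.cong refl)
      fix i j assume ij: "i \<in> {..<n}" "j \<in> {..<n}"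
      have "(\<Sum>k<n. \<Sum>l<n. A i j * A k l * (LINT z|gauss n. z i * z j * (z k * z l))) =
        (\<Sum>k<n. \<Sum>l<n. (if k = l then (if i = j then A i j * A k l else 0) else 0)
          + (if j = l then (if i = k then A i j * A k l else 0) else 0)
          + (if i = l then (if j = k then A i j * A k l else 0) else 0))"
        using ij by (intro sum.cong refl) (auto simp: gauss_moment4)
      also have "\<dots> = (if i = j then A i j * (\<Sum>k<n. A k k) else 0) + A i j * A i j + A i j * A j i"
        using ij by (simp add: sum.distrib sum_distrib_left)
      finally show "(\<Sum>k<n. \<Sum>l<n. A i j * A k l * (LINT z|gauss n. z i * z j * (z k * z l))) =
        (if i = j then A i j * (\<Sum>k<n. A k k) else 0) + A i j * A i j + A i j * A j i" .
    qed
    also have "\<dots> = (\<Sum>i<n. \<Sum>j<n. (if i = j then A i j else 0) + 2 * (A i j)\<^sup>2)"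
      by (intro sum.cong refl) (auto simp: tr sym power2_eq_square)
    also have "\<dots> = 1 + 2 * (\<Sum>i<n. \<Sum>j<n. (A i j)\<^sup>2)"
      using tr by (simp add: sum.distrib sum_distrib_left)
    finally show ?thesis .
  qed
  have e: "(Q z - 1)\<^sup>2 = (Q z)\<^sup>2 - 2 * Q z + 1" for z by (simp add: power2_eq_square algebra_simps)
  show "integrable (gauss n) (\<lambda>z. (Q z - 1)\<^sup>2)" unfolding e using iQ iQ2 by auto
  show "(LINT z|gauss n. (Q z - 1)\<^sup>2) = 2 * (\<Sum>i<n. \<Sum>j<n. (A i j)\<^sup>2)"
    unfolding e using iQ iQ2 EQ EQ2 by (simp add: prob_space)
qed

definition mean_square :: "nat \<Rightarrow> (nat \<Rightarrow> real) \<Rightarrow> (nat \<Rightarrow> nat \<Rightarrow> real) \<Rightarrow> (nat \<Rightarrow> real) \<Rightarrow> real" where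
  "mean_square n \<mu> S x = (\<Sum>i<n. ((x i - \<mu> i) / sqrt (S i i))\<^sup>2) / n"

lemma mean_square_laplace:
  assumes E: "elliptical n \<mu> S \<psi> M X" and n: "0 < n" and u: "0 \<le> u"
  shows "of_real (LINT \<omega>|M. exp (- u * mean_square n \<mu> S (X \<omega>) / 2)) =
    (CLINT z|gauss n. of_real (\<psi> (u * (\<Sum>i<n. \<Sum>j<n. S i j / (sqrt (S i i) * sqrt (S j j) * n) * (z i * z j)))))"
proof -
  interpret M: prob_space M using E by (rule elliptical_prob_space)
  interpret G: prob_space "gauss n" by (rule prob_space_gauss)
  interpret MG: pair_prob_space M "gauss n" ..
  have [measurable]: "(\<lambda>\<omega>. X \<omega> i) \<in> borel_measurable M" if "i < n" for i
    using elliptical_component[OF E that] .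
  have [measurable]: "(\<lambda>z. z i) \<in> borel_measurable (gauss n)" if "i < n" for i
    using that by (auto intro: measurable_component_singleton)
  \<comment> \<open>The scaling is chosen so that the squares of b i * (X_i - mu_i) sum to u times
    the mean square, while inserting b i * z i into the form of \<open>S\<close> gives u times the
    normalised correlation form.\<close>
  define b where "b i = sqrt (u / n) / sqrt (S i i)" for i
  have b2: "b i * b j = u * (1 / (sqrt (S i i) * sqrt (S j j) * n))" for i j
    using u n by (simp add: b_def flip: real_sqrt_mult)
  define f where "f \<omega> z = iexp (\<Sum>i<n. (b i * z i) * (X \<omega> i - \<mu> i))" for \<omega> and z :: "nat \<Rightarrow> real"
  have [measurable]: "case_prod f \<in> borel_measurable (M \<Otimes>\<^sub>M gauss n)"
  proof -
    have "(\<lambda>p. \<Sum>i<n. (b i * snd p i) * (X (fst p) i - \<mu> i)) \<in> borel_measurable (M \<Otimes>\<^sub>M gauss n)"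
      by (intro borel_measurable_sum) auto
    then show ?thesis unfolding f_def split_beta' by measurable
  qed
  have "integrable (M \<Otimes>\<^sub>M gauss n) (case_prod f)"
    by (rule MG.integrable_const_bound[of _ 1]) (auto simp: f_def simp del: of_real_sum)
  then have "(CLINT z|gauss n. CLINT \<omega>|M. f \<omega> z) = (CLINT \<omega>|M. CLINT z|gauss n. f \<omega> z)"
    by (rule MG.Fubini_integral)
  moreover have "(CLINT z|gauss n. f \<omega> z) = of_real (exp (- u * mean_square n \<mu> S (X \<omega>) / 2))" for \<omega>
  proof -
    have "(CLINT z|gauss n. f \<omega> z) = (CLINT z|gauss n. iexp (\<Sum>i<n. (b i * (X \<omega> i - \<mu> i)) * z i))"
      unfolding f_def by (simp only: mult_ac)
    also have "\<dots> = of_real (exp (- (\<Sum>i<n. (b i * (X \<omega> i - \<mu> i))\<^sup>2) / 2))"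
      by (rule gauss_char)
    also have "(\<Sum>i<n. (b i * (X \<omega> i - \<mu> i))\<^sup>2) = u * mean_square n \<mu> S (X \<omega>)"
      unfolding mean_square_def sum_divide_distrib sum_distrib_left
      using u n by (intro sum.cong refl) (simp add: b_def power_mult_distrib power_divide)
    finally show ?thesis by simp
  qed
  moreover have "(CLINT \<omega>|M. f \<omega> z) =
    of_real (\<psi> (u * (\<Sum>i<n. \<Sum>j<n. S i j / (sqrt (S i i) * sqrt (S j j) * n) * (z i * z j))))" for z
  proof -
    have "quad_form n S (\<lambda>i. b i * z i) = u * (\<Sum>i<n. \<Sum>j<n. S i j / (sqrt (S i i) * sqrt (S j j) * n) * (z i * z j))"
      unfolding quad_form_def sum_distrib_left
    proof (intro sum.cong refl)
      fix i j
      have "b i * z i * S i j * (b j * z j) = (b i * b j) * S i j * (z i * z j)" by simp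
      then show "b i * z i * S i j * (b j * z j) = u * (S i j / (sqrt (S i i) * sqrt (S j j) * n) * (z i * z j))"
        unfolding b2 by simp
    qed
    then show ?thesis unfolding f_def elliptical_char[OF E] by simp
  qed
  ultimately show ?thesis by simp
qed

text \<open>Positive semidefiniteness at e_i / sqrt (S_ii) + e_j / sqrt (S_jj) puts the off-diagonal
  correlations into [-1, 0], where a square is at most minus the number. At the sum of all the
  scaled unit vectors it gives a nonnegative total, so the off-diagonal entries sum to at least - n
  and their squares to at most n; the diagonal adds another n.\<close>

lemma elliptical_correlations:
  assumes E: "elliptical n \<mu> S \<psi> M X"
    and pos: "\<And>i. i < n \<Longrightarrow> 0 < S i i" and neg: "\<And>i j. i < n \<Longrightarrow> j < n \<Longrightarrow> i \<noteq> j \<Longrightarrow> S i j \<le> 0"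
  shows "(\<Sum>i<n. \<Sum>j<n. (S i j / (sqrt (S i i) * sqrt (S j j)))\<^sup>2) \<le> 2 * n"
proof -
  define R where "R i j = S i j / (sqrt (S i i) * sqrt (S j j))" for i j
  have psd: "0 \<le> quad_form n S t" for t using E by (simp add: elliptical_def psd_symmetric_def)
  have sym: "S i j = S j i" if "i < n" "j < n" for i j using E that by (simp add: elliptical_def psd_symmetric_def)
  have diag: "R i i = 1" if "i < n" for i using pos[OF that] by (simp add: R_def)
  have off: "R i j \<le> 0" "-1 \<le> R i j" if "i < n" "j < n" "i \<noteq> j" for i j
  proof -
    show "R i j \<le> 0" using that neg[OF that] pos unfolding R_def
      by (intro divide_nonpos_pos) auto
    have "0 \<le> 2 + 2 * R i j"
      using psd[of "\<lambda>k. if k = i then 1 / sqrt (S i i) else if k = j then 1 / sqrt (S j j) else 0"] pos[of i] pos[of j] that sym[of i j]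
      by (simp add: quad_form_two[OF that] R_def power_divide)
    then show "-1 \<le> R i j" by simp
  qed
  have "0 \<le> (\<Sum>i<n. \<Sum>j<n. R i j)"
    using psd[of "\<lambda>i. 1 / sqrt (S i i)"] by (simp add: quad_form_def R_def)
  moreover have "(R i j)\<^sup>2 \<le> 2 * of_bool (i = j) - R i j" if "i < n" "j < n" for i j
  proof (cases "i = j")
    case False
    then have "(- R i j) * (- R i j) \<le> 1 * (- R i j)" using off[OF that] by (intro mult_right_mono) auto
    then show ?thesis using False by (simp add: power2_eq_square)
  qed (use that diag in auto)
  then have "(\<Sum>i<n. \<Sum>j<n. (R i j)\<^sup>2) \<le> (\<Sum>i<n. \<Sum>j<n. 2 * of_bool (i = j) - R i j)"
    by (intro sum_mono) auto
  moreover have "(\<Sum>i<n. \<Sum>j<n. 2 * of_bool (i = j) - R i j) = 2 * n - (\<Sum>i<n. \<Sum>j<n. R i j)"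
    by (simp add: sum_subtractf of_bool_def if_distrib[of "\<lambda>x. 2 * x"] cong: if_cong)
  ultimately show ?thesis unfolding R_def by linarith
qed

text \<open>
  A law of large numbers: testing \<open>X\<close> against an independent Gaussian vector gives both the Laplace
  transform of the mean square and the average of \<open>\<psi>\<close> over a Gaussian quadratic form whose variance is
  \<open>O(1/n)\<close> because the correlations are nonpositive.
\<close>

theorem mean_square_laplace_limit:
  assumes P: "generating_law \<psi> P" and u: "0 \<le> u" and \<epsilon>: "0 < \<epsilon>"
  shows "\<exists>N>0. \<forall>n\<ge>N. \<forall>\<mu> S (M :: 'a measure) X. elliptical n \<mu> S \<psi> M X \<longrightarrow>
    (\<forall>i<n. 0 < S i i) \<longrightarrow> (\<forall>i<n. \<forall>j<n. i \<noteq> j \<longrightarrow> S i j \<le> 0) \<longrightarrow>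
    \<bar>(LINT \<omega>|M. exp (- u * mean_square n \<mu> S (X \<omega>) / 2)) - \<psi> u\<bar> < \<epsilon>"
proof -
  have "continuous_on {0..} (\<lambda>q. \<psi> (u * q))"
    by (rule continuous_on_compose2[OF generating_law_continuous[OF P]]) (use u in \<open>auto intro!: continuous_intros\<close>)
  then have "\<exists>d>0. \<forall>q\<in>{0..}. dist q 1 < d \<longrightarrow> dist (\<psi> (u * q)) (\<psi> (u * 1)) < \<epsilon> / 2"
    unfolding continuous_on_iff using \<epsilon> by (meson atLeast_iff half_gt_zero zero_le_one)
  then obtain d where d: "0 < d" and dd: "\<And>q. 0 \<le> q \<Longrightarrow> \<bar>q - 1\<bar> < d \<Longrightarrow> \<bar>\<psi> (u * q) - \<psi> u\<bar> < \<epsilon> / 2"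
    by (auto simp: dist_real_def)
  \<comment> \<open>The quadratic form will have variance at most 4/n, and \<open>pw\<close> weighs
    it with 2 / d^2. This N0 makes the resulting 8 / (n d^2) smaller than \<epsilon> / 2.\<close>
  obtain N0 :: nat where N0: "16 / (\<epsilon> * d\<^sup>2) < N0" using reals_Archimedean2 by blast
  show ?thesis
  proof (intro exI[of _ "Suc N0"] conjI allI impI)
    show "0 < Suc N0" by simp
    fix n \<mu> S and M :: "'a measure" and X
    assume n: "Suc N0 \<le> n" and E: "elliptical n \<mu> S \<psi> M X"
      and "\<forall>i<n. 0 < S i i" and "\<forall>i<n. \<forall>j<n. i \<noteq> j \<longrightarrow> S i j \<le> 0"
    then have pos: "\<And>i. i < n \<Longrightarrow> 0 < S i i" and neg: "\<And>i j. i < n \<Longrightarrow> j < n \<Longrightarrow> i \<noteq> j \<Longrightarrow> S i j \<le> 0"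
      by blast+
    have n0: "0 < n" using n by simp
    interpret G: prob_space "gauss n" by (rule prob_space_gauss)
    define A where "A i j = S i j / (sqrt (S i i) * sqrt (S j j) * n)" for i j
    define Q where "Q z = (\<Sum>i<n. \<Sum>j<n. A i j * (z i * z j))" for z :: "nat \<Rightarrow> real"
    have sym: "A i j = A j i" if "i < n" "j < n" for i j
      using E that by (simp add: elliptical_def psd_symmetric_def A_def mult_ac)
    have tr: "(\<Sum>i<n. A i i) = 1"
    proof -
      have "(\<Sum>i<n. A i i) = (\<Sum>i<n. 1 / n)"
      proof (intro sum.cong refl)
        fix i assume "i \<in> {..<n}"
        then show "A i i = 1 / n" using pos[of i] by (simp add: A_def)
      qed
      then show ?thesis using n0 by simp
    qed
    have Q0: "0 \<le> Q z" for z
    proof -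
      have "0 \<le> quad_form n S (\<lambda>i. z i / sqrt (S i i)) / n"
        using E by (simp add: elliptical_def psd_symmetric_def)
      also have "\<dots> = Q z"
        unfolding quad_form_def Q_def sum_divide_distrib by (intro sum.cong refl) (simp add: A_def)
      finally show ?thesis .
    qed
    have "(\<Sum>i<n. \<Sum>j<n. (A i j)\<^sup>2) = (\<Sum>i<n. \<Sum>j<n. (S i j / (sqrt (S i i) * sqrt (S j j)))\<^sup>2) / n\<^sup>2"
      unfolding A_def sum_divide_distrib by (intro sum.cong refl) (simp add: power_divide power_mult_distrib)
    also have "\<dots> \<le> (2 * n) / n\<^sup>2"
      by (intro divide_right_mono elliptical_correlations[OF E pos neg]) auto
    finally have A2: "(\<Sum>i<n. \<Sum>j<n. (A i j)\<^sup>2) \<le> 2 / n" using n0 by (simp add: power2_eq_square)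
    note var = gauss_quadratic_variance[of n A, OF sym tr, folded Q_def]
    have mQ: "Q \<in> borel_measurable (gauss n)" unfolding Q_def by measurable
    \<comment> \<open>Nothing is known about \<psi> on the negative reals, so measurability is taken
      from the extension by 0, which agrees with \<psi> at the nonnegative number u * Q z.\<close>
    have "(\<lambda>x. if x \<in> {0..} then \<psi> x else 0) \<in> borel_measurable borel"
      by (rule borel_measurable_continuous_on_if) (auto intro: generating_law_continuous[OF P])
    from measurable_compose[OF _ this, of "\<lambda>z. u * Q z" "gauss n"]
    have mpsi: "(\<lambda>z. \<psi> (u * Q z)) \<in> borel_measurable (gauss n)"
      using mQ u Q0 by simp
    have bd: "\<bar>\<psi> (u * Q z)\<bar> \<le> 1" for z using generating_law_bounded[OF P] u Q0 by simp
    have ipsi: "integrable (gauss n) (\<lambda>z. \<psi> (u * Q z))"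
      by (rule G.integrable_const_bound[of _ 1]) (use bd mpsi in auto)
    have eq: "(LINT \<omega>|M. exp (- u * mean_square n \<mu> S (X \<omega>) / 2)) = (LINT z|gauss n. \<psi> (u * Q z))"
    proof -
      have "of_real (LINT \<omega>|M. exp (- u * mean_square n \<mu> S (X \<omega>) / 2)) = (CLINT z|gauss n. of_real (\<psi> (u * Q z)))"
        unfolding Q_def A_def by (rule mean_square_laplace[OF E n0 u])
      then show ?thesis by (simp only: integral_complex_of_real of_real_eq_iff)
    qed
    \<comment> \<open>Where Q is at distance at least d from 1, the difference is at most 2 and (Q -
      1)^2 / d^2 is at least 1, as in Chebyshev's inequality.\<close>
    have pw: "\<bar>\<psi> (u * Q z) - \<psi> u\<bar> \<le> \<epsilon> / 2 + 2 / d\<^sup>2 * (Q z - 1)\<^sup>2" for z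
    proof (cases "\<bar>Q z - 1\<bar> < d")
      case True
      then show ?thesis using dd[OF Q0[of z]] by (intro add_increasing2) (auto intro: less_imp_le)
    next
      case False
      then have "d\<^sup>2 \<le> (Q z - 1)\<^sup>2" using d by (intro abs_le_square_iff[THEN iffD1]) auto
      then have "2 \<le> 2 / d\<^sup>2 * (Q z - 1)\<^sup>2" using d by (simp add: field_simps)
      moreover have "\<bar>\<psi> (u * Q z) - \<psi> u\<bar> \<le> 2" using bd[of z] generating_law_bounded[OF P u] by linarith
      ultimately show ?thesis using \<epsilon> by linarith
    qed
    have "\<bar>(LINT z|gauss n. \<psi> (u * Q z)) - \<psi> u\<bar> = \<bar>LINT z|gauss n. \<psi> (u * Q z) - \<psi> u\<bar>"
      using ipsi by (simp add: G.prob_space)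
    also have "\<dots> \<le> (LINT z|gauss n. \<bar>\<psi> (u * Q z) - \<psi> u\<bar>)"
      by (rule integral_abs_bound)
    also have "\<dots> \<le> (LINT z|gauss n. \<epsilon> / 2 + 2 / d\<^sup>2 * (Q z - 1)\<^sup>2)"
      using pw ipsi var(1) by (intro integral_mono) auto
    also have "\<dots> = \<epsilon> / 2 + 2 / d\<^sup>2 * (2 * (\<Sum>i<n. \<Sum>j<n. (A i j)\<^sup>2))"
      using var by (simp add: G.prob_space)
    also have "\<dots> \<le> \<epsilon> / 2 + 2 / d\<^sup>2 * (2 * (2 / n))"
      using A2 d by (intro add_left_mono mult_left_mono) auto
    also have "\<dots> < \<epsilon>"
    proof -
      have "16 / (\<epsilon> * d\<^sup>2) < n" using N0 n by linarith
      then have "16 < n * (\<epsilon> * d\<^sup>2)" using \<epsilon> d by (simp add: divide_less_eq)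
      then have "2 / d\<^sup>2 * (2 * (2 / n)) < \<epsilon> / 2" using n0 d \<epsilon> by (simp add: field_simps)
      then show ?thesis by simp
    qed
    finally show "\<bar>(LINT \<omega>|M. exp (- u * mean_square n \<mu> S (X \<omega>) / 2)) - \<psi> u\<bar> < \<epsilon>"
      unfolding eq .
  qed
qed

section \<open>Gaussian vectors and Gaussian variance mixtures\<close>

lemma quad_form_Suc:
  assumes "\<And>i. i < n \<Longrightarrow> S n i = S i n"
  shows "quad_form (Suc n) S t = quad_form n S t + 2 * t n * (\<Sum>i<n. t i * S i n) + (t n)\<^sup>2 * S n n"
proof -
  have "(\<Sum>i<n. t n * S n i * t i) = (\<Sum>i<n. t n * S i n * t i)"
    using assms by (intro sum.cong) auto
  then show ?thesis
    by (simp add: quad_form_def sum.distrib sum_distrib_left power2_eq_square mult_ac)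
qed

text \<open>Cholesky factorisation by induction: the Schur complement of the last diagonal entry is
  again positive semidefinite and is factorised first. If that entry is 0, its row and column
  vanish, and x / 0 = 0 makes the same formulas correct.\<close>

lemma psd_factorisation:
  "psd_symmetric n S \<Longrightarrow> \<exists>A. \<forall>i<n. \<forall>j<n. S i j = (\<Sum>k<n. A i k * A j k)"
proof (induction n arbitrary: S)
  case 0
  then show ?case by simp
next
  case (Suc n)
  have sym: "S i j = S j i" if "i < Suc n" "j < Suc n" for i j
    using Suc.prems that by (simp add: psd_symmetric_def)
  have psd: "0 \<le> quad_form (Suc n) S t" for t
    using Suc.prems by (simp add: psd_symmetric_def)
  have d0: "0 \<le> S n n" using psd[of "\<lambda>k. if k = n then 1 else 0"] by (simp add: quad_form_one)
  have z: "S i n = 0" if i: "i < n" and 0: "S n n = 0" for i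
  proof (rule ccontr)
    assume "S i n \<noteq> 0"
    \<comment> \<open>On the vector below the form takes the value S i i - (S i i + 1) = -1.\<close>
    then show False
      using psd[of "\<lambda>k. if k = i then 1 else if k = n then - (S i i + 1) / (2 * S i n) else 0"] i 0 sym[of i n]
      by (simp add: quad_form_two)
  qed
  define S' where "S' i j = S i j - S i n * S j n / S n n" for i j
  have "psd_symmetric n S'"
    unfolding psd_symmetric_def
  proof (intro conjI allI impI)
    show "S' i j = S' j i" if "i < n" "j < n" for i j using sym[of i j] that by (simp add: S'_def)
    fix t
    define b where "b = (\<Sum>i<n. t i * S i n)"
    have "quad_form n S' t = quad_form n S t - (\<Sum>i<n. \<Sum>j<n. (t i * S i n) * (t j * S j n)) / S n n"
      unfolding quad_form_def S'_def sum_subtractf[symmetric] sum_divide_distrib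
      by (intro sum.cong refl) (simp add: algebra_simps)
    also have "(\<Sum>i<n. \<Sum>j<n. (t i * S i n) * (t j * S j n)) = b\<^sup>2"
      by (simp add: b_def power2_eq_square sum_product)
    \<comment> \<open>Completing the square: - b / S n n is the last coordinate that minimises the
      extended form. For S n n = 0 both quotients are 0 by convention, and so is the last
      coordinate.\<close>
    also have "quad_form n S t - b\<^sup>2 / S n n = quad_form (Suc n) S (\<lambda>k. if k < n then t k else - b / S n n)"
    proof -
      have "quad_form n S (\<lambda>k. if k < n then t k else - b / S n n) = quad_form n S t"
        unfolding quad_form_def by (intro sum.cong refl) auto
      then show ?thesis
        by (subst quad_form_Suc) (auto simp: sym b_def[symmetric] power2_eq_square divide_simps)
    qed
    finally show "0 \<le> quad_form n S' t" using psd by simp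
  qed
  from Suc.IH[OF this] obtain A where A: "\<And>i j. i < n \<Longrightarrow> j < n \<Longrightarrow> S' i j = (\<Sum>k<n. A i k * A j k)" by blast
  define B where "B i k = (if k < n then if i < n then A i k else 0 else S i n / sqrt (S n n))" for i k
  have "S i j = (\<Sum>k<Suc n. B i k * B j k)" if ij: "i < Suc n" "j < Suc n" for i j
  proof -
    have last: "B i n * B j n = S i n * S j n / S n n" using d0 by (simp add: B_def)
    have "(\<Sum>k<n. B i k * B j k) = (if i < n \<and> j < n then S' i j else 0)"
      using A[of i j] by (auto simp: B_def)
    moreover from ij have "i < n \<or> i = n" "j < n \<or> j = n" by auto
    ultimately show ?thesis using sym[of i j] z[of i] z[of j] last
      by (cases "S n n = 0"; elim disjE; simp add: S'_def)
  qed
  then show ?case by blast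
qed

lemma affine_vec_measurable [measurable]:
  assumes [measurable]: "s \<in> borel_measurable M" "z \<in> measurable M (borel_vec k)"
  shows "(\<lambda>x. affine_vec n k \<mu> A (s x) (z x)) \<in> measurable M (borel_vec n)"
proof -
  have [measurable]: "(\<lambda>x. z x j) \<in> borel_measurable M" if "j < k" for j
    using assms(2) that by (auto intro: measurable_compose[OF _ measurable_component_singleton])
  show ?thesis unfolding affine_vec_def by (intro measurable_restrict) auto
qed

lemma affine_vec_char:
  "(CLINT z|gauss k. iexp (\<Sum>i<n. t i * affine_vec n k \<mu> A s z i)) =
    iexp (\<Sum>i<n. t i * \<mu> i) * of_real (exp (- s\<^sup>2 * quad_form n (\<lambda>i j. \<Sum>l<k. A i l * A j l) t / 2))"
proof -
  define a where "a j = s * (\<Sum>i<n. t i * A i j)" for j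
  have e: "(\<Sum>i<n. t i * affine_vec n k \<mu> A s z i) = (\<Sum>i<n. t i * \<mu> i) + (\<Sum>j<k. a j * z j)" for z
  proof -
    have "(\<Sum>i<n. t i * affine_vec n k \<mu> A s z i) = (\<Sum>i<n. t i * \<mu> i) + (\<Sum>i<n. \<Sum>j<k. s * t i * A i j * z j)"
      by (simp add: affine_vec_def sum_distrib_left distrib_left sum.distrib mult_ac)
    also have "(\<Sum>i<n. \<Sum>j<k. s * t i * A i j * z j) = (\<Sum>j<k. a j * z j)"
      by (subst sum.swap) (simp add: a_def sum_distrib_left sum_distrib_right mult_ac)
    finally show ?thesis .
  qed
  have "(CLINT z|gauss k. iexp (\<Sum>i<n. t i * affine_vec n k \<mu> A s z i)) =
    (CLINT z|gauss k. iexp (\<Sum>i<n. t i * \<mu> i) * iexp (\<Sum>j<k. a j * z j))"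
    unfolding e of_real_add distrib_left exp_add ..
  also have "\<dots> = iexp (\<Sum>i<n. t i * \<mu> i) * of_real (exp (- (\<Sum>j<k. (a j)\<^sup>2) / 2))"
    by (simp only: integral_mult_right_zero gauss_char)
  also have "(\<Sum>j<k. (a j)\<^sup>2) = s\<^sup>2 * quad_form n (\<lambda>i j. \<Sum>l<k. A i l * A j l) t"
  proof -
    have "(\<Sum>j<k. (\<Sum>i<n. t i * A i j)\<^sup>2) = (\<Sum>l<k. \<Sum>i<n. \<Sum>j<n. t i * A i l * (t j * A j l))"
      by (simp add: power2_eq_square sum_product)
    also have "\<dots> = (\<Sum>i<n. \<Sum>j<n. \<Sum>l<k. t i * A i l * (t j * A j l))"
      by (rule trans[OF sum.swap], rule sum.cong[OF refl], rule sum.swap)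
    also have "\<dots> = quad_form n (\<lambda>i j. \<Sum>l<k. A i l * A j l) t"
      unfolding quad_form_def by (simp add: sum_distrib_left sum_distrib_right mult_ac)
    finally show ?thesis by (simp add: a_def power_mult_distrib flip: sum_distrib_left)
  qed
  finally show ?thesis by simp
qed

lemma std_gaussian_vector_gauss: "std_gaussian_vector k (gauss k) (\<lambda>z. z)"
  by (simp add: std_gaussian_vector_def random_vector_def prob_space_gauss sets_gauss distr_id2
      measurable_ident_sets)

lemma integral_affine_mixture:
  assumes \<nu>: "prob_space \<nu>" "sets \<nu> = sets borel" "AE w in \<nu>. 0 \<le> w"
  shows "(CLINT p|\<nu> \<Otimes>\<^sub>M gauss k. iexp (\<Sum>i<n. t i * affine_vec n k \<mu> A (sqrt (fst p)) (snd p) i)) =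
    iexp (\<Sum>i<n. t i * \<mu> i) *
    of_real (LINT w|\<nu>. exp (- w * quad_form n (\<lambda>i j. \<Sum>l<k. A i l * A j l) t / 2))"
proof -
  interpret N: prob_space \<nu> by fact
  interpret G: prob_space "gauss k" by (rule prob_space_gauss)
  interpret NG: pair_prob_space \<nu> "gauss k" ..
  note [measurable_cong] = \<nu>(2)
  let ?q = "quad_form n (\<lambda>i j. \<Sum>l<k. A i l * A j l) t"
  have m: "(\<lambda>p. affine_vec n k \<mu> A (sqrt (fst p)) (snd p)) \<in> measurable (\<nu> \<Otimes>\<^sub>M gauss k) (borel_vec n)"
    by measurable
  have [measurable]: "(\<lambda>p. affine_vec n k \<mu> A (sqrt (fst p)) (snd p) i) \<in> borel_measurable (\<nu> \<Otimes>\<^sub>M gauss k)" if "i < n" for i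
    using that by (auto intro: measurable_compose[OF m measurable_component_singleton])
  have "integrable (\<nu> \<Otimes>\<^sub>M gauss k) (\<lambda>p. iexp (\<Sum>i<n. t i * affine_vec n k \<mu> A (sqrt (fst p)) (snd p) i))"
    by (rule NG.integrable_const_bound[of _ 1]) (auto simp del: of_real_sum)
  then have "(CLINT p|\<nu> \<Otimes>\<^sub>M gauss k. iexp (\<Sum>i<n. t i * affine_vec n k \<mu> A (sqrt (fst p)) (snd p) i)) =
    (CLINT w|\<nu>. CLINT z|gauss k. iexp (\<Sum>i<n. t i * affine_vec n k \<mu> A (sqrt w) z i))"
    using NG.integral_fst'[of "\<lambda>p. iexp (\<Sum>i<n. t i * affine_vec n k \<mu> A (sqrt (fst p)) (snd p) i)"] by simp
  also have "\<dots> = (CLINT w|\<nu>. iexp (\<Sum>i<n. t i * \<mu> i) * of_real (exp (- w * ?q / 2)))"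
    unfolding affine_vec_char using \<nu>(3) by (intro integral_cong_AE) auto
  also have "\<dots> = iexp (\<Sum>i<n. t i * \<mu> i) * of_real (LINT w|\<nu>. exp (- w * ?q / 2))"
    by (simp only: integral_mult_right_zero integral_complex_of_real)
  finally show ?thesis .
qed

lemma indep_fst_snd:
  assumes "prob_space N" "prob_space L" "sets N = sets N'" "sets L = sets L'"
  shows "independent_rvs (N \<Otimes>\<^sub>M L) N' fst L' snd"
proof -
  interpret N: prob_space N by fact
  interpret L: prob_space L by fact
  interpret NL: pair_prob_space N L ..
  note [measurable_cong] = assms(3,4)
  show ?thesis
    unfolding independent_rvs_def NL.indep_sets2_eq
  proof (intro conjI ballI)
    show "fst \<in> measurable (N \<Otimes>\<^sub>M L) N'" "snd \<in> measurable (N \<Otimes>\<^sub>M L) L'" by measurable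
    then show "{fst -` S \<inter> space (N \<Otimes>\<^sub>M L) |S. S \<in> sets N'} \<subseteq> NL.events"
      "{snd -` S \<inter> space (N \<Otimes>\<^sub>M L) |S. S \<in> sets L'} \<subseteq> NL.events"
      by (auto intro: measurable_sets)
    fix a b assume "a \<in> {fst -` S \<inter> space (N \<Otimes>\<^sub>M L) |S. S \<in> sets N'}"
      "b \<in> {snd -` S \<inter> space (N \<Otimes>\<^sub>M L) |S. S \<in> sets L'}"
    then obtain S T where ST: "S \<in> sets N" "T \<in> sets L" "a = fst -` S \<inter> space (N \<Otimes>\<^sub>M L)" "b = snd -` T \<inter> space (N \<Otimes>\<^sub>M L)"
      using assms by auto
    have "a = S \<times> space L" "b = space N \<times> T" "a \<inter> b = S \<times> T"
      using ST sets.sets_into_space[of S N] sets.sets_into_space[of T L] by (auto simp: space_pair_measure)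
    then show "NL.prob (a \<inter> b) = NL.prob a * NL.prob b"
      using ST by (simp add: measure_def L.emeasure_pair_measure_Times enn2real_mult N.emeasure_space_1 L.emeasure_space_1)
  qed
qed

lemma distr_fst_pair:
  assumes "prob_space N" "prob_space L" and s: "sets N = sets N'"
  shows "distr (N \<Otimes>\<^sub>M L) N' fst = N"
proof (rule measure_eqI)
  interpret N: prob_space N by fact
  interpret L: prob_space L by fact
  note [measurable_cong] = s
  fix A assume "A \<in> sets (distr (N \<Otimes>\<^sub>M L) N' fst)"
  then have A: "A \<in> sets N" using s by simp
  have [measurable]: "A \<in> sets N'" using A s by simp
  have "fst -` A \<inter> space (N \<Otimes>\<^sub>M L) = A \<times> space L"
    using sets.sets_into_space[OF A] by (auto simp: space_pair_measure)
  then show "emeasure (distr (N \<Otimes>\<^sub>M L) N' fst) A = emeasure N A"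
    using A by (simp add: emeasure_distr L.emeasure_pair_measure_Times L.emeasure_space_1)
qed (simp add: s)

lemma distr_snd_pair:
  assumes "prob_space N" "prob_space L" and s: "sets L = sets L'"
  shows "distr (N \<Otimes>\<^sub>M L) L' snd = L"
proof (rule measure_eqI)
  interpret N: prob_space N by fact
  interpret L: prob_space L by fact
  note [measurable_cong] = s
  fix A assume "A \<in> sets (distr (N \<Otimes>\<^sub>M L) L' snd)"
  then have A: "A \<in> sets L" using s by simp
  have [measurable]: "A \<in> sets L'" using A s by simp
  have "snd -` A \<inter> space (N \<Otimes>\<^sub>M L) = space N \<times> A"
    using sets.sets_into_space[OF A] by (auto simp: space_pair_measure)
  then show "emeasure (distr (N \<Otimes>\<^sub>M L) L' snd) A = emeasure L A"
    using A by (simp add: emeasure_distr L.emeasure_pair_measure_Times N.emeasure_space_1)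
qed (simp add: s)

lemma indep_joint_distr:
  assumes Q: "prob_space Q" and I: "independent_rvs Q N U L V"
  shows "distr Q (N \<Otimes>\<^sub>M L) (\<lambda>q. (U q, V q)) = distr Q N U \<Otimes>\<^sub>M distr Q L V"
proof -
  interpret Q: prob_space Q by fact
  have [measurable]: "U \<in> measurable Q N" "V \<in> measurable Q L" using I by (auto simp: independent_rvs_def)
  interpret U: prob_space "distr Q N U" by (rule Q.prob_space_distr) simp
  interpret V: prob_space "distr Q L V" by (rule Q.prob_space_distr) simp
  show ?thesis
  proof (rule pair_measure_eqI[symmetric])
    show "sigma_finite_measure (distr Q N U)" "sigma_finite_measure (distr Q L V)" by unfold_locales
    show "sets (distr Q N U \<Otimes>\<^sub>M distr Q L V) = sets (distr Q (N \<Otimes>\<^sub>M L) (\<lambda>q. (U q, V q)))"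
      by (simp cong: sets_pair_measure_cong)
    fix A B assume "A \<in> sets (distr Q N U)" "B \<in> sets (distr Q L V)"
    then have AB [measurable]: "A \<in> sets N" "B \<in> sets L" by auto
    have "Q.prob ((U -` A \<inter> space Q) \<inter> (V -` B \<inter> space Q)) = Q.prob (U -` A \<inter> space Q) * Q.prob (V -` B \<inter> space Q)"
      using I AB unfolding independent_rvs_def Q.indep_sets2_eq by blast
    moreover have "(\<lambda>q. (U q, V q)) -` (A \<times> B) \<inter> space Q = (U -` A \<inter> space Q) \<inter> (V -` B \<inter> space Q)" by auto
    ultimately show "emeasure (distr Q N U) A * emeasure (distr Q L V) B =
        emeasure (distr Q (N \<Otimes>\<^sub>M L) (\<lambda>q. (U q, V q))) (A \<times> B)"
      by (simp add: emeasure_distr Q.emeasure_eq_measure ennreal_mult'')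
  qed
qed

text \<open>A factor of the dispersion matrix, scaled by sqrt \<kappa>, realises each member as an
  affine image of a standard Gaussian vector: the characteristic functions agree, and
  \<open>char_unique_vec\<close> passes to the laws.\<close>

lemma gaussian_classI:
  assumes "0 \<le> \<kappa>" and \<psi>: "\<And>u. 0 \<le> u \<Longrightarrow> \<psi> u = exp (- \<kappa> * u / 2)"
  shows "gaussian_class \<psi>"
  unfolding gaussian_class_def
proof (intro allI impI)
  fix n and M :: "(nat \<Rightarrow> real) measure" and X
  assume "in_elliptical_class \<psi> n M X"
  then obtain \<mu> S where E: "elliptical n \<mu> S \<psi> M X" by (auto simp: in_elliptical_class_def)
  then have rv: "random_vector n M X" and psd: "psd_symmetric n S" by (auto simp: elliptical_def)
  obtain A where A: "\<And>i j. i < n \<Longrightarrow> j < n \<Longrightarrow> S i j = (\<Sum>k<n. A i k * A j k)"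
    using psd_factorisation[OF psd] by blast
  have q: "quad_form n (\<lambda>i j. \<Sum>l<n. sqrt \<kappa> * A i l * (sqrt \<kappa> * A j l)) t = \<kappa> * quad_form n S t" for t
  proof -
    have "sqrt \<kappa> * a * (sqrt \<kappa> * b) = (sqrt \<kappa> * sqrt \<kappa>) * (a * b)" for a b
      by (simp only: mult_ac)
    then have r: "sqrt \<kappa> * a * (sqrt \<kappa> * b) = \<kappa> * (a * b)" for a b
      using \<open>0 \<le> \<kappa>\<close> by simp
    have "(\<Sum>l<n. sqrt \<kappa> * A i l * (sqrt \<kappa> * A j l)) = \<kappa> * S i j" if "i < n" "j < n" for i j
      unfolding r A[OF that] sum_distrib_left ..
    then show ?thesis
      unfolding quad_form_def sum_distrib_left[of \<kappa>] by (intro sum.cong refl) simp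
  qed
  have "distr M (borel_vec n) X = distr (gauss n) (borel_vec n) (\<lambda>q. affine_vec n n \<mu> (\<lambda>i j. sqrt \<kappa> * A i j) 1 q)"
  proof (rule char_unique_vec[OF rv])
    show "random_vector n (gauss n) (\<lambda>q. affine_vec n n \<mu> (\<lambda>i j. sqrt \<kappa> * A i j) 1 q)"
      unfolding random_vector_def using prob_space_gauss by (intro conjI) measurable
    fix t
    show "(CLINT \<omega>|M. iexp (\<Sum>i<n. t i * X \<omega> i)) =
      (CLINT q|gauss n. iexp (\<Sum>i<n. t i * affine_vec n n \<mu> (\<lambda>i j. sqrt \<kappa> * A i j) 1 q i))"
      using E psd \<psi>[of "quad_form n S t"] unfolding affine_vec_char q elliptical_def psd_symmetric_def by simp
  qed
  then show "gaussian_vector n M X"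
    unfolding gaussian_vector_def using rv std_gaussian_vector_gauss[of n] by blast
qed

lemma gaussian_variance_mixture_familyI:
  assumes \<nu>: "prob_space \<nu>" "sets \<nu> = sets borel" "AE w in \<nu>. 0 \<le> w"
    and \<psi>: "\<And>u. 0 \<le> u \<Longrightarrow> \<psi> u = (LINT w|\<nu>. exp (- w * u / 2))"
  shows "gaussian_variance_mixture_family \<psi>"
  unfolding gaussian_variance_mixture_family_def
proof (intro exI[of _ \<nu>] conjI allI impI \<nu>)
  interpret N: prob_space \<nu> by fact
  fix n and M :: "(nat \<Rightarrow> real) measure" and X
  assume "in_elliptical_class \<psi> n M X"
  then obtain \<mu> S where E: "elliptical n \<mu> S \<psi> M X" by (auto simp: in_elliptical_class_def)
  then have rv: "random_vector n M X" and psd: "psd_symmetric n S" by (auto simp: elliptical_def)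
  obtain A where A: "\<And>i j. i < n \<Longrightarrow> j < n \<Longrightarrow> S i j = (\<Sum>k<n. A i k * A j k)"
    using psd_factorisation[OF psd] by blast
  have q: "quad_form n (\<lambda>i j. \<Sum>l<n. A i l * A j l) t = quad_form n S t" for t
    unfolding quad_form_def by (intro sum.cong refl) (simp add: A)
  interpret G: prob_space "gauss n" by (rule prob_space_gauss)
  interpret NG: pair_prob_space \<nu> "gauss n" ..
  note [measurable_cong] = \<nu>(2)
  have dfst: "distr (\<nu> \<Otimes>\<^sub>M gauss n) borel fst = \<nu>"
    by (rule distr_fst_pair) (simp_all add: \<nu> prob_space_gauss)
  have dsnd: "distr (\<nu> \<Otimes>\<^sub>M gauss n) (borel_vec n) snd = gauss n"
    by (rule distr_snd_pair) (simp_all add: \<nu> prob_space_gauss sets_gauss)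
  have "distr M (borel_vec n) X =
    distr (\<nu> \<Otimes>\<^sub>M gauss n) (borel_vec n) (\<lambda>q. affine_vec n n \<mu> A (sqrt (fst q)) (snd q))"
  proof (rule char_unique_vec[OF rv])
    show "random_vector n (\<nu> \<Otimes>\<^sub>M gauss n) (\<lambda>q. affine_vec n n \<mu> A (sqrt (fst q)) (snd q))"
      unfolding random_vector_def using NG.prob_space_axioms by (intro conjI) measurable
    fix t
    show "(CLINT \<omega>|M. iexp (\<Sum>i<n. t i * X \<omega> i)) =
      (CLINT q|\<nu> \<Otimes>\<^sub>M gauss n. iexp (\<Sum>i<n. t i * affine_vec n n \<mu> A (sqrt (fst q)) (snd q) i))"
      using E psd \<psi>[of "quad_form n S t"]
      unfolding integral_affine_mixture[OF \<nu>] q elliptical_def psd_symmetric_def by simp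
  qed
  moreover have "std_gaussian_vector n (\<nu> \<Otimes>\<^sub>M gauss n) snd"
    unfolding std_gaussian_vector_def random_vector_def dsnd using NG.prob_space_axioms
    by (intro conjI refl) measurable
  moreover have "independent_rvs (\<nu> \<Otimes>\<^sub>M gauss n) borel fst (borel_vec n) snd"
    by (rule indep_fst_snd) (simp_all add: \<nu> prob_space_gauss sets_gauss)
  moreover have "fst \<in> borel_measurable (\<nu> \<Otimes>\<^sub>M gauss n)" by measurable
  ultimately show "\<exists>\<mu> k A (Q :: (real \<times> (nat \<Rightarrow> real)) measure) W Z. W \<in> borel_measurable Q \<and>
      distr Q borel W = \<nu> \<and> std_gaussian_vector k Q Z \<and> independent_rvs Q borel W (borel_vec k) Z \<and>
      distr M (borel_vec n) X = distr Q (borel_vec n) (\<lambda>q. affine_vec n k \<mu> A (sqrt (W q)) (Z q))"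
    using dfst by blast
qed

text \<open>At s = pi / (2 d) the phase is the imaginary unit, which times a positive number is not
  real. This identifies the locations of two representations.\<close>

lemma real_valued_phase:
  fixes f g :: "real \<Rightarrow> real"
  assumes e: "\<And>s. of_real (f s) = iexp (s * d) * of_real (g s)" and g: "\<And>s. 0 < g s"
  shows "f s = g s"
proof -
  have "d = 0"
  proof (rule ccontr)
    assume "d \<noteq> 0"
    then have "Im (iexp (pi / (2 * d) * d) * of_real (g (pi / (2 * d)))) = g (pi / (2 * d))"
      by (simp add: Im_exp)
    then show False using e[of "pi / (2 * d)"] g[of "pi / (2 * d)"] by (metis Im_complex_of_real less_irrefl)
  qed
  then show ?thesis using e[of s] by simp
qed

text \<open>The Gaussian or mixture representation has its own location m and matrix A, unrelated to
  the parameters of the elliptical one. The two are compared on the first coordinate axis only: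
  \<open>real_valued_phase\<close> removes the locations, and \<kappa> is the ratio of the two
  dispersions of this coordinate.\<close>

lemma affine_generator:
  assumes P: "generating_law \<psi> P" and C: "in_elliptical_class \<psi> n M X"
    and L: "\<And>u. 0 < L u"
    and ch: "\<And>t. (CLINT \<omega>|M. iexp (\<Sum>i<n. t i * X \<omega> i)) =
      iexp (\<Sum>i<n. t i * m i) * of_real (L (quad_form n (\<lambda>i j. \<Sum>l<k. A i l * A j l) t))"
  obtains \<kappa> where "0 \<le> \<kappa>" "\<And>u. 0 \<le> u \<Longrightarrow> \<psi> u = L (\<kappa> * u)"
proof -
  from C obtain \<mu> S where n: "0 < n" and nd: "nondegenerate n M X" and E: "elliptical n \<mu> S \<psi> M X"
    by (auto simp: in_elliptical_class_def)
  have pos: "0 < S 0 0" by (rule in_elliptical_class_diag_pos[OF P E nd n])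
  define a where "a = (\<Sum>l<k. A 0 l * A 0 l)"
  have a: "0 \<le> a" unfolding a_def by (intro sum_nonneg) simp
  have "of_real (\<psi> (s\<^sup>2 * S 0 0)) = iexp (s * (m 0 - \<mu> 0)) * of_real (L (s\<^sup>2 * a))" for s
  proof -
    have "iexp (s * \<mu> 0) * of_real (\<psi> (s\<^sup>2 * S 0 0)) = iexp (s * m 0) * of_real (L (s\<^sup>2 * a))"
    proof -
      let ?t = "\<lambda>k :: nat. if k = 0 then s else 0"
      have "(CLINT \<omega>|M. iexp (\<Sum>i<n. ?t i * X \<omega> i)) =
          iexp (\<Sum>i<n. ?t i * \<mu> i) * of_real (\<psi> (quad_form n S ?t))"
        using E unfolding elliptical_def by (elim conjE) (erule spec)
      then show ?thesis
        unfolding ch unfolding quad_form_one[OF n] sum_one[OF n] a_def by (rule sym)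
    qed
    then have "iexp (- (s * \<mu> 0)) * (iexp (s * \<mu> 0) * of_real (\<psi> (s\<^sup>2 * S 0 0))) =
       iexp (- (s * \<mu> 0)) * (iexp (s * m 0) * of_real (L (s\<^sup>2 * a)))" by (simp only:)
    then show ?thesis unfolding mult.assoc[symmetric] exp_add[symmetric] by (simp add: algebra_simps)
  qed
  then have eq: "\<psi> (s\<^sup>2 * S 0 0) = L (s\<^sup>2 * a)" for s
    by (rule real_valued_phase) (rule L)
  show ?thesis
  proof
    show "0 \<le> a / S 0 0" using a pos by simp
    show "\<psi> u = L (a / S 0 0 * u)" if "0 \<le> u" for u
      using eq[of "sqrt (u / S 0 0)"] pos that by (simp add: field_simps)
  qed
qed

lemma gaussian_classD:
  fixes M :: "(nat \<Rightarrow> real) measure"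
  assumes G: "gaussian_class \<psi>" and P: "generating_law \<psi> P" and C: "in_elliptical_class \<psi> n M X"
  shows "\<exists>\<kappa>\<ge>0. \<forall>u\<ge>0. \<psi> u = exp (- \<kappa> * u / 2)"
proof -
  obtain m k A and Q :: "(nat \<Rightarrow> real) measure" and Z where Z: "std_gaussian_vector k Q Z"
    and d: "distr M (borel_vec n) X = distr Q (borel_vec n) (\<lambda>q. affine_vec n k m A 1 (Z q))"
    and rv: "random_vector n M X"
    using G C unfolding gaussian_class_def gaussian_vector_def by blast
  have [measurable]: "X \<in> measurable M (borel_vec n)" "Z \<in> measurable Q (borel_vec k)"
    using rv Z by (auto simp: random_vector_def std_gaussian_vector_def)
  have c: "(\<lambda>x. iexp (\<Sum>i<n. t i * x i)) \<in> borel_measurable (borel_vec n)" for t :: "nat \<Rightarrow> real"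
    by measurable
  have c': "(\<lambda>z. iexp (\<Sum>i<n. t i * affine_vec n k m A 1 z i)) \<in> borel_measurable (borel_vec k)" for t :: "nat \<Rightarrow> real"
    by (rule measurable_compose[OF _ c]) measurable
  have ch: "(CLINT \<omega>|M. iexp (\<Sum>i<n. t i * X \<omega> i)) =
      iexp (\<Sum>i<n. t i * m i) * of_real (exp (- quad_form n (\<lambda>i j. \<Sum>l<k. A i l * A j l) t / 2))" for t
  proof -
    have "(CLINT \<omega>|M. iexp (\<Sum>i<n. t i * X \<omega> i)) = (CLINT x|distr M (borel_vec n) X. iexp (\<Sum>i<n. t i * x i))"
      by (rule integral_distr[symmetric]) (use c in auto)
    also have "\<dots> = (CLINT q|Q. iexp (\<Sum>i<n. t i * affine_vec n k m A 1 (Z q) i))"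
      unfolding d by (rule integral_distr) (use c in auto)
    also have "\<dots> = (CLINT z|distr Q (borel_vec k) Z. iexp (\<Sum>i<n. t i * affine_vec n k m A 1 z i))"
      by (rule integral_distr[symmetric]) (use c' in auto)
    also have "distr Q (borel_vec k) Z = gauss k" using Z by (simp add: std_gaussian_vector_def)
    finally show ?thesis unfolding affine_vec_char by simp
  qed
  show ?thesis
  proof (rule affine_generator[OF P C, of "\<lambda>u. exp (- u / 2)" m A k])
    show "(CLINT \<omega>|M. iexp (\<Sum>i<n. t i * X \<omega> i)) =
      iexp (\<Sum>i<n. t i * m i) * of_real (exp (- quad_form n (\<lambda>i j. \<Sum>l<k. A i l * A j l) t / 2))" for t
      by (rule ch)
    fix \<kappa> assume "0 \<le> \<kappa>" and "\<And>u. 0 \<le> u \<Longrightarrow> \<psi> u = exp (- (\<kappa> * u) / 2)"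
    then show "\<exists>\<kappa>\<ge>0. \<forall>u\<ge>0. \<psi> u = exp (- \<kappa> * u / 2)" by auto
  qed simp
qed

lemma gaussian_variance_mixture_familyD:
  fixes M :: "(nat \<Rightarrow> real) measure"
  assumes G: "gaussian_variance_mixture_family \<psi>" and P: "generating_law \<psi> P" and C: "in_elliptical_class \<psi> n M X"
  shows "\<exists>(\<nu> :: real measure) \<kappa>. prob_space \<nu> \<and> sets \<nu> = sets borel \<and> (AE w in \<nu>. 0 \<le> w) \<and> 0 \<le> \<kappa> \<and>
    (\<forall>u\<ge>0. \<psi> u = (LINT w|\<nu>. exp (- w * (\<kappa> * u) / 2)))"
proof -
  obtain \<nu> :: "real measure" and m k A and Q :: "(real \<times> (nat \<Rightarrow> real)) measure" and W Z where
    \<nu>: "prob_space \<nu>" "sets \<nu> = sets borel" "AE w in \<nu>. 0 \<le> w" and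
    W: "W \<in> borel_measurable Q" "distr Q borel W = \<nu>" and Z: "std_gaussian_vector k Q Z" and
    I: "independent_rvs Q borel W (borel_vec k) Z" and
    d: "distr M (borel_vec n) X = distr Q (borel_vec n) (\<lambda>q. affine_vec n k m A (sqrt (W q)) (Z q))"
    using G C unfolding gaussian_variance_mixture_family_def by blast
  have rv: "random_vector n M X" using C by (auto simp: in_elliptical_class_def elliptical_def)
  interpret N: prob_space \<nu> by fact
  have [measurable]: "X \<in> measurable M (borel_vec n)" "Z \<in> measurable Q (borel_vec k)" "W \<in> borel_measurable Q"
    using rv Z W by (auto simp: random_vector_def std_gaussian_vector_def)
  have Q: "prob_space Q" using Z by (auto simp: random_vector_def std_gaussian_vector_def)
  have c: "(\<lambda>x. iexp (\<Sum>i<n. t i * x i)) \<in> borel_measurable (borel_vec n)" for t :: "nat \<Rightarrow> real"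
    by measurable
  have c': "(\<lambda>p. iexp (\<Sum>i<n. t i * affine_vec n k m A (sqrt (fst p)) (snd p) i)) \<in> borel_measurable (borel \<Otimes>\<^sub>M borel_vec k)"
    for t :: "nat \<Rightarrow> real"
    by (rule measurable_compose[OF _ c]) measurable
  have ch: "(CLINT \<omega>|M. iexp (\<Sum>i<n. t i * X \<omega> i)) =
      iexp (\<Sum>i<n. t i * m i) * of_real (LINT w|\<nu>. exp (- w * quad_form n (\<lambda>i j. \<Sum>l<k. A i l * A j l) t / 2))" for t
  proof -
    have "(CLINT \<omega>|M. iexp (\<Sum>i<n. t i * X \<omega> i)) = (CLINT x|distr M (borel_vec n) X. iexp (\<Sum>i<n. t i * x i))"
      by (rule integral_distr[symmetric]) (use c in auto)
    also have "\<dots> = (CLINT q|Q. iexp (\<Sum>i<n. t i * affine_vec n k m A (sqrt (W q)) (Z q) i))"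
      unfolding d by (rule integral_distr) (use c in auto)
    also have "\<dots> = (CLINT p|distr Q (borel \<Otimes>\<^sub>M borel_vec k) (\<lambda>q. (W q, Z q)).
        iexp (\<Sum>i<n. t i * affine_vec n k m A (sqrt (fst p)) (snd p) i))"
      by (subst integral_distr) (use c' in auto)
    also have "distr Q (borel \<Otimes>\<^sub>M borel_vec k) (\<lambda>q. (W q, Z q)) = \<nu> \<Otimes>\<^sub>M gauss k"
      using Z W(2) unfolding indep_joint_distr[OF Q I] by (simp add: std_gaussian_vector_def)
    finally show ?thesis unfolding integral_affine_mixture[OF \<nu>] .
  qed
  note [measurable_cong] = \<nu>(2)
  have pos: "0 < (LINT w|\<nu>. exp (- w * u / 2))" if u: "0 \<le> u" for u
  proof -
    have i: "integrable \<nu> (\<lambda>w. exp (- w * u / 2))"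
      by (rule N.integrable_const_bound[of _ 1]) (use \<nu>(3) u in auto)
    have "\<not> (AE w in \<nu>. exp (- w * u / 2) = 0)" by (simp add: N.AE_False)
    then have "(LINT w|\<nu>. exp (- w * u / 2)) \<noteq> 0"
      using integral_nonneg_eq_0_iff_AE[OF i] by auto
    moreover have "0 \<le> (LINT w|\<nu>. exp (- w * u / 2))" by (intro integral_nonneg_AE) auto
    ultimately show ?thesis by (simp only: less_le eq_commute[of 0] not_False_eq_True simp_thms)
  qed
  \<comment> \<open>\<open>affine_generator\<close> asks for a function that is positive on the
    whole line. For negative u the integral may diverge, and the Bochner integral would then be 0,
    so L is set to 1 there.\<close>
  define L where "L u = (if 0 \<le> u then LINT w|\<nu>. exp (- w * u / 2) else 1)" for u
  have q: "0 \<le> quad_form n (\<lambda>i j. \<Sum>l<k. A i l * A j l) t" for t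
  proof -
    have "quad_form n (\<lambda>i j. \<Sum>l<k. A i l * A j l) t = (\<Sum>i<n. \<Sum>j<n. \<Sum>l<k. t i * A i l * (t j * A j l))"
      unfolding quad_form_def by (simp add: sum_distrib_left sum_distrib_right mult_ac)
    also have "\<dots> = (\<Sum>l<k. \<Sum>i<n. \<Sum>j<n. t i * A i l * (t j * A j l))"
      by (rule trans[OF sum.cong[OF refl sum.swap] sum.swap])
    also have "\<dots> = (\<Sum>l<k. (\<Sum>i<n. t i * A i l)\<^sup>2)" by (simp add: power2_eq_square sum_product)
    finally show ?thesis by (simp add: sum_nonneg)
  qed
  show ?thesis
  proof (rule affine_generator[OF P C, of L m A k])
    show "0 < L u" for u using pos by (simp add: L_def)
    show "(CLINT \<omega>|M. iexp (\<Sum>i<n. t i * X \<omega> i)) =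
      iexp (\<Sum>i<n. t i * m i) * of_real (L (quad_form n (\<lambda>i j. \<Sum>l<k. A i l * A j l) t))" for t
      unfolding ch L_def using q[of t] by simp
    fix \<kappa> assume "0 \<le> \<kappa>" and "\<And>u. 0 \<le> u \<Longrightarrow> \<psi> u = L (\<kappa> * u)"
    then have "0 \<le> \<kappa> \<and> (\<forall>u\<ge>0. \<psi> u = (LINT w|\<nu>. exp (- w * (\<kappa> * u) / 2)))" by (simp add: L_def)
    with \<nu> show "\<exists>(\<nu> :: real measure) \<kappa>. prob_space \<nu> \<and> sets \<nu> = sets borel \<and> (AE w in \<nu>. 0 \<le> w) \<and> 0 \<le> \<kappa> \<and>
      (\<forall>u\<ge>0. \<psi> u = (LINT w|\<nu>. exp (- w * (\<kappa> * u) / 2)))" by blast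
  qed
qed

section \<open>Negative correlation and variance mixtures\<close>

lemma tail_le_laplace:
  assumes D: "real_distribution D" and nn: "AE w in D. 0 \<le> w" and u: "0 < u" and b: "2 / u \<le> b"
  shows "(1 - exp (-1)) * measure D {b<..} \<le> 1 - (LINT w|D. exp (- w * u / 2))"
proof -
  interpret D: real_distribution D by fact
  have i: "integrable D (\<lambda>w. exp (- w * u / 2))"
    by (rule D.integrable_const_bound[of _ 1]) (use nn u in auto)
  have "(1 - exp (-1)) * measure D {b<..} = (LINT w|D. (1 - exp (-1)) * indicator {b<..} w)" by simp
  \<comment> \<open>Beyond b, which is at least 2 / u, the exponent w u / 2 is at least 1; this is
    Markov's inequality for 1 - exp (- w u / 2).\<close>
  also have "\<dots> \<le> (LINT w|D. 1 - exp (- w * u / 2))"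
  proof (rule integral_mono_AE)
    show "integrable D (\<lambda>w. (1 - exp (-1)) * indicator {b<..} w :: real)" by (simp add: D.emeasure_eq_measure)
    show "integrable D (\<lambda>w. 1 - exp (- w * u / 2))" using i by simp
    show "AE w in D. (1 - exp (-1)) * indicator {b<..} w \<le> 1 - exp (- w * u / 2)"
      using nn
    proof eventually_elim
      case (elim w)
      show ?case
      proof (cases "b < w")
        case True
        then have "2 / u \<le> w" using b by simp
        then have "1 \<le> w * u / 2" using u by (simp add: field_simps)
        then show ?thesis using True by simp
      qed (use elim u in simp)
    qed
  qed
  also have "\<dots> = 1 - (LINT w|D. exp (- w * u / 2))" using i D.prob_space by simp
  finally show ?thesis .
qed

text \<open>Continuity of \<psi> at 0 makes 1 minus the transform small at one small u > 0 and all
  large k, so \<open>tail_le_laplace\<close> bounds the tails and the laws are tight. A weak limit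
  along a subsequence then has Laplace transform \<psi>.\<close>

theorem laplace_continuity:
  fixes D :: "nat \<Rightarrow> real measure"
  assumes D: "\<And>k. real_distribution (D k)" and nn: "\<And>k. AE w in D k. 0 \<le> w"
    and lim: "\<And>u. 0 \<le> u \<Longrightarrow> (\<lambda>k. LINT w|D k. exp (- w * u / 2)) \<longlonglongrightarrow> \<psi> u"
    and cont: "continuous_on {0..} \<psi>" and one: "\<psi> 0 = 1"
  obtains \<nu> :: "real measure" where "prob_space \<nu>" "sets \<nu> = sets borel" "AE w in \<nu>. 0 \<le> w"
    "\<And>u. 0 \<le> u \<Longrightarrow> \<psi> u = (LINT w|\<nu>. exp (- w * u / 2))"
proof -
  \<comment> \<open>\<open>tight\<close> is phrased with half-open intervals {a<..b}; the left end
    -1 keeps a possible atom at 0 inside.\<close>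
  have tail: "1 - \<epsilon> < measure (D k) {-1<..b}" if "measure (D k) {b<..} < \<epsilon>" for k b \<epsilon>
  proof -
    interpret real_distribution "D k" by (rule D)
    have "AE w in D k. w \<notin> {..-1}" using nn[of k] by eventually_elim auto
    then have "{..-1} \<in> null_sets (D k)" by (subst AE_iff_null_sets) auto
    then have "measure (D k) {..-1} = 0" by (rule measure_eq_0_null_sets)
    moreover have "1 \<le> measure (D k) ({-1<..b} \<union> {b<..} \<union> {..-1})"
    proof -
      have "{-1<..b} \<union> {b<..} \<union> {..-1} = space (D k)" by auto
      then show ?thesis using prob_space by simp
    qed
    moreover have "measure (D k) ({-1<..b} \<union> {b<..} \<union> {..-1}) \<le> measure (D k) {-1<..b} + measure (D k) {b<..} + measure (D k) {..-1}"
      using measure_Un_le[of "{-1<..b} \<union> {b<..}" "D k" "{..-1}"] measure_Un_le[of "{-1<..b}" "D k" "{b<..}"] by simp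
    ultimately show ?thesis using that by linarith
  qed
  have "tight D"
    unfolding tight_def
  proof (intro conjI allI impI D)
    fix \<epsilon> :: real assume \<epsilon>: "0 < \<epsilon>"
    define c :: real where "c = 1 - exp (-1)"
    have c: "0 < c" by (simp add: c_def)
    have "\<exists>d>0. \<forall>u\<in>{0..}. dist u 0 < d \<longrightarrow> dist (\<psi> u) (\<psi> 0) < \<epsilon> * c / 2"
      using cont[unfolded continuous_on_iff, rule_format, of 0 "\<epsilon> * c / 2"] \<epsilon> c by simp
    then obtain d where d: "0 < d" and dd: "\<And>u. 0 \<le> u \<Longrightarrow> u < d \<Longrightarrow> \<bar>\<psi> u - 1\<bar> < \<epsilon> * c / 2"
      by (auto simp: dist_real_def one)
    define u where "u = d / 2"
    have u: "0 < u" and pu: "\<bar>\<psi> u - 1\<bar> < \<epsilon> * c / 2" using d dd[of u] by (auto simp: u_def)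
    have "\<forall>\<^sub>F k in sequentially. dist (LINT w|D k. exp (- w * u / 2)) (\<psi> u) < \<epsilon> * c / 2"
      by (rule tendstoD[OF lim]) (use u \<epsilon> c in auto)
    then obtain K where K: "\<And>k. K \<le> k \<Longrightarrow> \<bar>(LINT w|D k. exp (- w * u / 2)) - \<psi> u\<bar> < \<epsilon> * c / 2"
      by (auto simp: eventually_sequentially dist_real_def)
    have late: "measure (D k) {b<..} < \<epsilon>" if "K \<le> k" "2 / u \<le> b" for k b
    proof -
      have "c * measure (D k) {b<..} \<le> 1 - (LINT w|D k. exp (- w * u / 2))"
        unfolding c_def by (rule tail_le_laplace[OF D nn u that(2)])
      also have "\<dots> < c * \<epsilon>" using K[OF that(1)] pu by (simp add: abs_if mult.commute split: if_splits)
      finally show ?thesis using c by simp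
    qed
    have "\<forall>\<^sub>F b in at_top. measure (D k) {b<..} < \<epsilon>" for k
    proof -
      interpret real_distribution "D k" by (rule D)
      have "\<forall>\<^sub>F b in at_top. 1 - \<epsilon> < cdf (D k) b"
        using order_tendstoD(1)[OF cdf_lim_at_top_prob, of "1 - \<epsilon>"] \<epsilon> by simp
      then show ?thesis
      proof eventually_elim
        case (elim b)
        have "measure (D k) {b<..} = 1 - cdf (D k) b"
          using prob_compl[of "{..b}"] by (simp add: cdf_def Compl_eq_Diff_UNIV[symmetric])
        then show ?case using elim by simp
      qed
    qed
    \<comment> \<open>The limit controls the tails for k \<ge> K only; each of the finitely many
      earlier laws has its own bound, and b is chosen beyond all of them.\<close>
    then have "\<forall>\<^sub>F b in at_top. (\<forall>k\<in>{..<K}. measure (D k) {b<..} < \<epsilon>) \<and> 2 / u \<le> b \<and> 0 \<le> b"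
      by (intro eventually_conj eventually_ge_at_top eventually_ball_finite) auto
    then obtain b where b: "\<And>k. k < K \<Longrightarrow> measure (D k) {b<..} < \<epsilon>" "2 / u \<le> b" "0 \<le> b"
      by (auto simp: eventually_at_top_linorder)
    have "measure (D k) {b<..} < \<epsilon>" for k
      using b late by (cases "k < K") auto
    then show "\<exists>a b. a < b \<and> (\<forall>n. 1 - \<epsilon> < measure (D n) {a<..b})"
      using tail b(3) by (intro exI[of _ "-1"] exI[of _ b]) auto
  qed
  then obtain r \<nu> where r: "strict_mono (r :: nat \<Rightarrow> nat)" and \<nu>: "real_distribution \<nu>" and w: "weak_conv_m (D \<circ> id \<circ> r) \<nu>"
    using tight_imp_convergent_subsubsequence[of D id] by (auto simp: strict_mono_id)
  interpret N: real_distribution \<nu> by fact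
  have conv: "(\<lambda>k. LINT w|D (r k). f w) \<longlonglongrightarrow> (LINT w|\<nu>. f w)"
    if "\<And>x. isCont f x" "\<And>x. \<bar>f x\<bar> \<le> 1" for f :: "real \<Rightarrow> real"
    using weak_conv_imp_integral_bdd_continuous_conv[of "D \<circ> id \<circ> r" \<nu> f 1] D \<nu> w that by simp
  have nonneg: "AE w in \<nu>. 0 \<le> w"
  proof -
    \<comment> \<open>Bounded, continuous, and zero exactly on the nonnegative reals, so its
      integral detects mass on the negative ones.\<close>
    define g where "g w = min 1 (max 0 (- w))" for w :: real
    have g: "isCont g x" "\<bar>g x\<bar> \<le> 1" "0 \<le> g x" for x unfolding g_def by (auto intro!: continuous_intros)
    have gm: "g \<in> borel_measurable borel" unfolding g_def by measurable
    have "(LINT w|D (r k). g w) = 0" for k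
    proof -
      interpret real_distribution "D (r k)" by (rule D)
      have "(LINT w|D (r k). g w) = (LINT w|D (r k). 0)"
        using nn[of "r k"] gm by (intro integral_cong_AE) (auto simp: g_def elim: eventually_mono)
      then show ?thesis by simp
    qed
    then have "(LINT w|\<nu>. g w) = 0"
      using LIMSEQ_unique[OF conv[of g]] g by auto
    moreover have "integrable \<nu> g" by (rule N.integrable_const_bound[of _ 1]) (use g gm in auto)
    ultimately have "AE w in \<nu>. g w = 0" using integral_nonneg_eq_0_iff_AE[of \<nu> g] g by auto
    then show ?thesis by eventually_elim (auto simp: g_def min_def max_def split: if_splits)
  qed
  show ?thesis
  proof (rule that[of \<nu>])
    show "prob_space \<nu>" by (rule N.prob_space_axioms)
    show "sets \<nu> = sets borel" by simp
    show "AE w in \<nu>. 0 \<le> w" by (rule nonneg)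
    fix u :: real assume u: "0 \<le> u"
    \<comment> \<open>Clipping at 0 makes the exponential bounded, as weak convergence requires;
      almost surely it changes nothing.\<close>
    define f where "f w = exp (- max 0 w * u / 2)" for w :: real
    have f: "isCont f x" "\<bar>f x\<bar> \<le> 1" for x using u unfolding f_def by (auto intro!: continuous_intros)
    have fm: "f \<in> borel_measurable borel" unfolding f_def by measurable
    have "(LINT w|D (r k). f w) = (LINT w|D (r k). exp (- w * u / 2))" for k
    proof -
      interpret real_distribution "D (r k)" by (rule D)
      have "AE w in D (r k). f w = exp (- w * u / 2)"
        using nn[of "r k"] by eventually_elim (simp add: f_def)
      then show ?thesis
        by (rule integral_cong_AE[rotated 2]) (use fm in auto)
    qed
    then have "(\<lambda>k. LINT w|D (r k). exp (- w * u / 2)) \<longlonglongrightarrow> (LINT w|\<nu>. f w)"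
      using conv[of f] f by simp
    moreover have "(\<lambda>k. LINT w|D (r k). exp (- w * u / 2)) \<longlonglongrightarrow> \<psi> u"
      using LIMSEQ_subseq_LIMSEQ[OF lim[OF u] r] by (simp add: comp_def)
    ultimately have "\<psi> u = (LINT w|\<nu>. f w)" by (rule LIMSEQ_unique[symmetric])
    also have "\<dots> = (LINT w|\<nu>. exp (- w * u / 2))"
    proof -
      have "AE w in \<nu>. f w = exp (- w * u / 2)"
        using nonneg by eventually_elim (simp add: f_def)
      then show ?thesis
        by (rule integral_cong_AE[rotated 2]) (use fm in auto)
    qed
    finally show "\<psi> u = (LINT w|\<nu>. exp (- w * u / 2))" .
  qed
qed

section \<open>Second moments and covariances of elliptical vectors\<close>

lemma elliptical_linear_integrals:
  fixes f :: "real \<Rightarrow> real"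
  assumes P: "generating_law \<psi> P" and E: "elliptical n \<mu> S \<psi> M X" and [measurable]: "f \<in> borel_measurable borel"
  shows "integrable M (\<lambda>\<omega>. f (\<Sum>i<n. t i * (X \<omega> i - \<mu> i))) \<longleftrightarrow> integrable P (\<lambda>y. f (sqrt (quad_form n S t) * y))"
    and "(LINT \<omega>|M. f (\<Sum>i<n. t i * (X \<omega> i - \<mu> i))) = (LINT y|P. f (sqrt (quad_form n S t) * y))"
proof -
  interpret P: real_distribution P using P by (simp add: generating_law_def)
  have "(\<lambda>\<omega>. X \<omega> i) \<in> borel_measurable M" if "i < n" for i
    using elliptical_component[OF E that] .
  then have m: "(\<lambda>\<omega>. \<Sum>i<n. t i * (X \<omega> i - \<mu> i)) \<in> borel_measurable M"
    by (intro borel_measurable_sum) auto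
  have mP: "(\<lambda>y. sqrt (quad_form n S t) * y) \<in> borel_measurable P" by simp
  note d = elliptical_linear_distr[OF P E, of t]
  show "integrable M (\<lambda>\<omega>. f (\<Sum>i<n. t i * (X \<omega> i - \<mu> i))) \<longleftrightarrow> integrable P (\<lambda>y. f (sqrt (quad_form n S t) * y))"
    using integrable_distr_eq[OF m assms(3)] integrable_distr_eq[OF mP assms(3)] d by simp
  show "(LINT \<omega>|M. f (\<Sum>i<n. t i * (X \<omega> i - \<mu> i))) = (LINT y|P. f (sqrt (quad_form n S t) * y))"
    using integral_distr[OF m assms(3)] integral_distr[OF mP assms(3)] d by simp
qed

text \<open>Polarisation: a product is a difference of squares of linear combinations, and these are
  scaled copies of \<open>P\<close>, so their second moments are values of the quadratic form times
  that of \<open>P\<close>. The means are mu because \<open>P\<close> is symmetric.\<close>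

lemma elliptical_covariance:
  assumes P: "generating_law \<psi> P" and E: "elliptical n \<mu> S \<psi> M X" and ij: "i < n" "j < n" "i \<noteq> j"
    and iP: "integrable P (\<lambda>y. y\<^sup>2)"
  shows "covariance_exists M (\<lambda>\<omega>. X \<omega> i) (\<lambda>\<omega>. X \<omega> j)"
    and "covariance M (\<lambda>\<omega>. X \<omega> i) (\<lambda>\<omega>. X \<omega> j) = S i j * (LINT y|P. y\<^sup>2)"
proof -
  interpret P: real_distribution P using P by (simp add: generating_law_def)
  interpret M: prob_space M using E by (rule elliptical_prob_space)
  have psd: "0 \<le> quad_form n S t" for t using E by (simp add: elliptical_def psd_symmetric_def)
  have sym: "S j i = S i j" using E ij by (simp add: elliptical_def psd_symmetric_def)
  have i1: "integrable P (\<lambda>y. y)" by (rule P.square_integrable_imp_integrable) (use iP in auto)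
  have "(LINT y|P. y) = (LINT y|distr P borel uminus. y)" by (simp only: generating_law_symmetric[OF P])
  also have "\<dots> = - (LINT y|P. y)" by (subst integral_distr) auto
  finally have m0: "(LINT y|P. y) = 0" by simp
  have mean: "integrable M (\<lambda>\<omega>. X \<omega> k)" "(LINT \<omega>|M. X \<omega> k) = \<mu> k" if "k < n" for k
  proof -
    let ?t = "\<lambda>l :: nat. if l = k then 1 else 0 :: real"
    have s: "(\<Sum>l<n. ?t l * (x l - \<mu> l)) = x k - \<mu> k" for x using sum_one[OF that] by simp
    note L = elliptical_linear_integrals[OF P E measurable_ident_sets[OF refl], of ?t, unfolded s]
    have "integrable M (\<lambda>\<omega>. X \<omega> k - \<mu> k)"
      unfolding L(1) by (rule integrable_mult_right) (rule i1)
    moreover have "(LINT \<omega>|M. X \<omega> k - \<mu> k) = 0"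
      unfolding L(2) by (simp only: integral_mult_right_zero m0 mult_zero_right)
    moreover from calculation(1) have "integrable M (\<lambda>\<omega>. (X \<omega> k - \<mu> k) + \<mu> k)"
      by (intro Bochner_Integration.integrable_add) auto
    ultimately show "integrable M (\<lambda>\<omega>. X \<omega> k)" "(LINT \<omega>|M. X \<omega> k) = \<mu> k" by (simp_all add: M.prob_space)
  qed
  have sq: "integrable M (\<lambda>\<omega>. (a * (X \<omega> i - \<mu> i) + b * (X \<omega> j - \<mu> j))\<^sup>2)"
    "(LINT \<omega>|M. (a * (X \<omega> i - \<mu> i) + b * (X \<omega> j - \<mu> j))\<^sup>2) =
      (a\<^sup>2 * S i i + 2 * a * b * S i j + b\<^sup>2 * S j j) * (LINT y|P. y\<^sup>2)" for a b
  proof -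
    let ?t = "\<lambda>l. if l = i then a else if l = j then b else 0"
    have q: "quad_form n S ?t = a\<^sup>2 * S i i + 2 * a * b * S i j + b\<^sup>2 * S j j"
      unfolding quad_form_two[OF ij] sym by simp
    have e: "(sqrt (quad_form n S ?t) * y)\<^sup>2 = quad_form n S ?t * y\<^sup>2" for y
      using psd[of ?t] by (simp only: power_mult_distrib real_sqrt_pow2)
    have m: "(\<lambda>x. x\<^sup>2) \<in> borel_measurable (borel :: real measure)" by measurable
    note L = elliptical_linear_integrals[OF P E m, of ?t, unfolded e sum_two[OF ij]]
    show "integrable M (\<lambda>\<omega>. (a * (X \<omega> i - \<mu> i) + b * (X \<omega> j - \<mu> j))\<^sup>2)"
      unfolding L(1) by (rule integrable_mult_right) (rule iP)
    show "(LINT \<omega>|M. (a * (X \<omega> i - \<mu> i) + b * (X \<omega> j - \<mu> j))\<^sup>2) =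
      (a\<^sup>2 * S i i + 2 * a * b * S i j + b\<^sup>2 * S j j) * (LINT y|P. y\<^sup>2)"
      unfolding L(2) q integral_mult_right_zero ..
  qed
  have pol: "(X \<omega> i - \<mu> i) * (X \<omega> j - \<mu> j) =
    (1 / 4) * ((1 * (X \<omega> i - \<mu> i) + 1 * (X \<omega> j - \<mu> j))\<^sup>2 - (1 * (X \<omega> i - \<mu> i) + (-1) * (X \<omega> j - \<mu> j))\<^sup>2)" for \<omega>
    by (simp add: power2_eq_square algebra_simps)
  have prod: "integrable M (\<lambda>\<omega>. (X \<omega> i - \<mu> i) * (X \<omega> j - \<mu> j))"
    unfolding pol using sq(1)[of 1 1] sq(1)[of 1 "-1"]
    by (intro integrable_mult_right Bochner_Integration.integrable_diff) auto
  have "X \<omega> i * X \<omega> j = (X \<omega> i - \<mu> i) * (X \<omega> j - \<mu> j) + \<mu> j * X \<omega> i + \<mu> i * X \<omega> j - \<mu> i * \<mu> j" for \<omega>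
    by (simp add: algebra_simps)
  then have "integrable M (\<lambda>\<omega>. X \<omega> i * X \<omega> j)" using prod mean ij by simp
  then show "covariance_exists M (\<lambda>\<omega>. X \<omega> i) (\<lambda>\<omega>. X \<omega> j)"
    using mean ij by (simp add: covariance_exists_def)
  show "covariance M (\<lambda>\<omega>. X \<omega> i) (\<lambda>\<omega>. X \<omega> j) = S i j * (LINT y|P. y\<^sup>2)"
    unfolding covariance_def mean(2)[OF ij(1)] mean(2)[OF ij(2)] pol
    unfolding integral_mult_right_zero Bochner_Integration.integral_diff[OF sq(1) sq(1)] sq(2)
    by (simp add: algebra_simps)
qed

lemma generating_law_second_moment_pos:
  assumes P: "generating_law \<psi> P" and iP: "integrable P (\<lambda>y. y\<^sup>2)"
  shows "0 < (LINT y|P. y\<^sup>2)"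
proof -
  have "(LINT y|P. y\<^sup>2) \<noteq> 0"
    using P integral_nonneg_eq_0_iff_AE[OF iP] by (auto simp: generating_law_def)
  moreover have "0 \<le> (LINT y|P. y\<^sup>2)" by (intro integral_nonneg_AE) auto
  ultimately show ?thesis by linarith
qed

lemma generating_law_second_moment:
  assumes P: "generating_law \<psi> P" and E: "elliptical n \<mu> S \<psi> M X" and i: "i < n" "0 < S i i"
    and sq: "integrable M (\<lambda>\<omega>. (X \<omega> i)\<^sup>2)"
  shows "integrable P (\<lambda>y. y\<^sup>2)"
proof -
  interpret M: prob_space M using E by (rule elliptical_prob_space)
  note [measurable] = elliptical_component[OF E i(1)]
  have i1: "integrable M (\<lambda>\<omega>. X \<omega> i)" by (rule M.square_integrable_imp_integrable) (use sq in auto)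
  have "integrable M (\<lambda>\<omega>. ((X \<omega> i - \<mu> i) / sqrt (S i i))\<^sup>2)"
    using sq i1 by (simp add: power_divide power2_diff)
  then show ?thesis
    by (subst standardised_component_distr[OF P E i, symmetric], subst integrable_distr_eq) auto
qed

text \<open>NCD provides integrable products of different components only. Multiplying the constant
  sum c by X_i gives X_i^2 = c X_i minus the sum of X_i X_l over l \<noteq> i, so the second moment
  exists as well, and then the covariance is a positive multiple of S i j.\<close>

lemma NCD_joint_mix_nonpos:
  assumes P: "generating_law \<psi> P" and E: "elliptical n \<mu> S \<psi> M X" and nd: "nondegenerate n M X"
    and J: "joint_mix n M X" and N: "NCD n M X" and n: "2 \<le> n" and ij: "i < n" "j < n" "i \<noteq> j"
  shows "S i j \<le> 0"
proof -
  interpret M: prob_space M using E by (rule elliptical_prob_space)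
  have mX: "(\<lambda>\<omega>. X \<omega> k) \<in> borel_measurable M" if "k < n" for k using elliptical_component[OF E that] .
  obtain c where c: "AE \<omega> in M. (\<Sum>k<n. X \<omega> k) = c" using J by (auto simp: joint_mix_def)
  have ce: "covariance_exists M (\<lambda>\<omega>. X \<omega> k) (\<lambda>\<omega>. X \<omega> l)" if "k < n" "l < n" "k \<noteq> l" for k l
    using N that by (auto simp: NCD_def)
  have "integrable M (\<lambda>\<omega>. c * X \<omega> i - (\<Sum>l\<in>{..<n} - {i}. X \<omega> i * X \<omega> l))"
    using ce[OF ij] ce[of i] ij
    by (intro Bochner_Integration.integrable_diff Bochner_Integration.integrable_sum integrable_mult_right)
      (auto simp: covariance_exists_def)
  moreover have "AE \<omega> in M. c * X \<omega> i - (\<Sum>l\<in>{..<n} - {i}. X \<omega> i * X \<omega> l) = (X \<omega> i)\<^sup>2"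
    using c
  proof eventually_elim
    case (elim \<omega>)
    have "c = X \<omega> i + (\<Sum>l\<in>{..<n} - {i}. X \<omega> l)"
      using elim ij by (subst (asm) sum.remove[of _ i]) auto
    then show ?case by (simp add: power2_eq_square algebra_simps sum_distrib_left)
  qed
  ultimately have "integrable M (\<lambda>\<omega>. (X \<omega> i)\<^sup>2)"
    using mX ij by (subst integrable_cong_AE[symmetric]) (auto intro!: borel_measurable_diff borel_measurable_sum borel_measurable_times)
  then have iP: "integrable P (\<lambda>y. y\<^sup>2)"
    using generating_law_second_moment[OF P E ij(1)] in_elliptical_class_diag_pos[OF P E nd ij(1)] by simp
  have "S i j * (LINT y|P. y\<^sup>2) \<le> 0"
    using N ij unfolding elliptical_covariance(2)[OF P E ij iP, symmetric] by (auto simp: NCD_def)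
  then show ?thesis
    using generating_law_second_moment_pos[OF P iP] by (simp add: mult_le_0_iff)
qed

theorem NCD_imp_variance_mixture:
  assumes P: "generating_law \<psi> P" and C: "\<forall>n\<ge>2. class_contains_joint_mix \<psi> NCD n"
  shows "gaussian_variance_mixture_family \<psi>"
proof -
  have "\<exists>M X \<mu> S. elliptical n \<mu> S \<psi> (M :: (nat \<Rightarrow> real) measure) X \<and> (\<forall>i<n. 0 < S i i) \<and>
      (\<forall>i<n. \<forall>j<n. i \<noteq> j \<longrightarrow> S i j \<le> 0)" if n: "2 \<le> n" for n
  proof -
    from C n obtain M :: "(nat \<Rightarrow> real) measure" and X where "in_elliptical_class \<psi> n M X" and J: "joint_mix n M X" "NCD n M X"
      by (auto simp: class_contains_joint_mix_def)
    then obtain \<mu> S where E: "elliptical n \<mu> S \<psi> M X" and nd: "nondegenerate n M X"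
      by (auto simp: in_elliptical_class_def)
    show ?thesis
      using E in_elliptical_class_diag_pos[OF P E nd] NCD_joint_mix_nonpos[OF P E nd J n] by blast
  qed
  then obtain M X \<mu> S where
    E: "\<And>n. 2 \<le> n \<Longrightarrow> elliptical n (\<mu> n) (S n) \<psi> (M n :: (nat \<Rightarrow> real) measure) (X n)" and
    pos: "\<And>n i. 2 \<le> n \<Longrightarrow> i < n \<Longrightarrow> 0 < S n i i" and
    neg: "\<And>n i j. 2 \<le> n \<Longrightarrow> i < n \<Longrightarrow> j < n \<Longrightarrow> i \<noteq> j \<Longrightarrow> S n i j \<le> 0"
    by metis
  \<comment> \<open>Members with the required dispersion are available from dimension 2 on, hence
    the shift.\<close>
  define D where "D k = distr (M (k + 2)) borel (\<lambda>\<omega>. mean_square (k + 2) (\<mu> (k + 2)) (S (k + 2)) (X (k + 2) \<omega>))" for k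
  have meas: "(\<lambda>\<omega>. mean_square (k + 2) (\<mu> (k + 2)) (S (k + 2)) (X (k + 2) \<omega>)) \<in> borel_measurable (M (k + 2))" for k
    unfolding mean_square_def using elliptical_component[OF E[of "k + 2"]]
    by (intro borel_measurable_divide borel_measurable_sum borel_measurable_power borel_measurable_diff) auto
  have ms: "0 \<le> mean_square n \<mu> S x" for n \<mu> S x by (simp add: mean_square_def sum_nonneg)
  have lim: "(\<lambda>k. LINT w|D k. exp (- w * u / 2)) \<longlonglongrightarrow> \<psi> u" if u: "0 \<le> u" for u
  proof (rule LIMSEQ_I)
    fix \<epsilon> :: real assume "0 < \<epsilon>"
    from mean_square_laplace_limit[OF P u this, where 'a = "nat \<Rightarrow> real"] obtain N where
      N: "\<forall>n\<ge>N. \<forall>\<mu> S (M :: (nat \<Rightarrow> real) measure) X. elliptical n \<mu> S \<psi> M X \<longrightarrow>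
        (\<forall>i<n. 0 < S i i) \<longrightarrow> (\<forall>i<n. \<forall>j<n. i \<noteq> j \<longrightarrow> S i j \<le> 0) \<longrightarrow>
        \<bar>(LINT \<omega>|M. exp (- u * mean_square n \<mu> S (X \<omega>) / 2)) - \<psi> u\<bar> < \<epsilon>"
      by (elim exE conjE)
    have "\<bar>(LINT w|D k. exp (- w * u / 2)) - \<psi> u\<bar> < \<epsilon>" if "N \<le> k" for k
    proof -
      have "(LINT w|D k. exp (- w * u / 2)) =
        (LINT \<omega>|M (k + 2). exp (- u * mean_square (k + 2) (\<mu> (k + 2)) (S (k + 2)) (X (k + 2) \<omega>) / 2))"
        unfolding D_def using meas by (subst integral_distr) (auto simp: mult.commute)
      then show ?thesis using N[rule_format, of "k + 2", OF _ E pos neg] that by simp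
    qed
    then show "\<exists>no. \<forall>k\<ge>no. norm ((LINT w|D k. exp (- w * u / 2)) - \<psi> u) < \<epsilon>" by auto
  qed
  have Dr: "real_distribution (D k)" for k
    unfolding D_def using prob_space.real_distribution_distr[OF elliptical_prob_space[OF E] meas] by simp
  have Dn: "AE w in D k. 0 \<le> w" for k
    unfolding D_def using meas ms by (subst AE_distr_iff) auto
  show ?thesis
    using laplace_continuity[OF Dr Dn lim generating_law_continuous[OF P] generating_law_zero[OF P]]
      gaussian_variance_mixture_familyI by metis
qed

section \<open>A decoupling inequality\<close>

definition mix :: "nat \<Rightarrow> nat set \<Rightarrow> (nat \<Rightarrow> 'b) \<Rightarrow> (nat \<Rightarrow> 'b) \<Rightarrow> nat \<Rightarrow> 'b" where
  "mix m \<sigma> z z' = (\<lambda>k\<in>{..<m}. if k \<in> \<sigma> then z k else z' k)"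

lemma mix_in_PiE: "mix m \<sigma> z z' \<in> {..<m} \<rightarrow>\<^sub>E UNIV"
  by (simp add: mix_def)

text \<open>Identifies two independent copies with a product of 2 m factors, on which permutations
  of coordinates act through \<open>distr_PiM_reindex\<close>.\<close>

lemma distr_PiM_halves:
  fixes m :: nat
  assumes P: "prob_space P"
  shows "distr (PiM {..<m + m} (\<lambda>_. P)) (PiM {..<m} (\<lambda>_. P) \<Otimes>\<^sub>M PiM {..<m} (\<lambda>_. P))
      (\<lambda>\<omega>. (\<lambda>k\<in>{..<m}. \<omega> k, \<lambda>k\<in>{..<m}. \<omega> (m + k))) =
    PiM {..<m} (\<lambda>_. P) \<Otimes>\<^sub>M PiM {..<m} (\<lambda>_. P)"
proof -
  interpret P: prob_space P by fact
  interpret PP: product_sigma_finite "\<lambda>_ :: nat. P" by standard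
  let ?I = "{..<m}" and ?J = "{m..<m + m}"
  let ?A = "PiM ?I (\<lambda>_. P)" and ?B = "PiM ?J (\<lambda>_. P)" and ?D = "PiM {..<m + m} (\<lambda>_. P)"
  interpret A: prob_space ?A by (intro prob_space_PiM P)
  have IJ: "?I \<union> ?J = {..<m + m}" "?I \<inter> ?J = {}" by auto
  have D: "distr (?A \<Otimes>\<^sub>M ?B) ?D (merge ?I ?J) = ?D"
    using PP.distr_merge[OF IJ(2)] by (simp add: IJ(1))
  have mm: "merge ?I ?J \<in> measurable (?A \<Otimes>\<^sub>M ?B) ?D"
    using measurable_merge[of ?I ?J "\<lambda>_. P"] by (simp add: IJ(1))
  have sh: "distr ?B ?A (\<lambda>\<omega>. \<lambda>k\<in>?I. \<omega> (m + k)) = ?A"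
    by (rule distr_PiM_reindex) (auto simp: P inj_on_def)
  have mshift: "(\<lambda>\<omega>. \<lambda>k\<in>?I. \<omega> (m + k)) \<in> measurable ?B ?A"
    by (intro measurable_restrict measurable_component_singleton) auto
  have mPhi: "(\<lambda>\<omega>. (\<lambda>k\<in>?I. \<omega> k, \<lambda>k\<in>?I. \<omega> (m + k))) \<in> measurable ?D (?A \<Otimes>\<^sub>M ?A)"
    by (intro measurable_Pair measurable_restrict measurable_component_singleton) auto
  have "distr ?D (?A \<Otimes>\<^sub>M ?A) (\<lambda>\<omega>. (\<lambda>k\<in>?I. \<omega> k, \<lambda>k\<in>?I. \<omega> (m + k))) =
    distr (distr (?A \<Otimes>\<^sub>M ?B) ?D (merge ?I ?J)) (?A \<Otimes>\<^sub>M ?A) (\<lambda>\<omega>. (\<lambda>k\<in>?I. \<omega> k, \<lambda>k\<in>?I. \<omega> (m + k)))"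
    by (simp only: D)
  also have "\<dots> = distr (?A \<Otimes>\<^sub>M ?B) (?A \<Otimes>\<^sub>M ?A) (\<lambda>(x, y). (x, \<lambda>k\<in>?I. y (m + k)))"
    by (subst distr_distr[OF mPhi mm], rule distr_cong)
      (auto simp: merge_def space_pair_measure space_PiM PiE_def extensional_def fun_eq_iff restrict_def)
  also have "\<dots> = distr ?A ?A (\<lambda>x. x) \<Otimes>\<^sub>M distr ?B ?A (\<lambda>\<omega>. \<lambda>k\<in>?I. \<omega> (m + k))"
    by (rule pair_measure_distr[symmetric]) (auto simp: sh mshift A.sigma_finite_measure_axioms)
  also have "\<dots> = ?A \<Otimes>\<^sub>M ?A" by (simp add: sh distr_id2)
  finally show ?thesis .
qed

lemma mix_measurable [measurable]:
  "(\<lambda>(z, z'). (mix m \<sigma> z z', mix m \<tau> z z')) \<in>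
    measurable (PiM {..<m} (\<lambda>_. P) \<Otimes>\<^sub>M PiM {..<m} (\<lambda>_. P)) (PiM {..<m} (\<lambda>_. P) \<Otimes>\<^sub>M PiM {..<m} (\<lambda>_. P))"
proof -
  have "(\<lambda>p. mix m \<sigma> (fst p) (snd p)) \<in>
    measurable (PiM {..<m} (\<lambda>_. P) \<Otimes>\<^sub>M PiM {..<m} (\<lambda>_. P)) (PiM {..<m} (\<lambda>_. P))" for \<sigma>
    unfolding mix_def
    by (intro measurable_restrict) (auto intro: measurable_compose[OF measurable_fst measurable_component_singleton]
      measurable_compose[OF measurable_snd measurable_component_singleton])
  then show ?thesis by (simp add: split_beta')
qed

text \<open>The map exchanges z k and z' k for k outside \<sigma>. On 2 m independent factors of
  equal law this is the permutation \<open>\<pi>\<close>, which preserves the product.\<close>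

lemma distr_mix:
  assumes P: "prob_space P"
  shows "distr (PiM {..<m} (\<lambda>_. P) \<Otimes>\<^sub>M PiM {..<m} (\<lambda>_. P)) (PiM {..<m} (\<lambda>_. P) \<Otimes>\<^sub>M PiM {..<m} (\<lambda>_. P))
      (\<lambda>(z, z'). (mix m \<sigma> z z', mix m (- \<sigma>) z z')) =
    PiM {..<m} (\<lambda>_. P) \<Otimes>\<^sub>M PiM {..<m} (\<lambda>_. P)" (is "distr ?AA ?AA ?T = ?AA")
proof -
  let ?D = "PiM {..<m + m} (\<lambda>_. P)"
  define \<Phi> where "\<Phi> = (\<lambda>\<omega> :: nat \<Rightarrow> 'a. (\<lambda>k\<in>{..<m}. \<omega> k, \<lambda>k\<in>{..<m}. \<omega> (m + k)))"
  define \<pi> where "\<pi> k = (if k < m then if k \<in> \<sigma> then k else m + k else if k - m \<in> \<sigma> then k else k - m)" for k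
  have mPhi: "\<Phi> \<in> measurable ?D ?AA"
    unfolding \<Phi>_def by (intro measurable_Pair measurable_restrict measurable_component_singleton) auto
  have m\<pi>: "(\<lambda>\<omega>. \<lambda>k\<in>{..<m + m}. \<omega> (\<pi> k)) \<in> measurable ?D ?D"
    by (intro measurable_restrict measurable_component_singleton) (auto simp: \<pi>_def)
  have D: "distr ?D ?AA \<Phi> = ?AA" unfolding \<Phi>_def by (rule distr_PiM_halves[OF P])
  have "distr ?D ?D (\<lambda>\<omega>. \<lambda>k\<in>{..<m + m}. \<omega> (\<pi> k)) = ?D"
  proof (rule distr_PiM_reindex)
    show "inj_on \<pi> {..<m + m}" by (auto simp: inj_on_def \<pi>_def split: if_splits)
  qed (auto simp: P \<pi>_def)
  then have "?AA = distr (distr ?D ?D (\<lambda>\<omega>. \<lambda>k\<in>{..<m + m}. \<omega> (\<pi> k))) ?AA \<Phi>"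
    by (simp only: D)
  also have "\<dots> = distr ?D ?AA (?T \<circ> \<Phi>)"
    unfolding distr_distr[OF mPhi m\<pi>]
    by (rule distr_cong) (auto simp: \<Phi>_def \<pi>_def mix_def fun_eq_iff restrict_def)
  also have "\<dots> = distr (distr ?D ?AA \<Phi>) ?AA ?T"
    by (rule distr_distr[symmetric, OF mix_measurable mPhi])
  also have "\<dots> = distr ?AA ?AA ?T" by (simp only: D)
  finally show ?thesis by (rule sym)
qed

text \<open>\<open>G k\<close> interpolates: below k the second argument makes the opposite choice
  to the first, from k on the same choice. Passing to k + 1 alters coordinate k only; pairing
  \<sigma> with \<sigma> toggled at k lets both entries a and b occur there, and each pair is an
  instance of the exchange hypothesis.\<close>

lemma mix_exchange_sum:
  fixes F :: "(nat \<Rightarrow> 'b) \<Rightarrow> (nat \<Rightarrow> 'b) \<Rightarrow> real"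
  assumes swap: "\<And>k z w a b. k < m \<Longrightarrow> z \<in> {..<m} \<rightarrow>\<^sub>E UNIV \<Longrightarrow> w \<in> {..<m} \<rightarrow>\<^sub>E UNIV \<Longrightarrow>
    F (z(k := a)) (w(k := a)) + F (z(k := b)) (w(k := b)) \<le> F (z(k := a)) (w(k := b)) + F (z(k := b)) (w(k := a))"
  shows "(\<Sum>\<sigma>\<in>Pow {..<m}. F (mix m \<sigma> z z') (mix m \<sigma> z z')) \<le> (\<Sum>\<sigma>\<in>Pow {..<m}. F (mix m \<sigma> z z') (mix m (- \<sigma>) z z'))"
proof -
  define flip where "flip \<sigma> k = {j. (j \<in> \<sigma>) \<noteq> (j < k)}" for \<sigma> and k :: nat
  define tog where "tog k \<sigma> = (if k \<in> \<sigma> then \<sigma> - {k} else insert k \<sigma>)" for k :: nat and \<sigma>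
  define G where "G k = (\<Sum>\<sigma>\<in>Pow {..<m}. F (mix m \<sigma> z z') (mix m (flip \<sigma> k) z z'))" for k
  have step: "G k \<le> G (Suc k)" if k: "k < m" for k
  proof -
    have tog: "(\<Sum>\<sigma>\<in>Pow {..<m}. f (tog k \<sigma>)) = (\<Sum>\<sigma>\<in>Pow {..<m}. f \<sigma>)" for f :: "nat set \<Rightarrow> real"
      by (rule sum.reindex_bij_witness[of _ "tog k" "tog k"]) (use k in \<open>auto simp: tog_def split: if_splits\<close>)
    have "F (mix m \<sigma> z z') (mix m (flip \<sigma> k) z z') + F (mix m (tog k \<sigma>) z z') (mix m (flip (tog k \<sigma>) k) z z')
      \<le> F (mix m \<sigma> z z') (mix m (flip \<sigma> (Suc k)) z z') + F (mix m (tog k \<sigma>) z z') (mix m (flip (tog k \<sigma>) (Suc k)) z z')"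
      (is "?L \<le> ?R") for \<sigma>
    proof -
      let ?x = "mix m \<sigma> z z'" and ?y = "mix m (flip \<sigma> k) z z'"
      define a where "a = ?x k"
      define b where "b = (if k \<in> \<sigma> then z' k else z k)"
      have e: "?x = ?x(k := a)" "?y = ?y(k := a)" "mix m (tog k \<sigma>) z z' = ?x(k := b)"
        "mix m (flip (tog k \<sigma>) k) z z' = ?y(k := b)" "mix m (flip \<sigma> (Suc k)) z z' = ?y(k := b)"
        "mix m (flip (tog k \<sigma>) (Suc k)) z z' = ?y(k := a)"
        using k by (auto simp: mix_def flip_def tog_def a_def b_def fun_eq_iff less_Suc_eq)
      show ?thesis
        using swap[OF k mix_in_PiE mix_in_PiE, of \<sigma> z z' a "flip \<sigma> k" z z' b] unfolding e(3-6)
        using e(1,2) by simp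
    qed
    then have "(\<Sum>\<sigma>\<in>Pow {..<m}. F (mix m \<sigma> z z') (mix m (flip \<sigma> k) z z') + F (mix m (tog k \<sigma>) z z') (mix m (flip (tog k \<sigma>) k) z z'))
      \<le> (\<Sum>\<sigma>\<in>Pow {..<m}. F (mix m \<sigma> z z') (mix m (flip \<sigma> (Suc k)) z z') + F (mix m (tog k \<sigma>) z z') (mix m (flip (tog k \<sigma>) (Suc k)) z z'))"
      by (rule sum_mono)
    then show ?thesis
      unfolding sum.distrib
        tog[of "\<lambda>\<sigma>. F (mix m \<sigma> z z') (mix m (flip \<sigma> k) z z')"]
        tog[of "\<lambda>\<sigma>. F (mix m \<sigma> z z') (mix m (flip \<sigma> (Suc k)) z z')"]
      by (simp add: G_def)
  qed
  have "G 0 \<le> G k" if "k \<le> m" for k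
    using that by (induction k) (auto intro: order_trans[OF _ step])
  then have "G 0 \<le> G m" by simp
  moreover have "G 0 = (\<Sum>\<sigma>\<in>Pow {..<m}. F (mix m \<sigma> z z') (mix m \<sigma> z z'))"
    by (simp add: G_def flip_def)
  moreover have "mix m (flip \<sigma> m) z z' = mix m (- \<sigma>) z z'" for \<sigma>
    by (auto simp: mix_def flip_def fun_eq_iff)
  then have "G m = (\<Sum>\<sigma>\<in>Pow {..<m}. F (mix m \<sigma> z z') (mix m (- \<sigma>) z z'))"
    by (simp add: G_def)
  ultimately show ?thesis by simp
qed

text \<open>
  Decoupling: only \<open>F(z, z)\<close> and \<open>F(z, w)\<close> have to be integrable. Exchanging the coordinates one at a
  time at the level of integrals would pass through functions that need not be.
\<close>

theorem decoupling_inequality: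
  fixes F :: "(nat \<Rightarrow> real) \<Rightarrow> (nat \<Rightarrow> real) \<Rightarrow> real" and P :: "real measure"
  assumes P: "prob_space P"
    and swap: "\<And>k z w a b. k < m \<Longrightarrow> z \<in> {..<m} \<rightarrow>\<^sub>E UNIV \<Longrightarrow> w \<in> {..<m} \<rightarrow>\<^sub>E UNIV \<Longrightarrow>
      F (z(k := a)) (w(k := a)) + F (z(k := b)) (w(k := b)) \<le> F (z(k := a)) (w(k := b)) + F (z(k := b)) (w(k := a))"
    and diag: "integrable (PiM {..<m} (\<lambda>_. P)) (\<lambda>z. F z z)"
    and prod: "integrable (PiM {..<m} (\<lambda>_. P) \<Otimes>\<^sub>M PiM {..<m} (\<lambda>_. P)) (\<lambda>p. F (fst p) (snd p))"
  shows "(LINT z|PiM {..<m} (\<lambda>_. P). F z z) \<le> (LINT p|(PiM {..<m} (\<lambda>_. P) \<Otimes>\<^sub>M PiM {..<m} (\<lambda>_. P)). F (fst p) (snd p))"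
proof -
  let ?A = "PiM {..<m} (\<lambda>_. P)"
  let ?AA = "?A \<Otimes>\<^sub>M ?A"
  interpret A: prob_space ?A by (intro prob_space_PiM P)
  define T :: "nat set \<Rightarrow> (nat \<Rightarrow> real) \<times> (nat \<Rightarrow> real) \<Rightarrow> (nat \<Rightarrow> real) \<times> (nat \<Rightarrow> real)"
    where "T \<sigma> = (\<lambda>(z, z'). (mix m \<sigma> z z', mix m (- \<sigma>) z z'))" for \<sigma>
  have mT: "T \<sigma> \<in> measurable ?AA ?AA" for \<sigma> unfolding T_def by measurable
  have dT: "distr ?AA ?AA (T \<sigma>) = ?AA" for \<sigma> unfolding T_def by (rule distr_mix[OF P])
  have dfst: "distr ?AA ?A fst = ?A" by (rule distr_fst_pair) (auto intro: A.prob_space_axioms)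
  have mfst: "fst \<in> measurable ?AA ?A" by simp
  have diag': "integrable ?AA (\<lambda>p. F (fst p) (fst p))" "(LINT p|?AA. F (fst p) (fst p)) = (LINT z|?A. F z z)"
    using integrable_distr_eq[OF mfst, of "\<lambda>z. F z z"] integral_distr[OF mfst, of "\<lambda>z. F z z"] diag
    by (simp_all add: dfst borel_measurable_integrable)
  have iT: "integrable ?AA (\<lambda>p. f (T \<sigma> p))" "(LINT p|?AA. f (T \<sigma> p)) = (LINT p|?AA. f p)"
    if "integrable ?AA f" for f :: "(nat \<Rightarrow> real) \<times> (nat \<Rightarrow> real) \<Rightarrow> real" and \<sigma>
    using integrable_distr_eq[OF mT, of f] integral_distr[OF mT, of f] that
    by (simp_all add: dT borel_measurable_integrable)
  let ?L = "\<lambda>\<sigma> p. F (mix m \<sigma> (fst p) (snd p)) (mix m \<sigma> (fst p) (snd p))"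
  let ?R = "\<lambda>\<sigma> p. F (mix m \<sigma> (fst p) (snd p)) (mix m (- \<sigma>) (fst p) (snd p))"
  have L: "integrable ?AA (?L \<sigma>)" "(LINT p|?AA. ?L \<sigma> p) = (LINT z|?A. F z z)" for \<sigma>
    using iT[OF diag'(1), of \<sigma>] by (simp_all add: T_def split_beta diag'(2))
  have R: "integrable ?AA (?R \<sigma>)" "(LINT p|?AA. ?R \<sigma> p) = (LINT p|?AA. F (fst p) (snd p))" for \<sigma>
    using iT[OF prod, of \<sigma>] by (simp_all add: T_def split_beta)
  \<comment> \<open>By \<open>L\<close> and \<open>R\<close> all 2^m summands on one side have the
    same integral, so the pointwise inequality between the sums gives the claim after division by
    2^m.\<close>
  have "(\<Sum>\<sigma>\<in>Pow {..<m}. LINT p|?AA. ?L \<sigma> p) = (LINT p|?AA. (\<Sum>\<sigma>\<in>Pow {..<m}. ?L \<sigma> p))"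
    by (rule Bochner_Integration.integral_sum[symmetric]) (rule L)
  also have "\<dots> \<le> (LINT p|?AA. (\<Sum>\<sigma>\<in>Pow {..<m}. ?R \<sigma> p))"
    by (intro integral_mono Bochner_Integration.integrable_sum L R mix_exchange_sum swap)
  also have "\<dots> = (\<Sum>\<sigma>\<in>Pow {..<m}. LINT p|?AA. ?R \<sigma> p)"
    by (rule Bochner_Integration.integral_sum) (rule R)
  finally show ?thesis unfolding L(2) R(2) by (simp add: card_Pow)
qed

section \<open>Joint mixes with one dependent component\<close>

text \<open>The free components and the balancing one get separate arguments: for independent
  \<open>z\<close> and \<open>w\<close> with iid coordinates the result has the law of the
  independent version of \<open>star m z\<close>, see \<open>indep_law_star\<close>.\<close>

definition star2 :: "nat \<Rightarrow> (nat \<Rightarrow> real) \<Rightarrow> (nat \<Rightarrow> real) \<Rightarrow> nat \<Rightarrow> real" where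
  "star2 m z w = (\<lambda>i\<in>{..<Suc m}. if i < m then z i else - (\<Sum>k<m. w k))"

abbreviation star :: "nat \<Rightarrow> (nat \<Rightarrow> real) \<Rightarrow> nat \<Rightarrow> real" where
  "star m z \<equiv> star2 m z z"

text \<open>The covariance matrix of \<open>star m z\<close> when the z k are uncorrelated with
  variance 1.\<close>

definition star_dispersion :: "nat \<Rightarrow> nat \<Rightarrow> nat \<Rightarrow> real" where
  "star_dispersion m i j = (if i = m then if j = m then real m else -1 else if j = m then -1 else if i = j then 1 else 0)"

lemma star_quad_form: "quad_form (Suc m) (star_dispersion m) t = (\<Sum>k<m. (t k - t m)\<^sup>2)"
proof -
  have "quad_form m (star_dispersion m) t = (\<Sum>i<m. \<Sum>j<m. if i = j then t i * t j else 0)"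
    unfolding quad_form_def by (intro sum.cong refl) (auto simp: star_dispersion_def)
  also have "\<dots> = (\<Sum>i<m. (t i)\<^sup>2)" by (simp add: power2_eq_square)
  finally have "quad_form m (star_dispersion m) t = (\<Sum>i<m. (t i)\<^sup>2)" .
  moreover have "(\<Sum>i<m. t i * star_dispersion m i m) = - (\<Sum>i<m. t i)"
    by (simp add: star_dispersion_def sum_negf)
  ultimately show ?thesis
    by (subst quad_form_Suc) (simp_all add: star_dispersion_def power2_diff sum.distrib sum_subtractf
        sum_distrib_left sum_distrib_right mult_ac)
qed

lemma sum_star: "(\<Sum>i<Suc m. t i * star m z i) = (\<Sum>k<m. (t k - t m) * z k)"
proof -
  have "(\<Sum>i<m. t i * star m z i) = (\<Sum>i<m. t i * z i)" by (simp add: star2_def)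
  moreover have "star m z m = - (\<Sum>k<m. z k)" by (simp add: star2_def)
  ultimately show ?thesis by (simp add: left_diff_distrib sum_subtractf sum_distrib_left)
qed

lemma star2_component_measurable [measurable]:
  "(\<lambda>p. star2 m (fst p) (snd p) i) \<in> borel_measurable (borel_vec m \<Otimes>\<^sub>M borel_vec m)"
proof (cases "i < m")
  case True
  then show ?thesis
    by (simp add: star2_def measurable_compose[OF measurable_fst measurable_component_singleton])
next
  case False
  have "(\<lambda>p. - (\<Sum>k<m. snd p k)) \<in> borel_measurable (borel_vec m \<Otimes>\<^sub>M borel_vec m)"
    by (intro borel_measurable_uminus borel_measurable_sum)
      (auto intro: measurable_compose[OF measurable_snd measurable_component_singleton])
  then show ?thesis using False by (cases "i = m") (simp_all add: star2_def)
qed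

lemma star2_measurable:
  "(\<lambda>p. star2 m (fst p) (snd p)) \<in> measurable (borel_vec m \<Otimes>\<^sub>M borel_vec m) (borel_vec (Suc m))"
proof -
  have "(\<lambda>p. \<lambda>i\<in>{..<Suc m}. star2 m (fst p) (snd p) i) \<in> measurable (borel_vec m \<Otimes>\<^sub>M borel_vec m) (borel_vec (Suc m))"
    by (intro measurable_restrict) simp
  moreover have "(\<lambda>i\<in>{..<Suc m}. star2 m z w i) = star2 m z w" for z w by (auto simp: star2_def fun_eq_iff)
  ultimately show ?thesis by simp
qed

lemma star_measurable:
  assumes "sets M = sets (borel_vec m)"
  shows "star m \<in> measurable M (borel_vec (Suc m))"
proof -
  have [measurable_cong]: "sets M = sets (borel_vec m)" by fact
  have "(\<lambda>z. (z, z)) \<in> measurable M (borel_vec m \<Otimes>\<^sub>M borel_vec m)" by measurable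
  from measurable_compose[OF this star2_measurable] show ?thesis by simp
qed

lemma star_joint_mix:
  assumes "prob_space M" "sets M = sets (borel_vec m)"
  shows "joint_mix (Suc m) M (star m)"
  using assms star_measurable[OF assms(2)] sum_star[of "\<lambda>_. 1" m]
  by (auto simp: joint_mix_def random_vector_def)

lemma star_in_elliptical_class:
  assumes P: "generating_law \<psi> P" and m: "1 \<le> m" and M: "prob_space M" "sets M = sets (borel_vec m)"
    and ch: "\<And>a. (CLINT z|M. iexp (\<Sum>k<m. a k * z k)) = of_real (\<psi> (\<Sum>k<m. (a k)\<^sup>2))"
  shows "elliptical (Suc m) (\<lambda>_. 0) (star_dispersion m) \<psi> M (star m)"
    and "in_elliptical_class \<psi> (Suc m) M (star m)"
proof -
  show E: "elliptical (Suc m) (\<lambda>_. 0) (star_dispersion m) \<psi> M (star m)"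
    unfolding elliptical_def random_vector_def psd_symmetric_def sum_star star_quad_form ch
    using M star_measurable[OF M(2)] by (auto simp: star_dispersion_def sum_nonneg)
  show "in_elliptical_class \<psi> (Suc m) M (star m)"
    unfolding in_elliptical_class_def
    using E nondegenerateI[OF P E] m by (auto simp: star_dispersion_def)
qed

text \<open>Multiplicativity turns the product of the marginal values \<psi> ((a k)^2) into a
  function of the Euclidean norm of a, so the independent coordinates form a spherical vector.
  Exponential generators have this property.\<close>

lemma iid_PiM_char:
  fixes m :: nat
  assumes P: "generating_law \<psi> P" and mult: "\<And>u v. 0 \<le> u \<Longrightarrow> 0 \<le> v \<Longrightarrow> \<psi> (u + v) = \<psi> u * \<psi> v"
  shows "(CLINT z|PiM {..<m} (\<lambda>_. P). iexp (\<Sum>k<m. a k * z k)) = of_real (\<psi> (\<Sum>k<m. (a k)\<^sup>2))"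
proof -
  interpret P: real_distribution P using P by (simp add: generating_law_def)
  interpret PP: product_sigma_finite "\<lambda>_ :: nat. P" by standard
  have "(CLINT z|PiM {..<m} (\<lambda>_. P). iexp (\<Sum>k<m. a k * z k)) = (CLINT z|PiM {..<m} (\<lambda>_. P). (\<Prod>k<m. iexp (a k * z k)))"
    by (simp add: exp_sum sum_distrib_left)
  also have "\<dots> = (\<Prod>k<m. CLINT x|P. iexp (a k * x))"
    by (rule PP.product_integral_prod) (auto intro!: P.integrable_iexp simp del: of_real_mult)
  also have "\<dots> = (\<Prod>k<m. of_real (\<psi> ((a k)\<^sup>2)))"
    using P by (simp add: generating_law_def char_def)
  also have "\<dots> = of_real (\<Prod>k<m. \<psi> ((a k)\<^sup>2))" by simp
  also have "(\<Prod>k<m. \<psi> ((a k)\<^sup>2)) = \<psi> (\<Sum>k<m. (a k)\<^sup>2)"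
    by (induction m) (simp_all add: generating_law_zero[OF P] mult sum_nonneg)
  finally show ?thesis .
qed

lemma sets_PiM_real_distribution:
  "real_distribution P \<Longrightarrow> sets (PiM {..<m} (\<lambda>_. P)) = sets (borel_vec m)" for m :: nat
  by (intro sets_PiM_cong refl) (simp add: real_distribution_def real_distribution_axioms_def)

text \<open>The first m components read \<open>z\<close> only and the last one reads
  \<open>w\<close> only, so preimages of boxes are products, and the two factors carry the right
  marginals.\<close>

lemma indep_law_star:
  assumes P: "real_distribution P"
  shows "indep_law (Suc m) (PiM {..<m} (\<lambda>_. P)) (star m) =
    distr (PiM {..<m} (\<lambda>_. P) \<Otimes>\<^sub>M PiM {..<m} (\<lambda>_. P)) (borel_vec (Suc m)) (\<lambda>p. star2 m (fst p) (snd p))"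
proof -
  interpret P: real_distribution P by fact
  interpret PP: product_sigma_finite "\<lambda>_ :: nat. P" by standard
  let ?A = "PiM {..<m} (\<lambda>_. P)"
  interpret A: prob_space ?A by (intro prob_space_PiM P.prob_space_axioms)
  have sA [measurable_cong]: "sets ?A = sets (borel_vec m)" by (rule sets_PiM_real_distribution[OF P])
  have mi [measurable]: "(\<lambda>z. star m z i) \<in> borel_measurable ?A" for i
    using measurable_compose[of "\<lambda>z. (z, z)" ?A "borel_vec m \<Otimes>\<^sub>M borel_vec m", OF _ star2_component_measurable[of m i]] by simp
  have pi: "prob_space (distr ?A borel (\<lambda>z. star m z i))" for i
    by (rule A.prob_space_distr) simp
  interpret D: product_sigma_finite "\<lambda>i. distr ?A borel (\<lambda>z. star m z i)"
    using pi by (intro product_sigma_finite.intro prob_space_imp_sigma_finite)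
  have m2: "(\<lambda>p. star2 m (fst p) (snd p)) \<in> measurable (?A \<Otimes>\<^sub>M ?A) (borel_vec (Suc m))"
    using star2_measurable by (simp cong: measurable_cong_sets sets_pair_measure_cong add: sA)
  show ?thesis
    unfolding indep_law_def
  proof (rule D.PiM_eqI[symmetric])
    show "finite {..<Suc m}" by simp
    show "sets (distr (?A \<Otimes>\<^sub>M ?A) (borel_vec (Suc m)) (\<lambda>p. star2 m (fst p) (snd p))) =
      sets (PiM {..<Suc m} (\<lambda>i. distr ?A borel (\<lambda>z. star m z i)))"
      by (simp cong: sets_PiM_cong)
    fix B assume "\<And>i. i \<in> {..<Suc m} \<Longrightarrow> B i \<in> sets (distr ?A borel (\<lambda>z. star m z i))"
    then have B: "B i \<in> sets borel" if "i < Suc m" for i using that by simp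
    let ?last = "(\<lambda>z. - (\<Sum>k<m. z k)) -` B m \<inter> space ?A"
    have last: "(\<lambda>z. star m z m) = (\<lambda>z. - (\<Sum>k<m. z k))" by (simp add: star2_def)
    have ml: "(\<lambda>z. - (\<Sum>k<m. z k)) \<in> borel_measurable ?A" using mi[of m] unfolding last .
    have sl: "?last \<in> sets ?A" by (rule measurable_sets[OF ml]) (use B in simp)
    have s1: "PiE {..<m} B \<in> sets ?A" by (rule sets_PiM_I_finite) (use B in auto)
    have "(\<lambda>p. star2 m (fst p) (snd p)) -` PiE {..<Suc m} B \<inter> space (?A \<Otimes>\<^sub>M ?A) = PiE {..<m} B \<times> ?last"
      by (auto simp: space_pair_measure space_PiM star2_def PiE_iff extensional_def less_Suc_eq split: if_splits)
    then have "emeasure (distr (?A \<Otimes>\<^sub>M ?A) (borel_vec (Suc m)) (\<lambda>p. star2 m (fst p) (snd p))) (PiE {..<Suc m} B) =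
      emeasure ?A (PiE {..<m} B) * emeasure ?A ?last"
      using B by (subst emeasure_distr[OF m2]) (auto simp: A.emeasure_pair_measure_Times s1 sl)
    also have "emeasure ?A (PiE {..<m} B) = (\<Prod>i<m. emeasure P (B i))"
      by (rule PP.emeasure_PiM) (use B in auto)
    also have "\<dots> = (\<Prod>i<m. emeasure (distr ?A borel (\<lambda>z. star m z i)) (B i))"
    proof (intro prod.cong refl)
      fix i assume i: "i \<in> {..<m}"
      have "distr ?A borel (\<lambda>z. star m z i) = distr ?A P (\<lambda>z. z i)"
        using i by (intro distr_cong) (auto simp: star2_def)
      also have "\<dots> = P" by (rule distr_PiM_component) (use i P.prob_space_axioms in auto)
      finally show "emeasure P (B i) = emeasure (distr ?A borel (\<lambda>z. star m z i)) (B i)" by simp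
    qed
    also have "emeasure ?A ?last = emeasure (distr ?A borel (\<lambda>z. star m z m)) (B m)"
      using B ml by (simp add: last emeasure_distr)
    finally show "emeasure (distr (?A \<Otimes>\<^sub>M ?A) (borel_vec (Suc m)) (\<lambda>p. star2 m (fst p) (snd p))) (PiE {..<Suc m} B) =
      (\<Prod>i\<in>{..<Suc m}. emeasure (distr ?A borel (\<lambda>z. star m z i)) (B i))" by simp
  qed
qed

lemma star2_in_PiE: "star2 m z w \<in> {..<Suc m} \<rightarrow>\<^sub>E UNIV"
  by (simp add: star2_def)

lemma sum_fun_upd:
  fixes w :: "nat \<Rightarrow> real"
  assumes "k < m"
  shows "(\<Sum>j<m. (w(k := a)) j) = a + (\<Sum>j\<in>{..<m} - {k}. w j)"
  using assms by (subst sum.remove[of _ k]) auto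

text \<open>Raising coordinate k of \<open>z\<close> raises component k; raising it in
  \<open>w\<close> lowers the last component. For a \<le> b the points with entries (a, a) and (b,
  b) therefore have those with entries (a, b) and (b, a) as componentwise minimum and maximum, and
  the exchange hypothesis of \<open>decoupling_inequality\<close> is supermodularity.\<close>

theorem star_NSD:
  assumes P: "real_distribution P"
  shows "NSD (Suc m) (PiM {..<m} (\<lambda>_. P)) (star m)"
  unfolding NSD_def
proof (intro allI impI)
  interpret P: real_distribution P by fact
  let ?A = "PiM {..<m} (\<lambda>_. P)"
  have sA [measurable_cong]: "sets ?A = sets (borel_vec m)" by (rule sets_PiM_real_distribution[OF P])
  have m2: "(\<lambda>p. star2 m (fst p) (snd p)) \<in> measurable (?A \<Otimes>\<^sub>M ?A) (borel_vec (Suc m))"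
    using star2_measurable by (simp cong: measurable_cong_sets sets_pair_measure_cong add: sA)
  fix \<phi> assume sm: "supermodular (Suc m) \<phi>" and i1: "integrable ?A (\<lambda>z. \<phi> (star m z))"
    and i2: "integrable (indep_law (Suc m) ?A (star m)) \<phi>"
  have m\<phi>: "\<phi> \<in> borel_measurable (borel_vec (Suc m))"
    using borel_measurable_integrable[OF i2] unfolding indep_law_star[OF P] by simp
  have ord: "\<phi> (star2 m (z(k := a)) (w(k := a))) + \<phi> (star2 m (z(k := b)) (w(k := b)))
    \<le> \<phi> (star2 m (z(k := a)) (w(k := b))) + \<phi> (star2 m (z(k := b)) (w(k := a)))"
    if k: "k < m" and ab: "a \<le> b" for k z w and a b :: real
  proof -
    let ?x = "star2 m (z(k := a)) (w(k := a))" and ?y = "star2 m (z(k := b)) (w(k := b))"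
    have "inf ?x ?y = star2 m (z(k := a)) (w(k := b))" "sup ?x ?y = star2 m (z(k := b)) (w(k := a))"
      unfolding star2_def sum_fun_upd[OF k] using ab
      by (auto simp: fun_eq_iff inf_min sup_max min_def max_def)
    then show ?thesis
      using sm star2_in_PiE[of m "z(k := a)" "w(k := a)"] star2_in_PiE[of m "z(k := b)" "w(k := b)"]
      unfolding supermodular_def by metis
  qed
  have "(LINT z|?A. \<phi> (star2 m z z)) \<le> (LINT p|(?A \<Otimes>\<^sub>M ?A). \<phi> (star2 m (fst p) (snd p)))"
  proof (rule decoupling_inequality[OF P.prob_space_axioms])
    show "\<phi> (star2 m (z(k := a)) (w(k := a))) + \<phi> (star2 m (z(k := b)) (w(k := b)))
    \<le> \<phi> (star2 m (z(k := a)) (w(k := b))) + \<phi> (star2 m (z(k := b)) (w(k := a)))"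
      if k: "k < m" for k z w and a b :: real
      using ord[OF k, of a b z w] ord[OF k, of b a z w] by (cases "a \<le> b") auto
    show "integrable ?A (\<lambda>z. \<phi> (star2 m z z))" by (rule i1)
    show "integrable (?A \<Otimes>\<^sub>M ?A) (\<lambda>p. \<phi> (star2 m (fst p) (snd p)))"
      using i2 unfolding indep_law_star[OF P] integrable_distr_eq[OF m2 m\<phi>] .
  qed
  also have "\<dots> = (LINT x|indep_law (Suc m) ?A (star m). \<phi> x)"
    unfolding indep_law_star[OF P] by (rule integral_distr[symmetric, OF m2 m\<phi>])
  finally show "(LINT z|?A. \<phi> (star m z)) \<le> (LINT x|indep_law (Suc m) ?A (star m). \<phi> x)" .
qed

text \<open>Raising z k raises component k, lowers component m and fixes the others, so the
  direction in which f moves depends on which of the two A contains.\<close>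

lemma coordwise_increasing_star:
  assumes f: "coordwise_increasing A f" and A: "A \<subseteq> {..<Suc m}" and k: "k < m" and ab: "a \<le> b"
  shows "m \<notin> A \<Longrightarrow> f (restrict (star m (z(k := a))) A) \<le> f (restrict (star m (z(k := b))) A)"
    and "k \<notin> A \<Longrightarrow> f (restrict (star m (z(k := b))) A) \<le> f (restrict (star m (z(k := a))) A)"
proof -
  have le: "f x \<le> f y" if "\<And>i. i \<in> A \<Longrightarrow> x i \<le> y i" "x \<in> A \<rightarrow>\<^sub>E UNIV" "y \<in> A \<rightarrow>\<^sub>E UNIV" for x y
    using f that by (auto simp: coordwise_increasing_def)
  have r: "restrict x A \<in> A \<rightarrow>\<^sub>E UNIV" for x :: "nat \<Rightarrow> real" by simp
  show "f (restrict (star m (z(k := a))) A) \<le> f (restrict (star m (z(k := b))) A)" if "m \<notin> A"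
    by (rule le[OF _ r r]) (use that A ab in \<open>auto simp: star2_def less_Suc_eq\<close>)
  show "f (restrict (star m (z(k := b))) A) \<le> f (restrict (star m (z(k := a))) A)" if "k \<notin> A"
    by (rule le[OF _ r r]) (use that A ab k in \<open>auto simp: star2_def less_Suc_eq intro!: sum_mono\<close>)
qed

text \<open>For U z * V w the exchange hypothesis says that U and V never move in the same direction
  under a change of coordinate k. As A and B are disjoint, either they move weakly in opposite
  directions, or one of A and B contains neither k nor m and its function is constant in that
  coordinate.\<close>

theorem star_NA:
  assumes P: "real_distribution P"
  shows "NA (Suc m) (PiM {..<m} (\<lambda>_. P)) (star m)"
  unfolding NA_def
proof (intro allI impI)
  interpret P: real_distribution P by fact
  let ?A = "PiM {..<m} (\<lambda>_. P)"
  interpret A: prob_space ?A by (intro prob_space_PiM P.prob_space_axioms)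
  interpret AA: pair_prob_space ?A ?A ..
  fix A B f g
  assume A: "A \<subseteq> {..<Suc m}" and B: "B \<subseteq> {..<Suc m}" and AB: "A \<inter> B = {}"
    and f: "coordwise_increasing A f" and g: "coordwise_increasing B g"
    and f2: "finite_second_moment ?A (\<lambda>z. f (restrict (star m z) A))"
    and g2: "finite_second_moment ?A (\<lambda>z. g (restrict (star m z) B))"
  define U where "U z = f (restrict (star m z) A)" for z
  define V where "V z = g (restrict (star m z) B)" for z
  have [measurable]: "U \<in> borel_measurable ?A" "V \<in> borel_measurable ?A"
    and U2: "integrable ?A (\<lambda>z. (U z)\<^sup>2)" and V2: "integrable ?A (\<lambda>z. (V z)\<^sup>2)"
    using f2 g2 unfolding finite_second_moment_def U_def[symmetric] V_def[symmetric] by auto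
  have iU: "integrable ?A U" by (rule A.square_integrable_imp_integrable) (use U2 in auto)
  have iV: "integrable ?A V" by (rule A.square_integrable_imp_integrable) (use V2 in auto)
  have iUV: "integrable ?A (\<lambda>z. U z * V z)"
  proof (rule Bochner_Integration.integrable_bound)
    show "integrable ?A (\<lambda>z. (U z)\<^sup>2 + (V z)\<^sup>2)" using U2 V2 by simp
    have "\<bar>u * v\<bar> \<le> u\<^sup>2 + v\<^sup>2" for u v :: real
    proof -
      have "2 * \<bar>u\<bar> * \<bar>v\<bar> \<le> u\<^sup>2 + v\<^sup>2"
        using sum_squares_bound[of "\<bar>u\<bar>" "\<bar>v\<bar>"] by simp
      moreover have "0 \<le> \<bar>u\<bar> * \<bar>v\<bar>" by simp
      ultimately show ?thesis unfolding abs_mult by linarith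
    qed
    then show "AE z in ?A. norm (U z * V z) \<le> norm ((U z)\<^sup>2 + (V z)\<^sup>2)"
      by (auto intro: order_trans[OF _ abs_ge_self])
  qed measurable
  have iP: "integrable (?A \<Otimes>\<^sub>M ?A) (\<lambda>p. U (fst p) * V (snd p))"
  proof (rule AA.Fubini_integrable)
    show "integrable ?A (\<lambda>x. LINT y|?A. norm (U (fst (x, y)) * V (snd (x, y))))"
      using iU by (simp add: abs_mult)
    show "AE x in ?A. integrable ?A (\<lambda>y. U (fst (x, y)) * V (snd (x, y)))"
      using iV by simp
  qed measurable
  have anti: "(U (z(k := a)) - U (z(k := b))) * (V (w(k := a)) - V (w(k := b))) \<le> 0"
    if k: "k < m" and ab: "a \<le> b" for k z w a b
  proof -
    note Um = coordwise_increasing_star[OF f A k ab, of z, folded U_def]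
    note Vm = coordwise_increasing_star[OF g B k ab, of w, folded V_def]
    show ?thesis
      using Um Vm AB by (cases "m \<in> A"; cases "k \<in> A"; cases "m \<in> B"; cases "k \<in> B")
        (auto simp: mult_le_0_iff)
  qed
  have "(LINT z|?A. U z * V z) \<le> (LINT p|(?A \<Otimes>\<^sub>M ?A). U (fst p) * V (snd p))"
  proof (rule decoupling_inequality[OF P.prob_space_axioms _ iUV iP])
    fix k z w and a b :: real
    assume k: "k < m"
    show "U (z(k := a)) * V (w(k := a)) + U (z(k := b)) * V (w(k := b))
      \<le> U (z(k := a)) * V (w(k := b)) + U (z(k := b)) * V (w(k := a))"
      using anti[OF k, of a b z w] anti[OF k, of b a z w]
      by (cases "a \<le> b") (auto simp: algebra_simps)
  qed
  also have "\<dots> = (LINT x|?A. LINT y|?A. U x * V y)"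
    using AA.integral_fst'[OF iP] by simp
  also have "\<dots> = (LINT z|?A. U z) * (LINT z|?A. V z)" by simp
  finally have le: "(LINT z|?A. U z * V z) \<le> (LINT z|?A. U z) * (LINT z|?A. V z)" .
  define u v where "u = (LINT z|?A. U z)" and "v = (LINT z|?A. V z)"
  have "(LINT z|?A. (U z - u) * (V z - v)) = (LINT z|?A. U z * V z - v * U z - u * V z + u * v)"
    by (intro Bochner_Integration.integral_cong refl) (simp add: algebra_simps)
  also have "\<dots> = (LINT z|?A. U z * V z) - v * u - u * v + u * v"
    using iU iV iUV by (simp add: A.prob_space u_def v_def)
  also have "\<dots> \<le> 0" using le by (simp add: u_def v_def mult.commute)
  finally show "covariance ?A (\<lambda>z. f (restrict (star m z) A)) (\<lambda>z. g (restrict (star m z) B)) \<le> 0"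
    unfolding covariance_def U_def[symmetric] V_def[symmetric] u_def v_def .
qed

section \<open>Negative quadrant dependence\<close>

lemma prob_space_indep_law:
  assumes "random_vector n M X"
  shows "prob_space (indep_law n M X)"
  unfolding indep_law_def
proof (rule prob_space_PiM)
  fix i assume "i \<in> {..<n}"
  then show "prob_space (distr M borel (\<lambda>\<omega>. X \<omega> i))"
    using assms random_vector_component[OF assms] by (auto simp: random_vector_def intro: prob_space.prob_space_distr)
qed

lemma sets_indep_law: "sets (indep_law n M X) = sets (borel_vec n)"
  unfolding indep_law_def by (intro sets_PiM_cong) auto

lemma sets_Collect_all_in:
  fixes n :: nat
  assumes f: "\<And>i. i < n \<Longrightarrow> f i \<in> borel_measurable M" and C: "\<And>i. i < n \<Longrightarrow> C i \<in> sets borel"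
  shows "{\<omega> \<in> space M. \<forall>i<n. f i \<omega> \<in> C i} \<in> sets M"
proof -
  have "{\<omega> \<in> space M. \<forall>i\<in>{..<n}. f i \<omega> \<in> C i} \<in> sets M"
  proof (rule sets.sets_Collect_finite_All)
    fix i assume "i \<in> {..<n}"
    then have "f i -` C i \<inter> space M \<in> sets M" using f C by (intro measurable_sets) auto
    moreover have "{\<omega> \<in> space M. f i \<omega> \<in> C i} = f i -` C i \<inter> space M" by auto
    ultimately show "{\<omega> \<in> space M. f i \<omega> \<in> C i} \<in> sets M" by simp
  qed simp
  moreover have "{\<omega> \<in> space M. \<forall>i\<in>{..<n}. f i \<omega> \<in> C i} = {\<omega> \<in> space M. \<forall>i<n. f i \<omega> \<in> C i}" by auto
  ultimately show ?thesis by (simp only:)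
qed

lemma (in prob_space) integral_eq_prob:
  fixes f :: "'a \<Rightarrow> real"
  assumes S: "S \<in> events" and f: "\<And>x. x \<in> space M \<Longrightarrow> f x = indicator S x"
  shows "integrable M f" "(LINT x|M. f x) = prob S"
proof -
  have "integrable M (indicat_real S)"
    by (rule integrable_const_bound[of _ 1]) (use S in \<open>auto simp: indicator_def\<close>)
  then show "integrable M f"
    using Bochner_Integration.integrable_cong[of M M f "indicat_real S"] f by blast
  have "(LINT x|M. f x) = (LINT x|M. indicat_real S x)"
    by (intro Bochner_Integration.integral_cong refl) (rule f)
  also have "\<dots> = measure M (S \<inter> space M)" by simp
  finally show "(LINT x|M. f x) = prob S"
    using sets.sets_into_space[OF S] by (simp add: Int_absorb2)
qed

text \<open>The indicator of a product of lower (or of upper) sets is supermodular: if one of two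
  points lies in the product, so does their minimum (or maximum), and if both do, so do minimum and
  maximum.\<close>

lemma NSD_orthant:
  assumes rv: "random_vector n M X" and N: "NSD n M X" and C: "\<And>i. C i \<in> sets borel"
    and closed: "(\<forall>i. \<forall>b\<in>C i. \<forall>a\<le>b. a \<in> C i) \<or> (\<forall>i. \<forall>a\<in>C i. \<forall>b\<ge>a. b \<in> C i)"
  shows "measure M {\<omega> \<in> space M. \<forall>i<n. X \<omega> i \<in> C i}
    \<le> measure (indep_law n M X) {x \<in> space (indep_law n M X). \<forall>i<n. x i \<in> C i}"
proof -
  let ?L = "indep_law n M X"
  interpret M: prob_space M using rv by (simp add: random_vector_def)
  interpret L: prob_space ?L by (rule prob_space_indep_law[OF rv])
  define \<phi> where "\<phi> x = (if \<forall>i<n. x i \<in> C i then 1 else 0 :: real)" for x :: "nat \<Rightarrow> real"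
  have mX: "(\<lambda>\<omega>. X \<omega> i) \<in> borel_measurable M" if "i < n" for i using random_vector_component[OF rv that] .
  have mx: "(\<lambda>x. x i) \<in> borel_measurable ?L" if "i < n" for i
    using that by (simp cong: measurable_cong_sets add: sets_indep_law)
  have sM: "{\<omega> \<in> space M. \<forall>i<n. X \<omega> i \<in> C i} \<in> sets M"
    by (rule sets_Collect_all_in) (use mX C in auto)
  have sL: "{x \<in> space ?L. \<forall>i<n. x i \<in> C i} \<in> sets ?L"
    by (rule sets_Collect_all_in) (use mx C in auto)
  have eM: "\<phi> (X \<omega>) = indicator {\<omega> \<in> space M. \<forall>i<n. X \<omega> i \<in> C i} \<omega>" if "\<omega> \<in> space M" for \<omega>
    using that by (simp add: \<phi>_def indicator_def)
  have eL: "\<phi> x = indicator {x \<in> space ?L. \<forall>i<n. x i \<in> C i} x" if "x \<in> space ?L" for x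
    using that by (simp add: \<phi>_def indicator_def)
  have cl: "(inf a b \<in> C i \<and> sup a b \<in> C i)" if "a \<in> C i" "b \<in> C i" for a b i
    using that by (cases "a \<le> b") (auto simp: inf_min sup_max min_def max_def)
  have "supermodular n \<phi>"
    unfolding supermodular_def
  proof (intro ballI)
    fix x y :: "nat \<Rightarrow> real"
    have both: "(\<forall>i<n. inf x y i \<in> C i) \<and> (\<forall>i<n. sup x y i \<in> C i)" if "\<forall>i<n. x i \<in> C i" "\<forall>i<n. y i \<in> C i"
      using that cl by auto
    have one: "(\<forall>i<n. inf x y i \<in> C i) \<or> (\<forall>i<n. sup x y i \<in> C i)" if "(\<forall>i<n. x i \<in> C i) \<or> (\<forall>i<n. y i \<in> C i)"
      using closed that by (elim disjE) (force simp: inf_min sup_max)+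
    show "\<phi> x + \<phi> y \<le> \<phi> (inf x y) + \<phi> (sup x y)"
      using both one unfolding \<phi>_def by auto
  qed
  moreover have "integrable M (\<lambda>\<omega>. \<phi> (X \<omega>))" "(LINT \<omega>|M. \<phi> (X \<omega>)) = measure M {\<omega> \<in> space M. \<forall>i<n. X \<omega> i \<in> C i}"
    using M.integral_eq_prob[OF sM eM] by (simp_all only:)
  moreover have "integrable ?L \<phi>" "(LINT x|?L. \<phi> x) = measure ?L {x \<in> space ?L. \<forall>i<n. x i \<in> C i}"
    using L.integral_eq_prob[OF sL eL] by (simp_all only:)
  ultimately show ?thesis
    using N unfolding NSD_def by metis
qed

lemma NSD_imp_NOD:
  assumes rv: "random_vector n M X" and N: "NSD n M X"
  shows "NOD n M X"
  unfolding NOD_def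
proof (intro allI conjI)
  fix t :: "nat \<Rightarrow> real"
  show "measure M {\<omega> \<in> space M. \<forall>i<n. X \<omega> i \<le> t i}
          \<le> measure (indep_law n M X) {x \<in> space (indep_law n M X). \<forall>i<n. x i \<le> t i}"
    using NSD_orthant[OF rv N, of "\<lambda>i. {..t i}"] by auto
  show "measure M {\<omega> \<in> space M. \<forall>i<n. X \<omega> i > t i}
          \<le> measure (indep_law n M X) {x \<in> space (indep_law n M X). \<forall>i<n. x i > t i}"
    using NSD_orthant[OF rv N, of "\<lambda>i. {t i<..}"] by auto
qed

text \<open>Upper tails are enough: the increasing functions used later are superpositions of
  indicators of s < x, see \<open>unit_ramp_weighted_le\<close>.\<close>

definition NQD :: "nat \<Rightarrow> 'a measure \<Rightarrow> ('a \<Rightarrow> nat \<Rightarrow> real) \<Rightarrow> bool" where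
  "NQD n M X \<longleftrightarrow> (\<forall>i<n. \<forall>j<n. i \<noteq> j \<longrightarrow> (\<forall>s t.
     measure M {\<omega> \<in> space M. s < X \<omega> i \<and> t < X \<omega> j}
       \<le> measure M {\<omega> \<in> space M. s < X \<omega> i} * measure M {\<omega> \<in> space M. t < X \<omega> j}))"

lemma PiE_eq_Collect: "{x \<in> PiE I (\<lambda>_. UNIV). \<forall>i\<in>I. x i \<in> C i} = PiE I C"
  by (rule set_eqI, unfold mem_Collect_eq PiE_iff) blast

text \<open>Send the thresholds of all other components to minus infinity: the left side increases
  to the pair probability, and the extra factors on the right are at most 1.\<close>

lemma NOD_imp_NQD:
  assumes rv: "random_vector n M X" and N: "NOD n M X"
  shows "NQD n M X"
  unfolding NQD_def
proof (intro allI impI)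
  fix i j s t assume ij: "i < n" "j < n" "i \<noteq> (j :: nat)"
  interpret M: prob_space M using rv by (simp add: random_vector_def)
  have mX [measurable]: "(\<lambda>\<omega>. X \<omega> k) \<in> borel_measurable M" if "k < n" for k using random_vector_component[OF rv that] .
  let ?p = "\<lambda>k c. measure M {\<omega> \<in> space M. c < X \<omega> k}"
  define T where "T N k = (if k = i then s else if k = j then t else - real N)" for N k
  have meas: "{\<omega> \<in> space M. \<forall>k<n. T N k < X \<omega> k} \<in> sets M" for N
    using sets_Collect_all_in[of n "\<lambda>k \<omega>. X \<omega> k" M "\<lambda>k. {T N k<..}"] mX by auto
  have le: "measure M {\<omega> \<in> space M. \<forall>k<n. T N k < X \<omega> k} \<le> ?p i s * ?p j t" for N
  proof -
    let ?L = "indep_law n M X"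
    have pk: "prob_space (distr M borel (\<lambda>\<omega>. X \<omega> k))" if "k < n" for k
      using mX[OF that] by (rule M.prob_space_distr)
    have "{x \<in> space ?L. \<forall>k<n. T N k < x k} = PiE {..<n} (\<lambda>k. {T N k<..})"
      using PiE_eq_Collect[of "{..<n}" "\<lambda>k. {T N k<..}"] by (simp add: indep_law_def space_PiM Ball_def)
    then have "emeasure ?L {x \<in> space ?L. \<forall>k<n. T N k < x k} = emeasure ?L (PiE {..<n} (\<lambda>k. {T N k<..}))"
      by (simp only:)
    also have "\<dots> = (\<Prod>k<n. emeasure (distr M borel (\<lambda>\<omega>. X \<omega> k)) {T N k<..})"
      using emeasure_PiM_emb[of "{..<n}" "\<lambda>k. distr M borel (\<lambda>\<omega>. X \<omega> k)" "{..<n}" "\<lambda>k. {T N k<..}"] pk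
      by (simp add: indep_law_def prod_emb_PiE_same_index)
    also have "\<dots> = (\<Prod>k<n. ennreal (?p k (T N k)))"
    proof (intro prod.cong refl)
      fix k assume k: "k \<in> {..<n}"
      have "(\<lambda>\<omega>. X \<omega> k) -` {T N k<..} \<inter> space M = {\<omega> \<in> space M. T N k < X \<omega> k}" by auto
      then show "emeasure (distr M borel (\<lambda>\<omega>. X \<omega> k)) {T N k<..} = ennreal (?p k (T N k))"
        using k mX by (simp add: emeasure_distr M.emeasure_eq_measure)
    qed
    finally have "measure ?L {x \<in> space ?L. \<forall>k<n. T N k < x k} = (\<Prod>k<n. ?p k (T N k))"
      by (simp add: measure_def prod_ennreal prod_nonneg)
    also have "\<dots> = ?p i s * (?p j t * (\<Prod>k\<in>{..<n} - {i} - {j}. ?p k (T N k)))"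
      using ij by (simp add: prod.remove[of "{..<n}" i] prod.remove[of "{..<n} - {i}" j] T_def)
    also have "\<dots> \<le> ?p i s * (?p j t * 1)"
      by (intro mult_left_mono prod_le_1) auto
    finally have "measure ?L {x \<in> space ?L. \<forall>k<n. T N k < x k} \<le> ?p i s * ?p j t" by simp
    moreover have "measure M {\<omega> \<in> space M. \<forall>k<n. T N k < X \<omega> k} \<le> measure ?L {x \<in> space ?L. \<forall>k<n. T N k < x k}"
      using \<open>NOD n M X\<close> unfolding NOD_def by blast
    ultimately show ?thesis by linarith
  qed
  have "(\<lambda>N. measure M {\<omega> \<in> space M. \<forall>k<n. T N k < X \<omega> k}) \<longlonglongrightarrow>
    measure M (\<Union>N. {\<omega> \<in> space M. \<forall>k<n. T N k < X \<omega> k})"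
  proof (rule M.finite_Lim_measure_incseq)
    show "range (\<lambda>N. {\<omega> \<in> space M. \<forall>k<n. T N k < X \<omega> k}) \<subseteq> M.events" using meas by auto
    show "incseq (\<lambda>N. {\<omega> \<in> space M. \<forall>k<n. T N k < X \<omega> k})"
    proof (rule incseq_SucI, safe)
      fix N \<omega> k assume "\<forall>k<n. T N k < X \<omega> k" "k < n"
      then have "T N k < X \<omega> k" by simp
      then show "T (Suc N) k < X \<omega> k" by (auto simp: T_def split: if_splits)
    qed
  qed
  moreover have "(\<Union>N. {\<omega> \<in> space M. \<forall>k<n. T N k < X \<omega> k}) = {\<omega> \<in> space M. s < X \<omega> i \<and> t < X \<omega> j}"
  proof (intro equalityI subsetI)
    fix \<omega> assume "\<omega> \<in> {\<omega> \<in> space M. s < X \<omega> i \<and> t < X \<omega> j}"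
    then have \<omega>: "\<omega> \<in> space M" "s < X \<omega> i" "t < X \<omega> j" by auto
    obtain N :: nat where N: "(\<Sum>k<n. \<bar>X \<omega> k\<bar>) < N" using reals_Archimedean2 by blast
    have "- real N < X \<omega> k" if "k < n" for k
      using member_le_sum[of k "{..<n}" "\<lambda>k. \<bar>X \<omega> k\<bar>"] that N by auto
    then show "\<omega> \<in> (\<Union>N. {\<omega> \<in> space M. \<forall>k<n. T N k < X \<omega> k})"
      using \<omega> by (auto simp: T_def)
  next
    fix \<omega> assume "\<omega> \<in> (\<Union>N. {\<omega> \<in> space M. \<forall>k<n. T N k < X \<omega> k})"
    then obtain N where w: "\<omega> \<in> space M" and T: "\<And>k. k < n \<Longrightarrow> T N k < X \<omega> k" by auto
    then show "\<omega> \<in> {\<omega> \<in> space M. s < X \<omega> i \<and> t < X \<omega> j}"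
      using w T[OF ij(1)] T[OF ij(2)] ij(3) by (simp add: T_def)
  qed
  ultimately show "measure M {\<omega> \<in> space M. s < X \<omega> i \<and> t < X \<omega> j} \<le> ?p i s * ?p j t"
    using le by (auto intro: LIMSEQ_le_const2)
qed

text \<open>Indicators of upper half lines are increasing functions of disjoint single components,
  so their covariance is nonpositive.\<close>

lemma NA_imp_NQD:
  assumes rv: "random_vector n M X" and N: "NA n M X"
  shows "NQD n M X"
  unfolding NQD_def
proof (intro allI impI)
  fix i j s t assume ij: "i < n" "j < n" "i \<noteq> (j :: nat)"
  interpret M: prob_space M using rv by (simp add: random_vector_def)
  have [measurable]: "(\<lambda>\<omega>. X \<omega> i) \<in> borel_measurable M" "(\<lambda>\<omega>. X \<omega> j) \<in> borel_measurable M"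
    using random_vector_component[OF rv] ij by auto
  define f where "f k c x = (if c < x k then 1 else 0 :: real)" for k c and x :: "nat \<Rightarrow> real"
  have fe: "f k c (restrict (X \<omega>) {k}) = indicator {\<omega> \<in> space M. c < X \<omega> k} \<omega>" if "\<omega> \<in> space M" for k c \<omega>
    using that by (simp add: f_def)
  have ind: "indicator {\<omega> \<in> space M. c < X \<omega> k} \<in> borel_measurable M" if "k \<in> {i, j}" for k c
    using that by auto
  have inc: "coordwise_increasing {k} (f k c)" for k c by (auto simp: coordwise_increasing_def f_def)
  have m: "(\<lambda>\<omega>. f k c (restrict (X \<omega>) {k})) \<in> borel_measurable M" if "k \<in> {i, j}" for k c
    using ind[OF that, of c] by (subst measurable_cong[OF fe]) auto
  have fsm: "finite_second_moment M (\<lambda>\<omega>. f k c (restrict (X \<omega>) {k}))" if "k \<in> {i, j}" for k c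
    unfolding finite_second_moment_def using m[OF that]
    by (intro conjI M.integrable_const_bound[of _ 1]) (auto simp: f_def)
  define U where "U \<omega> = f i s (restrict (X \<omega>) {i})" for \<omega>
  define V where "V \<omega> = f j t (restrict (X \<omega>) {j})" for \<omega>
  have mU [measurable]: "U \<in> borel_measurable M" "V \<in> borel_measurable M" unfolding U_def V_def using m by auto
  have iU: "integrable M U" "integrable M V" "integrable M (\<lambda>\<omega>. U \<omega> * V \<omega>)"
    by (rule M.integrable_const_bound[of _ 1], auto simp: U_def V_def f_def)+
  have c: "covariance M U V \<le> 0"
    using N[unfolded NA_def, rule_format, of "{i}" "{j}" "f i s" "f j t"] ij inc fsm unfolding U_def V_def by auto
  define u v where "u = (LINT \<omega>|M. U \<omega>)" and "v = (LINT \<omega>|M. V \<omega>)"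
  have "covariance M U V = (LINT \<omega>|M. U \<omega> * V \<omega> - v * U \<omega> - u * V \<omega> + u * v)"
    unfolding covariance_def u_def[symmetric] v_def[symmetric]
    by (intro Bochner_Integration.integral_cong refl) (simp add: algebra_simps)
  also have "\<dots> = (LINT \<omega>|M. U \<omega> * V \<omega>) - v * u - u * v + u * v"
    using iU by (simp add: M.prob_space u_def v_def)
  finally have "(LINT \<omega>|M. U \<omega> * V \<omega>) \<le> u * v" using c by (simp add: mult.commute)
  moreover have "(LINT \<omega>|M. U \<omega> * V \<omega>) = M.prob {\<omega> \<in> space M. s < X \<omega> i \<and> t < X \<omega> j}"
    by (rule M.integral_eq_prob) (auto simp: U_def V_def fe indicator_def)
  moreover have "u = M.prob {\<omega> \<in> space M. s < X \<omega> i}"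
    unfolding u_def by (rule M.integral_eq_prob) (auto simp: U_def fe)
  moreover have "v = M.prob {\<omega> \<in> space M. t < X \<omega> j}"
    unfolding v_def by (rule M.integral_eq_prob) (auto simp: V_def fe)
  ultimately show "measure M {\<omega> \<in> space M. s < X \<omega> i \<and> t < X \<omega> j}
       \<le> measure M {\<omega> \<in> space M. s < X \<omega> i} * measure M {\<omega> \<in> space M. t < X \<omega> j}"
    by (simp only:)
qed

section \<open>Covariances of bounded increasing functions\<close>

definition unit_ramp :: "(real \<Rightarrow> real) \<Rightarrow> bool" where
  "unit_ramp f \<longleftrightarrow> mono f \<and> continuous_on UNIV f \<and> (\<forall>x. 0 \<le> f x \<and> f x \<le> 1)"

lemma unit_ramp_measurable: "unit_ramp f \<Longrightarrow> f \<in> borel_measurable borel"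
  by (auto simp: unit_ramp_def intro: borel_measurable_mono)

text \<open>Continuity makes the superlevel set open, so as a half line it has the strict form s < x
  that occurs in \<open>NQD\<close>.\<close>

lemma unit_ramp_superlevel:
  assumes f: "unit_ramp f"
  obtains "\<And>x. h < f x" | "\<And>x. \<not> h < f x" | s where "\<And>x. h < f x \<longleftrightarrow> s < x"
proof (cases "(\<forall>x. h < f x) \<or> (\<forall>x. \<not> h < f x)")
  case True
  then show ?thesis using that(1,2) by blast
next
  case False
  then obtain x0 x1 where x: "\<not> h < f x0" "h < f x1" by blast
  have mono: "f x \<le> f y" if "x \<le> y" for x y using f that by (auto simp: unit_ramp_def mono_def)
  let ?A = "{x. h < f x}"
  have lb: "x0 \<le> x" if "x \<in> ?A" for x using mono[of x x0] x(1) that by (cases "x0 \<le> x") auto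
  then have bdd: "bdd_below ?A" by (rule bdd_belowI)
  have ne: "?A \<noteq> {}" using x by auto
  have op: "open ?A"
    using f by (intro open_Collect_less continuous_on_const) (auto simp: unit_ramp_def)
  have "h < f y \<longleftrightarrow> Inf ?A < y" for y
  proof
    assume "Inf ?A < y"
    then obtain z where "z \<in> ?A" "z < y" using cInf_lessD[OF ne] by blast
    then show "h < f y" using mono[of z y] by simp
  next
    assume "h < f y"
    then have "y \<in> ?A" by simp
    then obtain e where e: "e > 0" "ball y e \<subseteq> ?A" using op by (auto simp: open_contains_ball)
    then have "y - e / 2 \<in> ?A" by (auto simp: dist_real_def subset_iff)
    then have "Inf ?A \<le> y - e / 2" by (rule cInf_lower[OF _ bdd])
    then show "Inf ?A < y" using e by simp
  qed
  then show ?thesis using that(3) by blast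
qed

text \<open>Layer cake: f x is the integral over h in [0, 1] of the indicator of h < f x. After
  Fubini each layer is a tail event, empty, or everything; \<open>base\<close> handles the last
  case.\<close>

lemma (in prob_space) unit_ramp_weighted_le:
  assumes [measurable]: "X \<in> borel_measurable M" "V \<in> borel_measurable M" and V: "\<And>\<omega>. 0 \<le> V \<omega>" "\<And>\<omega>. V \<omega> \<le> (1 :: real)"
    and f: "unit_ramp f" and base: "(LINT \<omega>|M. V \<omega>) \<le> c"
    and tail: "\<And>s. (LINT \<omega>|M. (if s < X \<omega> then 1 else 0) * V \<omega>) \<le> (LINT \<omega>|M. (if s < X \<omega> then 1 else 0)) * c"
  shows "(LINT \<omega>|M. f (X \<omega>) * V \<omega>) \<le> (LINT \<omega>|M. f (X \<omega>)) * c"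
proof -
  define L where "L = uniform_measure lborel {0..1::real}"
  interpret L: prob_space L unfolding L_def by (rule prob_space_uniform_measure) auto
  have sL [measurable_cong]: "sets L = sets borel" by (simp add: L_def)
  interpret ProdL: pair_prob_space M L by unfold_locales
  have [measurable]: "f \<in> borel_measurable borel" by (rule unit_ramp_measurable[OF f])
  have f01: "0 \<le> f x" "f x \<le> 1" for x using f by (auto simp: unit_ramp_def)
  have lay: "(LINT h|L. (if h < y then 1 else 0)) = y" if "0 \<le> y" "y \<le> 1" for y :: real
  proof -
    have "(LINT h|L. (if h < y then 1 else 0)) = measure L {..<y}"
      by (rule L.integral_eq_prob) (auto simp: sL)
    also have "\<dots> = y"
    proof -
      have "{0..1} \<inter> {..<y} = {0..<y}" using that by auto
      moreover have "ennreal y / 1 = ennreal y" using divide_ennreal[of y 1] that by simp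
      ultimately show ?thesis unfolding L_def using that by (simp add: measure_def emeasure_uniform_measure)
    qed
    finally show ?thesis .
  qed
  define G where "G \<omega> h = (if h < f (X \<omega>) then 1 else 0 :: real)" for \<omega> h
  have [measurable]: "(\<lambda>p. G (fst p) (snd p)) \<in> borel_measurable (M \<Otimes>\<^sub>M L)"
    unfolding G_def by measurable
  have G01: "0 \<le> G \<omega> h" "G \<omega> h \<le> 1" for \<omega> h by (auto simp: G_def)
  have i1: "integrable (M \<Otimes>\<^sub>M L) (\<lambda>(\<omega>, h). G \<omega> h * V \<omega>)"
    by (rule ProdL.integrable_const_bound[of _ 1])
      (use G01 V in \<open>auto simp: split_beta' abs_mult intro!: mult_le_one\<close>)
  have i2: "integrable (M \<Otimes>\<^sub>M L) (\<lambda>(\<omega>, h). G \<omega> h)"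
    by (rule ProdL.integrable_const_bound[of _ 1]) (use G01 in \<open>auto simp: split_beta'\<close>)
  have "(LINT \<omega>|M. f (X \<omega>) * V \<omega>) = (LINT \<omega>|M. LINT h|L. G \<omega> h * V \<omega>)"
    unfolding G_def using f01 by (simp add: lay)
  also have "\<dots> = (LINT h|L. LINT \<omega>|M. G \<omega> h * V \<omega>)"
    by (rule ProdL.Fubini_integral[symmetric, OF i1])
  also have "\<dots> \<le> (LINT h|L. (LINT \<omega>|M. G \<omega> h) * c)"
  proof (rule integral_mono)
    show "integrable L (\<lambda>h. LINT \<omega>|M. G \<omega> h * V \<omega>)" using ProdL.integrable_snd[OF i1] .
    show "integrable L (\<lambda>h. (LINT \<omega>|M. G \<omega> h) * c)" using ProdL.integrable_snd[OF i2] by simp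
    fix h
    show "(LINT \<omega>|M. G \<omega> h * V \<omega>) \<le> (LINT \<omega>|M. G \<omega> h) * c"
    proof (rule unit_ramp_superlevel[OF f, of h])
      assume "\<And>x. h < f x"
      then show ?thesis using base by (simp add: G_def prob_space)
    next
      assume "\<And>x. \<not> h < f x"
      then show ?thesis by (simp add: G_def)
    next
      fix s assume "\<And>x. h < f x \<longleftrightarrow> s < x"
      then show ?thesis using tail[of s] by (simp add: G_def)
    qed
  qed
  also have "\<dots> = (LINT h|L. LINT \<omega>|M. G \<omega> h) * c" by simp
  also have "(LINT h|L. LINT \<omega>|M. G \<omega> h) = (LINT \<omega>|M. LINT h|L. G \<omega> h)"
    by (rule ProdL.Fubini_integral[OF i2])
  also have "\<dots> = (LINT \<omega>|M. f (X \<omega>))"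
    unfolding G_def using f01 by (simp add: lay)
  finally show ?thesis .
qed

text \<open>The layer cake is applied to one factor at a time: first to f against an indicator in
  X_j, then to g against f (X_i).\<close>

lemma NQD_unit_ramp_covariance:
  assumes rv: "random_vector n M X" and N: "NQD n M X" and ij: "i < n" "j < n" "i \<noteq> j"
    and f: "unit_ramp f" and g: "unit_ramp g"
  shows "(LINT \<omega>|M. f (X \<omega> i) * g (X \<omega> j)) \<le> (LINT \<omega>|M. f (X \<omega> i)) * (LINT \<omega>|M. g (X \<omega> j))"
proof -
  interpret M: prob_space M using rv by (simp add: random_vector_def)
  have [measurable]: "(\<lambda>\<omega>. X \<omega> i) \<in> borel_measurable M" "(\<lambda>\<omega>. X \<omega> j) \<in> borel_measurable M"
    using random_vector_component[OF rv] ij by auto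
  note [measurable] = unit_ramp_measurable[OF f] unit_ramp_measurable[OF g]
  have f01: "0 \<le> f x" "f x \<le> 1" for x using f by (auto simp: unit_ramp_def)
  have 1: "(LINT \<omega>|M. f (X \<omega> i) * (if t < X \<omega> j then 1 else 0)) \<le> (LINT \<omega>|M. f (X \<omega> i)) * (LINT \<omega>|M. (if t < X \<omega> j then 1 else 0))" for t
  proof (rule M.unit_ramp_weighted_le[OF _ _ _ _ f])
    fix s
    have nqd: "M.prob {\<omega> \<in> space M. s < X \<omega> i \<and> t < X \<omega> j} \<le>
      M.prob {\<omega> \<in> space M. s < X \<omega> i} * M.prob {\<omega> \<in> space M. t < X \<omega> j}"
      using N ij unfolding NQD_def by blast
    have "(LINT \<omega>|M. (if s < X \<omega> i then 1 else 0) * (if t < X \<omega> j then 1 else 0)) = M.prob {\<omega> \<in> space M. s < X \<omega> i \<and> t < X \<omega> j}"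
      by (rule M.integral_eq_prob) auto
    moreover have "(LINT \<omega>|M. (if s < X \<omega> i then 1 else 0)) = M.prob {\<omega> \<in> space M. s < X \<omega> i}"
      by (rule M.integral_eq_prob) auto
    moreover have "(LINT \<omega>|M. (if t < X \<omega> j then 1 else 0)) = M.prob {\<omega> \<in> space M. t < X \<omega> j}"
      by (rule M.integral_eq_prob) auto
    ultimately show "(LINT \<omega>|M. (if s < X \<omega> i then 1 else 0 :: real) * (if t < X \<omega> j then 1 else 0)) \<le>
      (LINT \<omega>|M. (if s < X \<omega> i then 1 else 0)) * (LINT \<omega>|M. (if t < X \<omega> j then 1 else 0))"
      using nqd by (simp only:)
  qed auto
  have "(LINT \<omega>|M. g (X \<omega> j) * f (X \<omega> i)) \<le> (LINT \<omega>|M. g (X \<omega> j)) * (LINT \<omega>|M. f (X \<omega> i))"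
  proof (rule M.unit_ramp_weighted_le[OF _ _ _ _ g])
    fix t
    show "(LINT \<omega>|M. (if t < X \<omega> j then 1 else 0) * f (X \<omega> i)) \<le>
      (LINT \<omega>|M. (if t < X \<omega> j then 1 else 0)) * (LINT \<omega>|M. f (X \<omega> i))"
      using 1[of t] by (simp only: mult.commute)
  qed (auto simp: f01)
  then show ?thesis by (simp only: mult.commute)
qed

lemma unit_ramp_affine:
  assumes "unit_ramp f" "0 < s"
  shows "unit_ramp (\<lambda>x. f ((x - m) / s))"
proof -
  have "mono (\<lambda>x. f ((x - m) / s))"
    using assms by (auto simp: unit_ramp_def mono_def divide_right_mono)
  moreover have "continuous_on UNIV (\<lambda>x. f ((x - m) / s))"
    by (rule continuous_on_compose2[of UNIV f]) (use assms in \<open>auto simp: unit_ramp_def intro!: continuous_intros\<close>)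
  ultimately show ?thesis using assms by (simp add: unit_ramp_def)
qed

lemma NQD_standardised:
  assumes P: "generating_law \<psi> P" and E: "elliptical n \<mu> S \<psi> M X" and pos: "\<And>i. i < n \<Longrightarrow> 0 < S i i"
    and N: "NQD n M X" and ij: "i < n" "j < n" "i \<noteq> j" and f: "unit_ramp f" and g: "unit_ramp g"
  shows "(LINT \<omega>|M. f ((X \<omega> i - \<mu> i) / sqrt (S i i)) * g ((X \<omega> j - \<mu> j) / sqrt (S j j))) \<le> (LINT y|P. f y) * (LINT y|P. g y)"
proof -
  have rv: "random_vector n M X" using E by (simp add: elliptical_def)
  have e: "(LINT \<omega>|M. f ((X \<omega> i - \<mu> i) / sqrt (S i i))) = (LINT y|P. f y)" if "unit_ramp f" "i < n" for f i
  proof -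
    note [measurable] = elliptical_component[OF E that(2)]
    show ?thesis
      by (subst standardised_component_distr[OF P E that(2) pos[OF that(2)], symmetric])
        (subst integral_distr; use unit_ramp_measurable[OF that(1)] in simp)
  qed
  show ?thesis
    using NQD_unit_ramp_covariance[OF rv N ij unit_ramp_affine[OF f, of "sqrt (S i i)" "\<mu> i"] unit_ramp_affine[OF g, of "sqrt (S j j)" "\<mu> j"]]
      pos ij e[OF f ij(1)] e[OF g ij(2)] by simp
qed

text \<open>arctan is bounded, odd and strictly increasing; the reflection argument of
  \<open>NQD_dispersion_nonpos\<close> uses all three.\<close>

lemma unit_ramp_arctan: "unit_ramp (\<lambda>x. arctan x / pi + 1 / 2)"
proof -
  have "mono (\<lambda>x. arctan x / pi + 1 / 2)"
    by (auto simp: mono_def arctan_le_iff divide_right_mono)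
  moreover have "continuous_on UNIV (\<lambda>x. arctan x / pi + 1 / 2)" by (intro continuous_intros) auto
  moreover have "0 \<le> arctan x / pi + 1 / 2" "arctan x / pi + 1 / 2 \<le> 1" for x
    using arctan_lbound[of x] arctan_ubound[of x] by (auto simp: field_simps)
  ultimately show ?thesis by (simp add: unit_ramp_def)
qed

text \<open>
  The pair \<open>(Y\<^sub>i, Y\<^sub>j)\<close> of standardised components has the same law as its reflection
  \<open>(Y\<^sub>i, 2\<rho>Y\<^sub>i - Y\<^sub>j)\<close>. If \<open>\<rho> > 0\<close> this makes the covariance of the arctangents positive.
\<close>

lemma NQD_dispersion_nonpos:
  assumes P: "generating_law \<psi> P" and E: "elliptical n \<mu> S \<psi> M X" and pos: "\<And>i. i < n \<Longrightarrow> 0 < S i i"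
    and N: "NQD n M X" and ij: "i < n" "j < n" "i \<noteq> j"
  shows "S i j \<le> 0"
proof (rule ccontr)
  assume "\<not> S i j \<le> 0"
  then have Sij: "0 < S i j" by simp
  interpret M: prob_space M using E by (rule elliptical_prob_space)
  interpret P: real_distribution P using P by (simp add: generating_law_def)
  have sym: "S j i = S i j" using E ij by (simp add: elliptical_def psd_symmetric_def)
  define a b where "a = sqrt (S i i)" and "b = sqrt (S j j)"
  have ab: "0 < a" "0 < b" "S i i = a\<^sup>2" "S j j = b\<^sup>2" using pos ij by (auto simp: a_def b_def less_imp_le)
  define \<rho> where "\<rho> = S i j / (a * b)"
  have \<rho>: "0 < \<rho>" using Sij ab by (simp add: \<rho>_def)
  define U where "U \<omega> = (X \<omega> i - \<mu> i) / a" for \<omega>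
  define V where "V \<omega> = (X \<omega> j - \<mu> j) / b" for \<omega>
  have [measurable]: "(\<lambda>\<omega>. X \<omega> i) \<in> borel_measurable M" "(\<lambda>\<omega>. X \<omega> j) \<in> borel_measurable M"
    using elliptical_component[OF E] ij by auto
  have mUV [measurable]: "U \<in> borel_measurable M" "V \<in> borel_measurable M" unfolding U_def V_def by measurable
  have ch: "(CLINT \<omega>|M. iexp (p * U \<omega> + q * V \<omega>)) = of_real (\<psi> (p\<^sup>2 + 2 * \<rho> * p * q + q\<^sup>2))" for p q
  proof -
    let ?t = "\<lambda>l. if l = i then p / a else if l = j then q / b else 0"
    have "quad_form n S ?t = p\<^sup>2 + 2 * \<rho> * p * q + q\<^sup>2"
      unfolding quad_form_two[OF ij] sym using ab by (simp add: \<rho>_def power_divide field_simps)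
    moreover have "(\<Sum>l<n. ?t l * (X \<omega> l - \<mu> l)) = p * U \<omega> + q * V \<omega>" for \<omega>
      unfolding sum_two[OF ij] by (simp add: U_def V_def)
    ultimately show ?thesis using elliptical_char[OF E, of ?t] by simp
  qed
  define R1 where "R1 \<omega> = (\<lambda>k\<in>{..<2::nat}. if k = 0 then U \<omega> else V \<omega>)" for \<omega>
  define R2 where "R2 \<omega> = (\<lambda>k\<in>{..<2::nat}. if k = 0 then U \<omega> else 2 * \<rho> * U \<omega> - V \<omega>)" for \<omega>
  have mR: "R1 \<in> measurable M (borel_vec 2)" "R2 \<in> measurable M (borel_vec 2)"
    unfolding R1_def R2_def by (intro measurable_restrict; simp)+
  have two: "(\<Sum>k<2. t k * x k) = t 0 * x 0 + t 1 * x 1" for t x :: "nat \<Rightarrow> real" by (simp add: numeral_2_eq_2)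
  have d: "distr M (borel_vec 2) R1 = distr M (borel_vec 2) R2"
  proof (rule char_unique_vec)
    show "random_vector 2 M R1" "random_vector 2 M R2"
      using mR M.prob_space_axioms by (auto simp: random_vector_def)
    fix t :: "nat \<Rightarrow> real"
    have "(CLINT \<omega>|M. iexp (\<Sum>k<2. t k * R1 \<omega> k)) = (CLINT \<omega>|M. iexp (t 0 * U \<omega> + t 1 * V \<omega>))"
      unfolding two by (simp add: R1_def)
    \<comment> \<open>The form p^2 + 2 \<rho> p q + q^2 is invariant under (p, q) -> (p + 2 \<rho>
      q, - q), the transpose of the reflection.\<close>
    also have "\<dots> = (CLINT \<omega>|M. iexp ((t 0 + 2 * \<rho> * t 1) * U \<omega> + (- t 1) * V \<omega>))"
      unfolding ch by (simp add: power2_eq_square algebra_simps)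
    also have "\<dots> = (CLINT \<omega>|M. iexp (\<Sum>k<2. t k * R2 \<omega> k))"
      unfolding two by (intro Bochner_Integration.integral_cong refl) (simp add: R2_def algebra_simps)
    finally show "(CLINT \<omega>|M. iexp (\<Sum>k<2. t k * R1 \<omega> k)) = (CLINT \<omega>|M. iexp (\<Sum>k<2. t k * R2 \<omega> k))" .
  qed
  define h where "h x = arctan (x 0) * arctan (x 1)" for x :: "nat \<Rightarrow> real"
  have mh: "h \<in> borel_measurable (borel_vec 2)"
    unfolding h_def by (intro borel_measurable_times measurable_compose[OF _ borel_measurable_arctan] measurable_component_singleton) auto
  have bd: "\<bar>arctan x\<bar> \<le> pi / 2" for x using arctan_lbound[of x] arctan_ubound[of x] by (simp add: abs_if)
  have bd2: "\<bar>arctan x * arctan y\<bar> \<le> (pi / 2) * (pi / 2)" for x y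
    unfolding abs_mult by (intro mult_mono bd) auto
  have mat [measurable]: "arctan \<in> borel_measurable borel" by (rule borel_measurable_arctan)
  have i1: "integrable M (\<lambda>\<omega>. arctan (U \<omega>))" "integrable M (\<lambda>\<omega>. arctan (V \<omega>))"
    by (rule M.integrable_const_bound[of _ "pi / 2"], rule AE_I2, unfold real_norm_def, rule bd, measurable)+
  have i2: "integrable M (\<lambda>\<omega>. arctan (U \<omega>) * arctan (V \<omega>))" "integrable M (\<lambda>\<omega>. arctan (U \<omega>) * arctan (2 * \<rho> * U \<omega> - V \<omega>))"
    by (rule M.integrable_const_bound[of _ "(pi / 2) * (pi / 2)"], rule AE_I2, unfold real_norm_def, rule bd2, measurable)+
  have refl: "(LINT \<omega>|M. arctan (U \<omega>) * arctan (V \<omega>)) = (LINT \<omega>|M. arctan (U \<omega>) * arctan (2 * \<rho> * U \<omega> - V \<omega>))"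
  proof -
    have "(LINT \<omega>|M. arctan (U \<omega>) * arctan (V \<omega>)) = (LINT x|distr M (borel_vec 2) R1. h x)"
      by (subst integral_distr[OF mR(1) mh]) (simp add: h_def R1_def)
    also have "\<dots> = (LINT \<omega>|M. arctan (U \<omega>) * arctan (2 * \<rho> * U \<omega> - V \<omega>))"
      unfolding d by (subst integral_distr[OF mR(2) mh]) (simp add: h_def R2_def)
    finally show ?thesis .
  qed
  \<comment> \<open>The arguments v and 2 \<rho> u - v add up to 2 \<rho> u. As arctan is odd and
    strictly increasing, the sum of the two arctangents has the sign of u.\<close>
  have pt: "0 \<le> arctan u * (arctan v + arctan (2 * \<rho> * u - v))" "u \<noteq> 0 \<Longrightarrow> 0 < arctan u * (arctan v + arctan (2 * \<rho> * u - v))" for u v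
  proof -
    have pos: "0 < arctan v + arctan (2 * \<rho> * u - v)" if "0 < u" for u v
    proof -
      have "- v < 2 * \<rho> * u - v" using that \<rho> by simp
      then have "arctan (- v) < arctan (2 * \<rho> * u - v)" by (simp only: arctan_less_iff)
      then show ?thesis by (simp add: arctan_minus)
    qed
    show p: "0 < arctan u * (arctan v + arctan (2 * \<rho> * u - v))" if "u \<noteq> 0" for u v
    proof (cases "0 < u")
      case True
      then show ?thesis using pos[OF True, of v] by simp
    next
      case False
      then have "0 < - u" using that by simp
      from pos[OF this, of "- v"] have "arctan v + arctan (2 * \<rho> * u - v) < 0"
        using arctan_minus[of v] arctan_minus[of "2 * \<rho> * u - v"] by (simp add: algebra_simps)
      then show ?thesis using \<open>0 < - u\<close> by (simp add: zero_less_mult_iff)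
    qed
    show "0 \<le> arctan u * (arctan v + arctan (2 * \<rho> * u - v))"
      using p[of u v] by (cases "u = 0") auto
  qed
  have i3: "integrable M (\<lambda>\<omega>. arctan (U \<omega>) * (arctan (V \<omega>) + arctan (2 * \<rho> * U \<omega> - V \<omega>)))"
    using i2 by (simp add: distrib_left)
  \<comment> \<open>The integrand is nonnegative, but by the reflection its integral is twice the
    covariance of the arctangents, which NQD makes nonpositive. So the integrand vanishes almost
    surely, which forces U = 0.\<close>
  have "(LINT \<omega>|M. arctan (U \<omega>) * (arctan (V \<omega>) + arctan (2 * \<rho> * U \<omega> - V \<omega>))) = 2 * (LINT \<omega>|M. arctan (U \<omega>) * arctan (V \<omega>))"
    using i2 refl by (simp add: distrib_left)
  also have "\<dots> \<le> 0"
  proof -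
    have sP: "(LINT y|P. arctan y) = 0"
    proof -
      have "(LINT y|P. arctan y) = (LINT y|distr P borel uminus. arctan y)" by (simp only: generating_law_symmetric[OF P])
      also have "\<dots> = - (LINT y|P. arctan y)" by (subst integral_distr) (auto simp: arctan_minus)
      finally show ?thesis by simp
    qed
    have iP: "integrable P arctan"
      by (rule P.integrable_const_bound[of _ "pi / 2"], rule AE_I2, unfold real_norm_def, rule bd, measurable)
    have half: "(LINT y|P. arctan y / pi + 1 / 2) = 1 / 2" using iP sP P.prob_space by simp
    have zero: "(LINT \<omega>|M. arctan (U \<omega>)) = 0" "(LINT \<omega>|M. arctan (V \<omega>)) = 0"
    proof -
      show "(LINT \<omega>|M. arctan (U \<omega>)) = 0"
        using integral_distr[of U M borel arctan] standardised_component_distr[OF P E ij(1) pos[OF ij(1)]] sP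
        by (simp add: U_def[abs_def] a_def)
      show "(LINT \<omega>|M. arctan (V \<omega>)) = 0"
        using integral_distr[of V M borel arctan] standardised_component_distr[OF P E ij(2) pos[OF ij(2)]] sP
        by (simp add: V_def[abs_def] b_def)
    qed
    have "(LINT \<omega>|M. (arctan (U \<omega>) / pi + 1 / 2) * (arctan (V \<omega>) / pi + 1 / 2)) \<le> 1 / 2 * (1 / 2)"
      using NQD_standardised[OF P E pos N ij unit_ramp_arctan unit_ramp_arctan]
      unfolding half U_def V_def a_def b_def .
    moreover have "(LINT \<omega>|M. (arctan (U \<omega>) / pi + 1 / 2) * (arctan (V \<omega>) / pi + 1 / 2)) =
      (LINT \<omega>|M. (1 / pi\<^sup>2) * (arctan (U \<omega>) * arctan (V \<omega>)) + (1 / (2 * pi)) * arctan (U \<omega>) + (1 / (2 * pi)) * arctan (V \<omega>) + 1 / 4)"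
      by (intro Bochner_Integration.integral_cong HOL.refl) (simp add: power2_eq_square field_simps)
    moreover have "\<dots> = (1 / pi\<^sup>2) * (LINT \<omega>|M. arctan (U \<omega>) * arctan (V \<omega>)) + 1 / 4"
      using i1 i2 zero by (simp add: M.prob_space)
    ultimately show ?thesis by (simp add: divide_le_0_iff)
  qed
  finally have "(LINT \<omega>|M. arctan (U \<omega>) * (arctan (V \<omega>) + arctan (2 * \<rho> * U \<omega> - V \<omega>))) = 0"
    using pt(1) by (intro antisym integral_nonneg_AE) auto
  then have "AE \<omega> in M. arctan (U \<omega>) * (arctan (V \<omega>) + arctan (2 * \<rho> * U \<omega> - V \<omega>)) = 0"
    using integral_nonneg_eq_0_iff_AE[OF i3] pt(1) by auto
  then have "AE \<omega> in M. U \<omega> = 0"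
  proof eventually_elim
    case (elim \<omega>)
    show ?case
    proof (rule ccontr)
      assume "U \<omega> \<noteq> 0"
      from pt(2)[OF this, of "V \<omega>"] show False unfolding elim by (simp only: less_irrefl)
    qed
  qed
  then have "AE y in distr M borel U. y = 0" by (subst AE_distr_iff) auto
  moreover have "distr M borel U = P"
    using standardised_component_distr[OF P E ij(1) pos[OF ij(1)]] by (simp add: U_def[abs_def] a_def)
  ultimately have "AE y in P. y = 0" by (simp only:)
  then show False using P by (simp add: generating_law_def)
qed

section \<open>Concentration of the mean square and the Gaussian generator\<close>

lemma NQD_unit_ramp_mean:
  assumes P: "generating_law \<psi> P" and E: "elliptical n \<mu> S \<psi> M X" and pos: "\<And>i. i < n \<Longrightarrow> 0 < S i i"
    and N: "NQD n M X" and f: "unit_ramp f" and n: "0 < n"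
  defines "A \<equiv> (\<lambda>\<omega>. (\<Sum>i<n. f ((X \<omega> i - \<mu> i) / sqrt (S i i))) / n)"
  shows "A \<in> borel_measurable M" "integrable M (\<lambda>\<omega>. (A \<omega> - (LINT y|P. f y))\<^sup>2)"
    "(LINT \<omega>|M. (A \<omega> - (LINT y|P. f y))\<^sup>2) \<le> 1 / n"
proof -
  interpret M: prob_space M using E by (rule elliptical_prob_space)
  interpret P: real_distribution P using P by (simp add: generating_law_def)
  have mf [measurable]: "f \<in> borel_measurable borel" by (rule unit_ramp_measurable[OF f])
  have f01: "0 \<le> f x" "f x \<le> 1" for x using f by (auto simp: unit_ramp_def)
  define a where "a = (LINT y|P. f y)"
  define Y where "Y i \<omega> = f ((X \<omega> i - \<mu> i) / sqrt (S i i))" for i \<omega>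
  have mX: "(\<lambda>\<omega>. X \<omega> i) \<in> borel_measurable M" if "i < n" for i using elliptical_component[OF E that] .
  have mY: "Y i \<in> borel_measurable M" if "i < n" for i
    unfolding Y_def using mX[OF that] by (intro measurable_compose[OF _ mf] borel_measurable_divide borel_measurable_diff) auto
  have Y01: "0 \<le> Y i \<omega>" "Y i \<omega> \<le> 1" for i \<omega> by (auto simp: Y_def f01)
  have EY: "(LINT \<omega>|M. Y i \<omega>) = a" if "i < n" for i
  proof -
    note [measurable] = mX[OF that]
    show ?thesis unfolding a_def Y_def
      by (subst standardised_component_distr[OF P E that pos[OF that], symmetric]) (subst integral_distr; simp)
  qed
  have iP: "integrable P f" by (rule P.integrable_const_bound[of _ 1]) (use f01 in auto)
  have a01: "0 \<le> a" "a \<le> 1"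
  proof -
    show "0 \<le> a" unfolding a_def using f01 by (intro integral_nonneg_AE) auto
    have "a \<le> (LINT y|P. 1)" unfolding a_def using f01 iP by (intro integral_mono) auto
    then show "a \<le> 1" using P.prob_space by simp
  qed
  have d1: "\<bar>Y i \<omega> - a\<bar> \<le> 1" for i \<omega> using Y01[of i \<omega>] a01 by (auto simp: abs_if)
  have bd: "\<bar>(Y i \<omega> - a) * (Y j \<omega> - a)\<bar> \<le> 1" for i j \<omega>
    unfolding abs_mult using mult_mono[OF d1[of i \<omega>] d1[of j \<omega>]] by simp
  have iYY: "integrable M (\<lambda>\<omega>. (Y i \<omega> - a) * (Y j \<omega> - a))" if "i < n" "j < n" for i j
    by (rule M.integrable_const_bound[of _ 1]) (use bd mY that in auto)
  \<comment> \<open>The square of the centred average has n^2 terms: the diagonal ones are at most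
    1, the others nonpositive by \<open>NQD_standardised\<close>, which leaves n / n^2.\<close>
  have cov: "(LINT \<omega>|M. (Y i \<omega> - a) * (Y j \<omega> - a)) \<le> of_bool (i = j)" if ij: "i < n" "j < n" for i j
  proof (cases "i = j")
    case True
    have "(LINT \<omega>|M. (Y i \<omega> - a) * (Y j \<omega> - a)) \<le> (LINT \<omega>|M. 1)"
      using iYY[OF ij] bd[of i _ j] by (intro integral_mono) (auto simp: abs_le_iff)
    then show ?thesis using True by (simp add: M.prob_space)
  next
    case False
    have i1: "integrable M (Y i)" "integrable M (Y j)" "integrable M (\<lambda>\<omega>. Y i \<omega> * Y j \<omega>)"
      by (rule M.integrable_const_bound[of _ 1]; use Y01 mY ij in \<open>auto simp: abs_mult intro!: mult_le_one\<close>)+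
    have "(LINT \<omega>|M. (Y i \<omega> - a) * (Y j \<omega> - a)) = (LINT \<omega>|M. Y i \<omega> * Y j \<omega> - a * Y i \<omega> - a * Y j \<omega> + a * a)"
      by (intro Bochner_Integration.integral_cong refl) (simp add: algebra_simps)
    also have "\<dots> = (LINT \<omega>|M. Y i \<omega> * Y j \<omega>) - a * a - a * a + a * a"
      using i1 EY[OF ij(1)] EY[OF ij(2)] by (simp add: M.prob_space)
    also have "\<dots> \<le> 0"
      using NQD_standardised[OF P E pos N ij False f f] unfolding Y_def a_def by simp
    finally show ?thesis using False by simp
  qed
  have A: "(A \<omega> - a)\<^sup>2 = (\<Sum>i<n. \<Sum>j<n. (Y i \<omega> - a) * (Y j \<omega> - a)) / (real n)\<^sup>2" for \<omega>
  proof -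
    have "A \<omega> - a = (\<Sum>i<n. Y i \<omega> - a) / n"
      using n by (simp add: A_def Y_def sum_subtractf diff_divide_distrib)
    then show ?thesis by (simp add: power_divide power2_eq_square sum_product)
  qed
  show "A \<in> borel_measurable M"
    using mY unfolding A_def Y_def by (intro borel_measurable_divide borel_measurable_sum) auto
  show "integrable M (\<lambda>\<omega>. (A \<omega> - (LINT y|P. f y))\<^sup>2)"
    unfolding a_def[symmetric] A
    by (intro integrable_divide Bochner_Integration.integrable_sum iYY) auto
  have "(LINT \<omega>|M. (A \<omega> - a)\<^sup>2) = (\<Sum>i<n. \<Sum>j<n. LINT \<omega>|M. (Y i \<omega> - a) * (Y j \<omega> - a)) / (real n)\<^sup>2"
    unfolding A
    by (intro has_bochner_integral_integral_eq has_bochner_integral_divide has_bochner_integral_sum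
        has_bochner_integral_integrable iYY) auto
  also have "\<dots> \<le> (\<Sum>i<n. \<Sum>j<n. of_bool (i = j)) / (real n)\<^sup>2"
    by (intro divide_right_mono sum_mono cov) auto
  also have "(\<Sum>i<n. \<Sum>j<n. of_bool (i = j)) = real n" by (simp add: of_bool_def)
  also have "real n / (real n)\<^sup>2 = 1 / n" using n by (simp add: power2_eq_square)
  finally show "(LINT \<omega>|M. (A \<omega> - (LINT y|P. f y))\<^sup>2) \<le> 1 / n" unfolding a_def .
qed

text \<open>The square is not monotone, so it is split at 0; on the negative half line the truncated
  square decreases and will enter as 1 minus the second ramp.\<close>

lemma unit_ramp_truncated_square:
  assumes K: "0 < K"
  shows "unit_ramp (\<lambda>y. min ((max 0 y)\<^sup>2) K / K)" "unit_ramp (\<lambda>y. 1 - min ((max 0 (- y))\<^sup>2) K / K)"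
proof -
  have m: "min ((max 0 x)\<^sup>2) K / K \<le> min ((max 0 y)\<^sup>2) K / K" if "x \<le> y" for x y :: real
    using K that by (intro divide_right_mono min.mono power_mono max.mono) auto
  have b: "0 \<le> min ((max 0 x)\<^sup>2) K / K" "min ((max 0 x)\<^sup>2) K / K \<le> 1" for x :: real
    using K by (auto simp: field_simps)
  show "unit_ramp (\<lambda>y. min ((max 0 y)\<^sup>2) K / K)"
    using m b K unfolding unit_ramp_def mono_def by (auto intro!: continuous_intros)
  show "unit_ramp (\<lambda>y. 1 - min ((max 0 (- y))\<^sup>2) K / K)"
    using m b K unfolding unit_ramp_def mono_def by (auto intro!: continuous_intros)
qed

lemma truncated_square_split:
  fixes y :: real
  assumes "0 < K"
  shows "min (y\<^sup>2) K = K * (min ((max 0 y)\<^sup>2) K / K) + K * (1 - (1 - min ((max 0 (- y))\<^sup>2) K / K))"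
  using assms by (cases "0 \<le> y") (auto simp: max_def)

lemma exp_minus_lipschitz:
  fixes x y :: real
  assumes that: "0 \<le> x" "0 \<le> y"
  shows "exp (- x) \<le> exp (- y) + \<bar>x - y\<bar>"
proof (cases "x \<le> y")
  case True
  have "exp (- x) - exp (- y) = exp (- x) * (1 - exp (- (y - x)))"
    by (simp add: right_diff_distrib exp_add[symmetric])
  also have "\<dots> \<le> 1 * (y - x)"
  proof (rule mult_mono)
    show "1 - exp (- (y - x)) \<le> y - x" using exp_ge_add_one_self[of "- (y - x)"] by linarith
  qed (use True that in auto)
  finally show ?thesis using True by simp
next
  case False
  then have "exp (- x) \<le> exp (- y)" by simp
  then show ?thesis by linarith
qed

text \<open>Lets a variance bound control a mean absolute deviation: with d = \<epsilon> and
  variance at most \<epsilon>^2 both terms are at most \<epsilon>.\<close>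

lemma abs_le_add_square:
  fixes x d :: real
  assumes that: "0 < d"
  shows "\<bar>x\<bar> \<le> d + x\<^sup>2 / d"
proof (cases "\<bar>x\<bar> \<le> d")
  case True
  then show ?thesis using that by (simp add: add_increasing2)
next
  case False
  then have "\<bar>x\<bar> * d \<le> \<bar>x\<bar> * \<bar>x\<bar>" by (intro mult_left_mono) auto
  then have "\<bar>x\<bar> \<le> x\<^sup>2 / d" using that by (simp add: power2_eq_square pos_le_divide_eq)
  then show ?thesis using that by simp
qed

text \<open>The truncated mean square G is at most W and concentrates at the truncated moment a. So
  \<psi> u is close to E exp (- u W / 2), which is at most E exp (- u G / 2), which exceeds exp (- u
  a / 2) only by a small error.\<close>

lemma NQD_generator_upper:
  assumes P: "generating_law \<psi> P"
    and H: "\<And>n. 2 \<le> n \<Longrightarrow> \<exists>(M :: 'a measure) X \<mu> S. elliptical n \<mu> S \<psi> M X \<and> (\<forall>i<n. 0 < S i i) \<and> NQD n M X"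
    and u: "0 \<le> u" and K: "0 < K"
  shows "\<psi> u \<le> exp (- u * (LINT y|P. min (y\<^sup>2) K) / 2)"
proof (rule field_le_epsilon)
  fix \<eta> :: real assume \<eta>: "0 < \<eta>"
  interpret P: real_distribution P using P by (simp add: generating_law_def)
  define f1 where "f1 y = min ((max 0 y)\<^sup>2) K / K" for y
  define f2 where "f2 y = 1 - min ((max 0 (- y))\<^sup>2) K / K" for y
  have ur: "unit_ramp f1" "unit_ramp f2"
    using unit_ramp_truncated_square[OF K] by (simp_all add: f1_def[abs_def] f2_def[abs_def])
  have split: "min (y\<^sup>2) K = K * f1 y + K * (1 - f2 y)" for y
    unfolding f1_def f2_def by (rule truncated_square_split[OF K])
  have iP: "integrable P f1" "integrable P f2"
    by (rule P.integrable_const_bound[of _ 1]; use ur unit_ramp_measurable in \<open>auto simp: unit_ramp_def\<close>)+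
  define a1 a2 a where "a1 = (LINT y|P. f1 y)" and "a2 = (LINT y|P. f2 y)" and "a = (LINT y|P. min (y\<^sup>2) K)"
  have a: "a = K * a1 + K * (1 - a2)"
    unfolding a_def a1_def a2_def split using iP P.prob_space by simp
  have a0: "0 \<le> a" unfolding a_def using K by (intro integral_nonneg_AE) auto
  \<comment> \<open>The Laplace limit costs \<epsilon> and the two averages cost u K / 2 * 4
    \<epsilon>, together \<epsilon> (1 + 2 u K) = \<eta>. The choice of N' below keeps their
    variances below \<epsilon>^2.\<close>
  define \<epsilon> where "\<epsilon> = \<eta> / (1 + 2 * u * K)"
  have pos1: "0 < 1 + 2 * u * K" using u K by (intro add_pos_nonneg) auto
  have \<epsilon>: "0 < \<epsilon>" using \<eta> pos1 by (simp add: \<epsilon>_def)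
  obtain N where N: "\<forall>n\<ge>N. \<forall>\<mu> S (M :: 'a measure) X. elliptical n \<mu> S \<psi> M X \<longrightarrow>
      (\<forall>i<n. 0 < S i i) \<longrightarrow> (\<forall>i<n. \<forall>j<n. i \<noteq> j \<longrightarrow> S i j \<le> 0) \<longrightarrow>
      \<bar>(LINT \<omega>|M. exp (- u * mean_square n \<mu> S (X \<omega>) / 2)) - \<psi> u\<bar> < \<epsilon>"
    using mean_square_laplace_limit[OF P u \<epsilon>, where 'a = 'a] by (elim exE conjE)
  obtain N' :: nat where N': "1 / \<epsilon>\<^sup>2 < N'" using reals_Archimedean2 by blast
  define n where "n = N + N' + 2"
  have n: "2 \<le> n" "N \<le> n" "0 < n" "N' \<le> n" by (auto simp: n_def)
  obtain M :: "'a measure" and X \<mu> S where E: "elliptical n \<mu> S \<psi> M X" and pos': "\<forall>i<n. 0 < S i i" and Q: "NQD n M X"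
    using H[OF n(1)] by (elim exE conjE)
  have pos: "0 < S i i" if "i < n" for i using pos' that by simp
  have lim: "\<bar>(LINT \<omega>|M. exp (- u * mean_square n \<mu> S (X \<omega>) / 2)) - \<psi> u\<bar> < \<epsilon>"
    by (rule N[rule_format, OF n(2) E pos NQD_dispersion_nonpos[OF P E pos Q]])
  interpret M: prob_space M using E by (rule elliptical_prob_space)
  define A1 where "A1 \<omega> = (\<Sum>i<n. f1 ((X \<omega> i - \<mu> i) / sqrt (S i i))) / n" for \<omega>
  define A2 where "A2 \<omega> = (\<Sum>i<n. f2 ((X \<omega> i - \<mu> i) / sqrt (S i i))) / n" for \<omega>
  note v1 = NQD_unit_ramp_mean[OF P E pos Q ur(1) n(3), folded A1_def[abs_def] A1_def a1_def]
  note v2 = NQD_unit_ramp_mean[OF P E pos Q ur(2) n(3), folded A2_def[abs_def] A2_def a2_def]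
  define W where "W \<omega> = mean_square n \<mu> S (X \<omega>)" for \<omega>
  have mW: "W \<in> borel_measurable M"
    unfolding W_def mean_square_def using elliptical_component[OF E]
    by (intro borel_measurable_divide borel_measurable_sum borel_measurable_power borel_measurable_diff) auto
  have W0: "0 \<le> W \<omega>" for \<omega> by (simp add: W_def mean_square_def sum_nonneg)
  define G where "G \<omega> = K * A1 \<omega> + K * (1 - A2 \<omega>)" for \<omega>
  have G: "G \<omega> = (\<Sum>i<n. min (((X \<omega> i - \<mu> i) / sqrt (S i i))\<^sup>2) K) / n" for \<omega>
  proof -
    have "(\<Sum>i<n. min (((X \<omega> i - \<mu> i) / sqrt (S i i))\<^sup>2) K) =
      K * (\<Sum>i<n. f1 ((X \<omega> i - \<mu> i) / sqrt (S i i))) + K * (real n - (\<Sum>i<n. f2 ((X \<omega> i - \<mu> i) / sqrt (S i i))))"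
      unfolding split by (simp add: sum.distrib sum_subtractf sum_distrib_left[symmetric])
    then show ?thesis using n(3) by (simp add: G_def A1_def A2_def field_simps)
  qed
  have G0: "0 \<le> G \<omega>" for \<omega> unfolding G using K by (intro divide_nonneg_nonneg sum_nonneg) auto
  have GW: "G \<omega> \<le> W \<omega>" for \<omega>
    unfolding G W_def mean_square_def by (intro divide_right_mono sum_mono) auto
  define B where "B \<omega> = exp (- (u * a / 2)) + u * K / 2 * (2 * \<epsilon> + ((A1 \<omega> - a1)\<^sup>2 + (A2 \<omega> - a2)\<^sup>2) / \<epsilon>)" for \<omega>
  have pw: "exp (- u * W \<omega> / 2) \<le> B \<omega>" for \<omega>
  proof -
    have "exp (- u * W \<omega> / 2) \<le> exp (- (u * G \<omega> / 2))" using u GW[of \<omega>] by (simp add: mult_left_mono)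
    also have "\<dots> \<le> exp (- (u * a / 2)) + \<bar>u * G \<omega> / 2 - u * a / 2\<bar>"
      using u G0 a0 by (intro exp_minus_lipschitz) auto
    also have "u * G \<omega> / 2 - u * a / 2 = u * K / 2 * ((A1 \<omega> - a1) - (A2 \<omega> - a2))"
      unfolding G_def a by (simp add: field_simps)
    also have "\<bar>u * K / 2 * ((A1 \<omega> - a1) - (A2 \<omega> - a2))\<bar> = u * K / 2 * \<bar>(A1 \<omega> - a1) - (A2 \<omega> - a2)\<bar>"
      using u K by (simp add: abs_mult)
    also have "\<bar>(A1 \<omega> - a1) - (A2 \<omega> - a2)\<bar> \<le> 2 * \<epsilon> + ((A1 \<omega> - a1)\<^sup>2 + (A2 \<omega> - a2)\<^sup>2) / \<epsilon>"
      using abs_le_add_square[OF \<epsilon>, of "A1 \<omega> - a1"] abs_le_add_square[OF \<epsilon>, of "A2 \<omega> - a2"]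
        abs_triangle_ineq4[of "A1 \<omega> - a1" "A2 \<omega> - a2"] unfolding add_divide_distrib by linarith
    finally show ?thesis unfolding B_def using u K by (simp add: mult_left_mono)
  qed
  have iB: "integrable M B" unfolding B_def using v1(2) v2(2) by auto
  have iW: "integrable M (\<lambda>\<omega>. exp (- u * W \<omega> / 2))"
    by (rule M.integrable_const_bound[of _ 1]) (use u W0 mW in auto)
  have "\<psi> u \<le> (LINT \<omega>|M. exp (- u * W \<omega> / 2)) + \<epsilon>" using lim unfolding W_def by linarith
  also have "(LINT \<omega>|M. exp (- u * W \<omega> / 2)) \<le> (LINT \<omega>|M. B \<omega>)"
    by (intro integral_mono iW iB pw)
  also have "(LINT \<omega>|M. B \<omega>) = exp (- (u * a / 2)) +
      u * K / 2 * (2 * \<epsilon> + ((LINT \<omega>|M. (A1 \<omega> - a1)\<^sup>2) + (LINT \<omega>|M. (A2 \<omega> - a2)\<^sup>2)) / \<epsilon>)"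
    unfolding B_def using v1(2) v2(2) by (simp add: M.prob_space)
  also have "\<dots> \<le> exp (- (u * a / 2)) + u * K / 2 * (2 * \<epsilon> + (\<epsilon>\<^sup>2 + \<epsilon>\<^sup>2) / \<epsilon>)"
  proof -
    have "1 / \<epsilon>\<^sup>2 \<le> n" using N' n(4) by linarith
    then have "1 / n \<le> \<epsilon>\<^sup>2" using \<epsilon> n(3) by (simp add: divide_le_eq mult.commute)
    then show ?thesis using v1(3) v2(3) u K \<epsilon>
      by (intro add_left_mono mult_left_mono divide_right_mono add_mono) auto
  qed
  also have "\<dots> + \<epsilon> = exp (- u * a / 2) + \<epsilon> * (1 + 2 * u * K)"
    using \<epsilon> by (simp add: power2_eq_square field_simps)
  also have "\<epsilon> * (1 + 2 * u * K) = \<eta>" using pos1 by (simp add: \<epsilon>_def)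
  finally show "\<psi> u \<le> exp (- u * (LINT y|P. min (y\<^sup>2) K) / 2) + \<eta>" unfolding a_def by simp
qed

theorem NQD_imp_gaussian_generator:
  assumes P: "generating_law \<psi> P"
    and H: "\<And>n. 2 \<le> n \<Longrightarrow> \<exists>(M :: 'a measure) X \<mu> S. elliptical n \<mu> S \<psi> M X \<and> (\<forall>i<n. 0 < S i i) \<and> NQD n M X"
  shows "\<exists>v\<ge>0. \<forall>u\<ge>0. \<psi> u = exp (- v * u / 2)"
proof -
  interpret P: real_distribution P using P by (simp add: generating_law_def)
  define a where "a k = (LINT y|P. min (y\<^sup>2) (real k))" for k :: nat
  have up: "\<psi> u \<le> exp (- u * a k / 2)" if "0 \<le> u" "0 < k" for u k
    unfolding a_def using NQD_generator_upper[OF P H that(1)] that(2) by simp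
  have i: "integrable P (\<lambda>y. min (y\<^sup>2) (real k))" for k
    by (rule P.integrable_const_bound[of _ "real k"]) auto
  have inc: "a k \<le> a l" if "k \<le> l" for k l
    unfolding a_def using that i by (intro integral_mono) auto
  \<comment> \<open>By continuity \<psi> exceeds 1/2 at some u0 > 0. Together with \<open>up\<close>
    this bounds all truncated moments at once, which is where the finiteness of the second moment
    comes from.\<close>
  have "\<exists>d>0. \<forall>u\<in>{0..}. dist u 0 < d \<longrightarrow> dist (\<psi> u) (\<psi> 0) < 1 / 2"
    using generating_law_continuous[OF P, unfolded continuous_on_iff, rule_format, of 0 "1 / 2"] by simp
  then obtain d where d: "0 < d" and dd: "\<And>u. 0 \<le> u \<Longrightarrow> u < d \<Longrightarrow> \<bar>\<psi> u - 1\<bar> < 1 / 2"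
    by (auto simp: dist_real_def generating_law_zero[OF P])
  define u0 where "u0 = d / 2"
  have u0: "0 < u0" "1 / 2 < \<psi> u0" using d dd[of u0] by (auto simp: u0_def abs_if split: if_splits)
  have bound: "a k \<le> 2 * ln 2 / u0" for k
  proof -
    \<comment> \<open>\<open>up\<close> is available for positive truncation levels only, hence the
      passage to \<open>Suc k\<close>.\<close>
    have "a k \<le> a (Suc k)" by (rule inc) simp
    also have "a (Suc k) \<le> 2 * ln 2 / u0"
    proof -
      have "1 / 2 < exp (- u0 * a (Suc k) / 2)" using up[of u0 "Suc k"] u0 by simp
      then have "ln (1 / 2) < - u0 * a (Suc k) / 2" by (subst (asm) ln_less_cancel_iff[symmetric]) auto
      then show ?thesis using u0 by (simp add: ln_div field_simps)
    qed
    finally show ?thesis .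
  qed
  have "incseq a" using inc by (simp add: incseq_def)
  then obtain v where v: "a \<longlonglongrightarrow> v"
    using incseq_convergent[of a "2 * ln 2 / u0"] bound by blast
  have conv: "integrable P (\<lambda>y. y\<^sup>2)" "(LINT y|P. y\<^sup>2) = v"
  proof -
    have m: "AE y in P. mono (\<lambda>k. min (y\<^sup>2) (real k))" by (auto simp: mono_def)
    have l: "AE y in P. (\<lambda>k. min (y\<^sup>2) (real k)) \<longlonglongrightarrow> y\<^sup>2"
    proof (rule AE_I2)
      fix y :: real
      obtain N :: nat where "y\<^sup>2 \<le> N" using real_arch_simple by blast
      then have "\<forall>\<^sub>F k in sequentially. min (y\<^sup>2) (real k) = y\<^sup>2"
        by (intro eventually_sequentiallyI[of N]) auto
      then show "(\<lambda>k. min (y\<^sup>2) (real k)) \<longlonglongrightarrow> y\<^sup>2" by (rule tendsto_eventually)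
    qed
    show "integrable P (\<lambda>y. y\<^sup>2)"
      by (rule integrable_monotone_convergence[OF i m l v[unfolded a_def]]) auto
    show "(LINT y|P. y\<^sup>2) = v"
      by (rule integral_monotone_convergence[OF i m l v[unfolded a_def]]) auto
  qed
  have v0: "0 \<le> v" unfolding conv(2)[symmetric] by (intro integral_nonneg_AE) auto
  have eq: "\<psi> u = exp (- v * u / 2)" if u: "0 \<le> u" for u
  proof (rule antisym)
    have "(\<lambda>k. exp (- u * a k / 2)) \<longlonglongrightarrow> exp (- u * v / 2)" by (intro tendsto_intros v) auto
    then have "\<psi> u \<le> exp (- u * v / 2)"
      by (rule LIMSEQ_le_const) (use up[OF u] in \<open>auto intro!: exI[of _ 1]\<close>)
    then show "\<psi> u \<le> exp (- v * u / 2)" by (simp add: mult.commute)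
    show "exp (- v * u / 2) \<le> \<psi> u"
    proof (rule field_le_epsilon)
      fix \<epsilon> :: real assume \<epsilon>: "0 < \<epsilon>"
      obtain N where N: "\<forall>n\<ge>N. \<forall>\<mu> S (M :: 'a measure) X. elliptical n \<mu> S \<psi> M X \<longrightarrow>
          (\<forall>i<n. 0 < S i i) \<longrightarrow> (\<forall>i<n. \<forall>j<n. i \<noteq> j \<longrightarrow> S i j \<le> 0) \<longrightarrow>
          \<bar>(LINT \<omega>|M. exp (- u * mean_square n \<mu> S (X \<omega>) / 2)) - \<psi> u\<bar> < \<epsilon>"
        using mean_square_laplace_limit[OF P u \<epsilon>, where 'a = 'a] by (elim exE conjE)
      define n where "n = N + 2"
      have n: "2 \<le> n" "N \<le> n" "0 < n" by (auto simp: n_def)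
      obtain M :: "'a measure" and X \<mu> S where E: "elliptical n \<mu> S \<psi> M X" and pos': "\<forall>i<n. 0 < S i i" and Q: "NQD n M X"
        using H[OF n(1)] by (elim exE conjE)
      have pos: "0 < S i i" if "i < n" for i using pos' that by simp
      have lim: "\<bar>(LINT \<omega>|M. exp (- u * mean_square n \<mu> S (X \<omega>) / 2)) - \<psi> u\<bar> < \<epsilon>"
        by (rule N[rule_format, OF n(2) E pos NQD_dispersion_nonpos[OF P E pos Q]])
      interpret M: prob_space M using E by (rule elliptical_prob_space)
      define W where "W \<omega> = mean_square n \<mu> S (X \<omega>)" for \<omega>
      have iY: "integrable M (\<lambda>\<omega>. ((X \<omega> i - \<mu> i) / sqrt (S i i))\<^sup>2)" "(LINT \<omega>|M. ((X \<omega> i - \<mu> i) / sqrt (S i i))\<^sup>2) = v"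
        if i: "i < n" for i
      proof -
        note [measurable] = elliptical_component[OF E i]
        have m: "(\<lambda>\<omega>. (X \<omega> i - \<mu> i) / sqrt (S i i)) \<in> borel_measurable M" by measurable
        have sq: "(\<lambda>y. y\<^sup>2) \<in> borel_measurable (borel :: real measure)" by measurable
        note d = standardised_component_distr[OF P E i pos[OF i]]
        show "integrable M (\<lambda>\<omega>. ((X \<omega> i - \<mu> i) / sqrt (S i i))\<^sup>2)"
          using conv(1) integrable_distr_eq[OF m sq] unfolding d by blast
        show "(LINT \<omega>|M. ((X \<omega> i - \<mu> i) / sqrt (S i i))\<^sup>2) = v"
          using conv(2) integral_distr[OF m sq] unfolding d by (simp only:)
      qed
      have iW: "integrable M W" unfolding W_def mean_square_def
        by (intro integrable_divide Bochner_Integration.integrable_sum iY) auto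
      have EW: "(LINT \<omega>|M. W \<omega>) = v"
      proof -
        have "(LINT \<omega>|M. W \<omega>) = (\<Sum>i<n. LINT \<omega>|M. ((X \<omega> i - \<mu> i) / sqrt (S i i))\<^sup>2) / n"
          unfolding W_def mean_square_def
          by (intro has_bochner_integral_integral_eq has_bochner_integral_divide has_bochner_integral_sum
              has_bochner_integral_integrable iY) auto
        then show ?thesis using n(3) by (simp add: iY(2))
      qed
      have W0: "0 \<le> W \<omega>" for \<omega> by (simp add: W_def mean_square_def sum_nonneg)
      \<comment> \<open>The tangent of exp at - v u / 2, evaluated at - u W / 2. Its integral is exp
        (- v u / 2) because W has mean v, which is Jensen's inequality.\<close>
      have tangent: "exp (- v * u / 2) * (1 + (v * u / 2 - u * W \<omega> / 2)) \<le> exp (- u * W \<omega> / 2)" for \<omega>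
      proof -
        have "exp (- v * u / 2) * (1 + (v * u / 2 - u * W \<omega> / 2)) \<le> exp (- v * u / 2) * exp (v * u / 2 - u * W \<omega> / 2)"
          by (intro mult_left_mono exp_ge_add_one_self) auto
        also have "\<dots> = exp (- u * W \<omega> / 2)" by (simp add: exp_add[symmetric])
        finally show ?thesis .
      qed
      have "exp (- v * u / 2) = (LINT \<omega>|M. exp (- v * u / 2) * (1 + (v * u / 2 - u * W \<omega> / 2)))"
        using iW EW by (simp add: M.prob_space mult.commute)
      also have "\<dots> \<le> (LINT \<omega>|M. exp (- u * W \<omega> / 2))"
      proof (rule integral_mono)
        show "integrable M (\<lambda>\<omega>. exp (- u * W \<omega> / 2))"
          by (rule M.integrable_const_bound[of _ 1]) (use u W0 borel_measurable_integrable[OF iW] in auto)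
        show "integrable M (\<lambda>\<omega>. exp (- v * u / 2) * (1 + (v * u / 2 - u * W \<omega> / 2)))" using iW by auto
      qed (rule tangent)
      also have "\<dots> \<le> \<psi> u + \<epsilon>" using lim unfolding W_def by linarith
      finally show "exp (- v * u / 2) \<le> \<psi> u + \<epsilon>" .
    qed
  qed
  show ?thesis using v0 eq by blast
qed

section \<open>Existence of joint mixes and the equivalences\<close>

lemma gaussian_class_contains_joint_mix:
  assumes P: "generating_law \<psi> P" and G: "0 \<le> \<kappa>" "\<And>u. 0 \<le> u \<Longrightarrow> \<psi> u = exp (- \<kappa> * u / 2)" and n: "2 \<le> n"
  obtains M :: "(nat \<Rightarrow> real) measure" and X where "in_elliptical_class \<psi> n M X" "joint_mix n M X"
    "NOD n M X" "NSD n M X" "NA n M X"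
proof -
  define m where "m = n - 1"
  have m: "n = Suc m" "1 \<le> m" using n by (auto simp: m_def)
  have rP: "real_distribution P" using P by (simp add: generating_law_def)
  \<comment> \<open>The coordinates are independent copies of the generating law itself; the
    exponential form of \<psi> enters through its multiplicativity, which makes the vector
    spherical.\<close>
  let ?M = "PiM {..<m} (\<lambda>_. P)"
  have M: "prob_space ?M" using rP by (intro prob_space_PiM) (simp add: real_distribution_def)
  have s: "sets ?M = sets (borel_vec m)" by (rule sets_PiM_real_distribution[OF rP])
  have mult: "\<psi> (u + v) = \<psi> u * \<psi> v" if "0 \<le> u" "0 \<le> v" for u v
  proof -
    have "- \<kappa> * (u + v) / 2 = - \<kappa> * u / 2 + - \<kappa> * v / 2" by (simp add: field_simps)
    then show ?thesis using that by (simp only: G(2) add_nonneg_nonneg exp_add)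
  qed
  have C: "in_elliptical_class \<psi> n ?M (star m)"
    unfolding m(1) by (rule star_in_elliptical_class(2)[OF P m(2) M s iid_PiM_char[OF P mult]])
  have "random_vector n ?M (star m)" using M star_measurable[OF s] by (simp add: random_vector_def m(1))
  then show ?thesis
    using that[OF C] star_joint_mix[OF M s] star_NSD[OF rP, of m] star_NA[OF rP, of m] NSD_imp_NOD
    unfolding m(1) by blast
qed

text \<open>The free components are sqrt (\<kappa> W) Z_k: they share W but are spherical, hence
  uncorrelated once second moments exist. Square integrability of the class, applied to the star
  vector itself, supplies these moments and with them the covariances whose existence NCD
  demands.\<close>

lemma variance_mixture_contains_NCD:
  fixes M0 :: "(nat \<Rightarrow> real) measure"
  assumes P: "generating_law \<psi> P" and C0: "in_elliptical_class \<psi> n0 M0 X0" and sq: "class_square_integrable \<psi>"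
    and G: "gaussian_variance_mixture_family \<psi>" and n: "2 \<le> n"
  shows "class_contains_joint_mix \<psi> NCD n"
proof -
  obtain \<nu> :: "real measure" and \<kappa> where \<nu>: "prob_space \<nu>" "sets \<nu> = sets borel" "AE w in \<nu>. 0 \<le> w" and \<kappa>: "0 \<le> \<kappa>"
    and \<psi>: "\<And>u. 0 \<le> u \<Longrightarrow> \<psi> u = (LINT w|\<nu>. exp (- w * (\<kappa> * u) / 2))"
    using gaussian_variance_mixture_familyD[OF G P C0] by blast
  define m where "m = n - 1"
  have m: "n = Suc m" "1 \<le> m" using n by (auto simp: m_def)
  interpret N: prob_space \<nu> by fact
  interpret G: prob_space "gauss m" by (rule prob_space_gauss)
  interpret NG: pair_prob_space \<nu> "gauss m" ..
  note [measurable_cong] = \<nu>(2)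
  \<comment> \<open>\<open>\<nu>\<close> represents \<psi> only up to the scale \<kappa>; the factor
    sqrt \<kappa> corrects this.\<close>
  define A where "A i j = (if i = j then sqrt \<kappa> else 0)" for i j :: nat
  define T where "T p = affine_vec m m (\<lambda>_. 0) A (sqrt (fst p)) (snd p)" for p :: "real \<times> (nat \<Rightarrow> real)"
  have mT: "T \<in> measurable (\<nu> \<Otimes>\<^sub>M gauss m) (borel_vec m)" unfolding T_def by measurable
  define M where "M = distr (\<nu> \<Otimes>\<^sub>M gauss m) (borel_vec m) T"
  have M: "prob_space M" unfolding M_def by (rule NG.prob_space_distr[OF mT])
  have s: "sets M = sets (borel_vec m)" by (simp add: M_def)
  have ch: "(CLINT z|M. iexp (\<Sum>k<m. a k * z k)) = of_real (\<psi> (\<Sum>k<m. (a k)\<^sup>2))" for a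
  proof -
    have mi: "(\<lambda>z. iexp (\<Sum>k<m. a k * z k)) \<in> borel_measurable (borel_vec m)" by measurable
    have AA: "(\<Sum>l<m. A i l * A j l) = (if i = j then \<kappa> else 0)" if "i < m" for i j
    proof -
      have "(\<Sum>l<m. A i l * A j l) = (\<Sum>l<m. if l = i then A i i * A j i else 0)"
        by (intro sum.cong refl) (auto simp: A_def)
      then show ?thesis using that \<kappa> by (simp add: A_def)
    qed
    have "quad_form m (\<lambda>i j. \<Sum>l<m. A i l * A j l) a = (\<Sum>i<m. \<Sum>j<m. if i = j then \<kappa> * (a i * a j) else 0)"
      unfolding quad_form_def by (intro sum.cong refl) (auto simp: AA)
    also have "\<dots> = \<kappa> * (\<Sum>k<m. (a k)\<^sup>2)" by (simp add: sum_distrib_left power2_eq_square)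
    finally have q: "quad_form m (\<lambda>i j. \<Sum>l<m. A i l * A j l) a = \<kappa> * (\<Sum>k<m. (a k)\<^sup>2)" .
    have "(CLINT z|M. iexp (\<Sum>k<m. a k * z k)) = (CLINT p|\<nu> \<Otimes>\<^sub>M gauss m. iexp (\<Sum>k<m. a k * T p k))"
      unfolding M_def by (rule integral_distr[OF mT mi])
    then show ?thesis
      unfolding T_def integral_affine_mixture[OF \<nu>] q by (simp add: \<psi> sum_nonneg)
  qed
  note E = star_in_elliptical_class(1)[OF P m(2) M s ch] and C = star_in_elliptical_class(2)[OF P m(2) M s ch]
  have "integrable M (\<lambda>\<omega>. (star m \<omega> 0)\<^sup>2)"
    using sq C unfolding class_square_integrable_def by blast
  then have iP: "integrable P (\<lambda>y. y\<^sup>2)"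
    by (rule generating_law_second_moment[OF P E, rotated 2]) (use m in \<open>auto simp: star_dispersion_def\<close>)
  have "NCD (Suc m) M (star m)"
    unfolding NCD_def
  proof (intro allI impI conjI)
    fix i j assume ij: "i < Suc m" "j < Suc m" "i \<noteq> j"
    show "covariance_exists M (\<lambda>\<omega>. star m \<omega> i) (\<lambda>\<omega>. star m \<omega> j)"
      by (rule elliptical_covariance(1)[OF P E ij iP])
    have "star_dispersion m i j \<le> 0" using ij by (auto simp: star_dispersion_def)
    then show "covariance M (\<lambda>\<omega>. star m \<omega> i) (\<lambda>\<omega>. star m \<omega> j) \<le> 0"
      unfolding elliptical_covariance(2)[OF P E ij iP]
      using generating_law_second_moment_pos[OF P iP] by (simp add: mult_le_0_iff)
  qed
  then show ?thesis
    unfolding class_contains_joint_mix_def m(1) using C star_joint_mix[OF M s] by blast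
qed

theorem theorem6:
  fixes \<psi> :: "real \<Rightarrow> real"
  assumes "characteristic_generator \<psi>"
  shows
    "(((\<forall>n\<ge>2. class_contains_joint_mix \<psi> NCD n) \<longrightarrow> gaussian_variance_mixture_family \<psi>) \<and>
      (class_square_integrable \<psi> \<longrightarrow>
        ((\<forall>n\<ge>2. class_contains_joint_mix \<psi> NCD n) \<longleftrightarrow> gaussian_variance_mixture_family \<psi>))) \<and>
     ((\<forall>n\<ge>2. class_contains_joint_mix \<psi> NOD n) \<longleftrightarrow> gaussian_class \<psi>) \<and>
     ((\<forall>n\<ge>2. class_contains_joint_mix \<psi> NSD n) \<longleftrightarrow> gaussian_class \<psi>) \<and>
     ((\<forall>n\<ge>2. class_contains_joint_mix \<psi> NA n) \<longleftrightarrow> gaussian_class \<psi>) \<and>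
     ((\<forall>n\<ge>2. class_contains_joint_mix \<psi> (\<lambda>n M X. NOD n M X \<or> NSD n M X \<or> NA n M X) n)
        \<longleftrightarrow> gaussian_class \<psi>)"
proof -
  obtain n0 and M0 :: "(nat \<Rightarrow> real) measure" and X0 where C0: "in_elliptical_class \<psi> n0 M0 X0"
    using assms by (auto simp: characteristic_generator_def)
  obtain P where P: "generating_law \<psi> P" using generating_law_exists[OF C0] by blast
  let ?any = "\<lambda>n M X. NOD n M X \<or> NSD n M X \<or> NA n M (X :: (nat \<Rightarrow> real) \<Rightarrow> nat \<Rightarrow> real)"
  \<comment> \<open>Proved once from the weakest hypothesis, where the kind of dependence may change
    with n; \<open>weaken\<close> reduces the three separate notions to it.\<close>
  have gaussian: "gaussian_class \<psi>" if any: "\<forall>n\<ge>2. class_contains_joint_mix \<psi> ?any n"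
  proof -
    have "\<exists>(M :: (nat \<Rightarrow> real) measure) X \<mu> S. elliptical n \<mu> S \<psi> M X \<and> (\<forall>i<n. 0 < S i i) \<and> NQD n M X" if n: "2 \<le> n" for n
    proof -
      obtain M :: "(nat \<Rightarrow> real) measure" and X where C: "in_elliptical_class \<psi> n M X" and d: "?any n M X"
        using any n unfolding class_contains_joint_mix_def by blast
      then obtain \<mu> S where E: "elliptical n \<mu> S \<psi> M X" and nd: "nondegenerate n M X"
        by (auto simp: in_elliptical_class_def)
      have rv: "random_vector n M X" using E by (simp add: elliptical_def)
      have "NQD n M X"
        using d NOD_imp_NQD[OF rv] NSD_imp_NOD[OF rv] NA_imp_NQD[OF rv] by blast
      then show ?thesis using E in_elliptical_class_diag_pos[OF P E nd] by blast
    qed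
    then obtain v where "0 \<le> v" "\<And>u. 0 \<le> u \<Longrightarrow> \<psi> u = exp (- v * u / 2)"
      using NQD_imp_gaussian_generator[OF P] by blast
    then show ?thesis by (rule gaussian_classI)
  qed
  have weaken: "class_contains_joint_mix \<psi> ?any n"
    if "class_contains_joint_mix \<psi> NOD n \<or> class_contains_joint_mix \<psi> NSD n \<or> class_contains_joint_mix \<psi> NA n" for n
    using that unfolding class_contains_joint_mix_def by blast
  have contains: "class_contains_joint_mix \<psi> NOD n \<and> class_contains_joint_mix \<psi> NSD n \<and> class_contains_joint_mix \<psi> NA n"
    if gc: "gaussian_class \<psi>" and n: "2 \<le> n" for n
  proof -
    obtain \<kappa> where \<kappa>: "0 \<le> \<kappa>" "\<And>u. 0 \<le> u \<Longrightarrow> \<psi> u = exp (- \<kappa> * u / 2)"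
      using gaussian_classD[OF gc P C0] by blast
    obtain M :: "(nat \<Rightarrow> real) measure" and X where "in_elliptical_class \<psi> n M X" "joint_mix n M X"
      "NOD n M X" "NSD n M X" "NA n M X"
      by (rule gaussian_class_contains_joint_mix[OF P \<kappa> n])
    then show ?thesis unfolding class_contains_joint_mix_def by blast
  qed
  have "(\<forall>n\<ge>2. class_contains_joint_mix \<psi> NCD n) \<longrightarrow> gaussian_variance_mixture_family \<psi>"
    using NCD_imp_variance_mixture[OF P] by blast
  moreover have "\<forall>n\<ge>2. class_contains_joint_mix \<psi> NCD n"
    if "class_square_integrable \<psi>" "gaussian_variance_mixture_family \<psi>"
    using variance_mixture_contains_NCD[OF P C0 that] by blast
  moreover have "(\<forall>n\<ge>2. class_contains_joint_mix \<psi> NOD n) \<longleftrightarrow> gaussian_class \<psi>"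
    using gaussian weaken contains by blast
  moreover have "(\<forall>n\<ge>2. class_contains_joint_mix \<psi> NSD n) \<longleftrightarrow> gaussian_class \<psi>"
    using gaussian weaken contains by blast
  moreover have "(\<forall>n\<ge>2. class_contains_joint_mix \<psi> NA n) \<longleftrightarrow> gaussian_class \<psi>"
    using gaussian weaken contains by blast
  moreover have "(\<forall>n\<ge>2. class_contains_joint_mix \<psi> ?any n) \<longleftrightarrow> gaussian_class \<psi>"
    using gaussian weaken contains by blast
  ultimately show ?thesis by blast
qed

end
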